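(* Let $n\ge 2$ and let $D\subsetneq\mathbb{R}^n$ be a proper subdomain which is Apollonian (i.e. $\mathbb{R}^n\setminus D$ is not contained in a hyperplane). Then the following conditions are quantitatively equivalent: (1) $D$ is an inner $c$-uniform domain; (2) there is a constant $c_1$ such that $k_D(x,y)\le c_1\, j'_D(x,y)$ for all $x,y\in D$; (3) there is a constant $c_2$ such that $\widetilde{\alpha}_D(x,y)\le c_2\, j'_D(x,y)$ for all $x,y\in D$; (4) there is a constant $c_3$ such that each pair of points $x,y\in D$ can be joined by an arc $\gamma$ in $D$ such that $\min\{\operatorname{diam}(\gamma[x,w]),\operatorname{diam}(\gamma[y,w])\}\le c_3\, d_D(w)$ for all $w\in\gamma$, and $\operatorname{diam}(\gamma)\le c_3\,\varrho_D(x,y)$. Here $c,c_1,c_2,c_3$ are constants greater than $1$, and quantitative equivalence means that if one of the conditions holds with its constant, then each of the others holds with a constant depending only on that constant and $n$.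
   Context: $D$ is a proper subdomain (open connected proper nonempty subset) of $\mathbb{R}^n$, $n\ge2$; $d_D(z)$ is the Euclidean distance from $z\in D$ to $\partial D$; $\operatorname{diam}$ is Euclidean diameter; $\ell$ is Euclidean arc length. For a path or arc $\gamma$ and points $z,w$ on it, $\gamma[z,w]$ is the part of $\gamma$ between $z$ and $w$. All paths are assumed rectifiable (finite Euclidean length). Apollonian distance: $\alpha_D(x,y)=\sup_{a,b\in\partial D}\log\frac{|a-x||b-y|}{|a-y||b-x|}$, where the boundary is taken in $\mathbb{R}^n\cup\{\infty\}$ (so $\infty\in\partial D$ when $D$ is unbounded) with the convention $\frac{|\infty-x|}{|\infty-y|}=1$. $D$ is called Apollonian if $\mathbb{R}^n\setminus D$ is not contained in a hyperplane (equivalently, $\alpha_D$ is a metric). For a metric $d$ on $D$ and a path $\gamma:[0,1]\to D$, $d(\gamma)=\sup\sum_{i=0}^{k-1}d(\gamma(t_i),\gamma(t_{i+1}))$ over all finite partitions $0=t_0<\dots<t_k=1$, and the inner metric is $\widetilde d(x,y)=\inf_\gamma d(\gamma)$ over all paths $\gamma$ in $D$ joining $x$ and $y$. $\widetilde\alpha_D$ is the inner metric of $\alpha_D$; $\lambda_D$ is the inner metric of Euclidean distance, i.e. $\lambda_D(x,y)=\inf_\gamma\ell(\gamma)$ over paths $\gamma$ in $D$ joining $x,y$. Inner diameter metric: $\varrho_D(x,y)=\inf_\gamma\operatorname{diam}(\gamma)$ over all arcs $\gamma$ joining $x$ and $y$ in $D$. Further, $j'_D(x,y)=\log\Big(1+\frac{\varrho_D(x,y)}{\min\{d_D(x),d_D(y)\}}\Big)$,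 and the quasihyperbolic metric is $k_D(x,y)=\inf_\gamma\int_\gamma\frac{|dz|}{d_D(z)}$ over paths $\gamma$ joining $x,y$ in $D$. $D$ is inner $c$-uniform if each pair $z_1,z_2\in D$ can be joined by a rectifiable arc $\gamma$ in $D$ with $\min\{\ell(\gamma[z_1,z]),\ell(\gamma[z_2,z])\}\le c\,d_D(z)$ for all $z\in\gamma$, and $\ell(\gamma)\le c\,\lambda_D(z_1,z_2)$. *)

theory Defs
  imports "HOL-Analysis.Analysis"
begin

section \<open>Domains\<close>

definition proper_subdomain :: "'a::euclidean_space set \<Rightarrow> bool" where
  "proper_subdomain D \<longleftrightarrow> open D \<and> connected D \<and> D \<noteq> {} \<and> D \<noteq> UNIV"

definition bdist :: "'a::euclidean_space set \<Rightarrow> 'a \<Rightarrow> real" where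
  "bdist D z = infdist z (frontier D)"

definition apollonian_domain :: "'a::euclidean_space set \<Rightarrow> bool" where
  "apollonian_domain D \<longleftrightarrow> \<not> (\<exists>a b. a \<noteq> 0 \<and> - D \<subseteq> {x. a \<bullet> x = b})"


section \<open>Length of paths and inner metrics\<close>

text \<open>The \<^term>\<open>d\<close>-length of the part of \<^term>\<open>g\<close> parametrized by the interval from
  \<^term>\<open>a\<close> to \<^term>\<open>b\<close>; it may be infinite. The case \<^term>\<open>a = b\<close> is covered by the
  partition with \<^term>\<open>k = (0::nat)\<close>.\<close>

definition dlength :: "('a \<Rightarrow> 'a \<Rightarrow> ereal) \<Rightarrow> (real \<Rightarrow> 'a) \<Rightarrow> real \<Rightarrow> real \<Rightarrow> ereal" where
  "dlength d g a b =
     Sup {(\<Sum>i<k. d (g (t i)) (g (t (Suc i)))) | (t :: nat \<Rightarrow> real) k.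
            t 0 = a \<and> t k = b \<and> (\<forall>i<k. t i < t (Suc i))}"

abbreviation edist :: "'a::metric_space \<Rightarrow> 'a \<Rightarrow> ereal" where
  "edist x y \<equiv> ereal (dist x y)"

definition rectifiable :: "(real \<Rightarrow> 'a::euclidean_space) \<Rightarrow> bool" where
  "rectifiable g \<longleftrightarrow> path g \<and> dlength edist g 0 1 < \<infinity>"

definition joining_path ::
    "'a::euclidean_space set \<Rightarrow> 'a \<Rightarrow> 'a \<Rightarrow> (real \<Rightarrow> 'a) \<Rightarrow> bool" where
  "joining_path D x y g \<longleftrightarrow>
     rectifiable g \<and> path_image g \<subseteq> D \<and> pathstart g = x \<and> pathfinish g = y"

text \<open>An injective path cannot join a point to itself, so the one-point path is admitted as
  a degenerate arc; it is relevant only for \<^term>\<open>x = y\<close>.\<close>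

definition joining_arc ::
    "'a::euclidean_space set \<Rightarrow> 'a \<Rightarrow> 'a \<Rightarrow> (real \<Rightarrow> 'a) \<Rightarrow> bool" where
  "joining_arc D x y g \<longleftrightarrow> joining_path D x y g \<and> (arc g \<or> path_image g = {x})"

definition inner_metric ::
    "('a \<Rightarrow> 'a \<Rightarrow> ereal) \<Rightarrow> 'a::euclidean_space set \<Rightarrow> 'a \<Rightarrow> 'a \<Rightarrow> ereal" where
  "inner_metric d D x y = (INF g\<in>{g. joining_path D x y g}. dlength d g 0 1)"

definition inner_length_metric :: "'a::euclidean_space set \<Rightarrow> 'a \<Rightarrow> 'a \<Rightarrow> ereal" where
  "inner_length_metric D = inner_metric edist D"


section \<open>The Apollonian metric and its inner metric\<close>

text \<open>The boundary in the one-point compactification: \<^term>\<open>None\<close> is the point at infinity.\<close>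

definition ext_frontier :: "'a::euclidean_space set \<Rightarrow> 'a option set" where
  "ext_frontier D = Some ` frontier D \<union> (if bounded D then {} else {None})"

fun dist_ratio :: "'a::euclidean_space option \<Rightarrow> 'a \<Rightarrow> 'a \<Rightarrow> real" where
  "dist_ratio None x y = 1"
| "dist_ratio (Some p) x y = dist p x / dist p y"

definition apollonian_dist :: "'a::euclidean_space set \<Rightarrow> 'a \<Rightarrow> 'a \<Rightarrow> ereal" where
  "apollonian_dist D x y =
     (SUP (a, b) \<in> ext_frontier D \<times> ext_frontier D.
        ereal (ln (dist_ratio a x y * dist_ratio b y x)))"

definition inner_apollonian :: "'a::euclidean_space set \<Rightarrow> 'a \<Rightarrow> 'a \<Rightarrow> ereal" where
  "inner_apollonian D = inner_metric (apollonian_dist D) D"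


section \<open>Inner diameter metric, the function j', quasihyperbolic metric\<close>

definition inner_diam_metric :: "'a::euclidean_space set \<Rightarrow> 'a \<Rightarrow> 'a \<Rightarrow> real" where
  "inner_diam_metric D x y = (INF g\<in>{g. joining_arc D x y g}. diameter (path_image g))"

definition j_inner :: "'a::euclidean_space set \<Rightarrow> 'a \<Rightarrow> 'a \<Rightarrow> real" where
  "j_inner D x y = ln (1 + inner_diam_metric D x y / min (bdist D x) (bdist D y))"

text \<open>The arc length parametrization of a rectifiable path, on the interval from 0 to its
  length. The choice of the parameter \<^term>\<open>t\<close> does not matter, as \<^term>\<open>g\<close> is
  constant on each interval on which the length function is constant.\<close>

definition arclength_param :: "(real \<Rightarrow> 'a::euclidean_space) \<Rightarrow> real \<Rightarrow> 'a" where
  "arclength_param g s = g (SOME t. t \<in> {0..1} \<and> dlength edist g 0 t = ereal s)"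

definition arclength_integral ::
    "('a::euclidean_space \<Rightarrow> real) \<Rightarrow> (real \<Rightarrow> 'a) \<Rightarrow> real" where
  "arclength_integral f g =
     integral {0..real_of_ereal (dlength edist g 0 1)} (\<lambda>s. f (arclength_param g s))"

definition quasihyperbolic :: "'a::euclidean_space set \<Rightarrow> 'a \<Rightarrow> 'a \<Rightarrow> real" where
  "quasihyperbolic D x y =
     (INF g\<in>{g. joining_path D x y g}. arclength_integral (\<lambda>z. 1 / bdist D z) g)"


section \<open>The four conditions\<close>

definition inner_uniform :: "real \<Rightarrow> 'a::euclidean_space set \<Rightarrow> bool" where
  "inner_uniform c D \<longleftrightarrow>
     (\<forall>x\<in>D. \<forall>y\<in>D. \<exists>g. joining_arc D x y g \<and>
        (\<forall>t\<in>{0..1}. min (dlength edist g 0 t) (dlength edist g t 1) \<le> ereal (c * bdist D (g t))) \<and>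
        dlength edist g 0 1 \<le> ereal c * inner_length_metric D x y)"

definition quasihyperbolic_le_j :: "real \<Rightarrow> 'a::euclidean_space set \<Rightarrow> bool" where
  "quasihyperbolic_le_j c D \<longleftrightarrow> (\<forall>x\<in>D. \<forall>y\<in>D. quasihyperbolic D x y \<le> c * j_inner D x y)"

definition inner_apollonian_le_j :: "real \<Rightarrow> 'a::euclidean_space set \<Rightarrow> bool" where
  "inner_apollonian_le_j c D \<longleftrightarrow>
     (\<forall>x\<in>D. \<forall>y\<in>D. inner_apollonian D x y \<le> ereal (c * j_inner D x y))"

definition diameter_inner_uniform :: "real \<Rightarrow> 'a::euclidean_space set \<Rightarrow> bool" where
  "diameter_inner_uniform c D \<longleftrightarrow>
     (\<forall>x\<in>D. \<forall>y\<in>D. \<exists>g. joining_arc D x y g \<and>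
        (\<forall>t\<in>{0..1}. min (diameter (g ` {0..t})) (diameter (g ` {t..1})) \<le> c * bdist D (g t)) \<and>
        diameter (path_image g) \<le> c * inner_diam_metric D x y)"

end

theory Submission
  imports Defs
begin

text \<open>All four conditions are compared with a discrete one. Call two points of the domain a step
  if their distance is at most a quarter of their distances to the boundary, and let \<open>n(x, y)\<close> be
  the least number of steps joining \<open>x\<close> to \<open>y\<close>. The pivot is \<open>n(x, y) \<le> c (j'(x, y) + 1)\<close>.

  Both the quasihyperbolic and the inner Apollonian metric are bounded by multiples of \<open>n\<close>, and by
  \<open>|x - y| / d(x)\<close> on a single step. Conversely \<open>n \<le> 10 k + 2\<close> by cutting a path into pieces of equal
  quasihyperbolic length. A path along which the Apollonian distance stays below \<open>ln 2\<close> remains at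
  distance comparable to \<open>d(x)\<close> from \<open>x\<close> and from the boundary, so a packing argument covers it by
  boundedly many steps; hence \<open>n\<close> is at most a multiple of the inner Apollonian distance plus one.

  Given the pivot, the boundary distances along a shortest chain form a sequence in which a stretch
  with comparable ends and no larger values in between has bounded length. This forces geometric
  growth away from both ends, that is, the cigar condition and total length at most a multiple of
  \<open>\<rho>(x, y)\<close>; erasing loops in the polygon through the chain gives an arc for both notions of
  uniformity.

  If the domain is uniform in either sense, let \<open>\<sigma>\<close> join \<open>x\<close> to \<open>y\<close> with diameter at most
  \<open>2 \<rho>(x, y)\<close>. From each \<open>z \<in> \<sigma>\<close> a cigar leads to a point \<open>f(z)\<close> at distance \<open>\<rho>(x, y) / 8\<close> with
  boundary distance comparable to \<open>\<rho>(x, y)\<close>, using \<open>O(1 + ln (1 + \<rho>(x, y) / d(z)))\<close> steps. For close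
  \<open>z\<close>, \<open>w\<close> the points \<open>f(z)\<close>, \<open>f(w)\<close> are joined by boundedly many steps, and as \<open>\<sigma>\<close> is connected and
  the points \<open>f(z)\<close> lie in a ball of radius \<open>3 \<rho>(x, y)\<close>, packing bounds the steps from \<open>f(x)\<close> to
  \<open>f(y)\<close>.\<close>

section \<open>Length of paths\<close>

text \<open>Counting steps has the resolution of one step, whereas \<open>j'\<close> tends to 0 as
  the points merge. This is why the pivot carries \<open>+ 1\<close>, and why its removal uses the
  finer estimate on a single step.

  Conditions (1) and (4) measure size against different inner metrics. A chain therefore also
  records a bound \<open>l\<close> on its Euclidean length: the inner length metric and \<rho> of
  its ends are both at most \<open>l\<close>, so one weak form of uniformity, with size relative to
  \<open>l\<close>, covers both. In the other direction the constructed arc has length at most a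
  multiple of \<rho>, the smaller of the two.

  The Apollonian distance of nearby points can be arbitrarily small against |x - y| / d(x), namely
  when the complement is almost contained in a hyperplane. Only a jump by the fixed amount ln 2, at
  the scale of d(x), is exploited, and paths are cut where such a jump occurs.\<close>

definition dissection :: "real \<Rightarrow> real \<Rightarrow> nat \<Rightarrow> (nat \<Rightarrow> real) \<Rightarrow> bool" where
  "dissection a b k t \<longleftrightarrow> t 0 = a \<and> t k = b \<and> (\<forall>i<k. t i < t (Suc i))"

lemma dlength_SUP:
  "dlength d g a b = (SUP (t, k) \<in> {(t, k). dissection a b k t}. \<Sum>i<k. d (g (t i)) (g (t (Suc i))))"
  unfolding dlength_def dissection_def by (rule arg_cong[where f = Sup]) auto

lemma sum_le_dlength:
  "dissection a b k t \<Longrightarrow> (\<Sum>i<k. d (g (t i)) (g (t (Suc i)))) \<le> dlength d g a b"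
  unfolding dlength_SUP by (rule SUP_upper2[of "(t, k)"]) auto

lemma dlength_le:
  assumes "\<And>t k. dissection a b k t \<Longrightarrow> (\<Sum>i<k. d (g (t i)) (g (t (Suc i)))) \<le> B"
  shows "dlength d g a b \<le> B"
  unfolding dlength_SUP by (rule SUP_least) (use assms in auto)

lemma dissection_mono: "dissection a b k t \<Longrightarrow> i \<le> j \<Longrightarrow> j \<le> k \<Longrightarrow> t i \<le> t j"
proof (induction j)
  case (Suc j)
  show ?case
  proof (cases "i = Suc j")
    case False
    then have "t i \<le> t j" using Suc by simp
    also have "t j < t (Suc j)" using Suc.prems unfolding dissection_def by auto
    finally show ?thesis by simp
  qed simp
qed simp

lemma dissection_mem: "dissection a b k t \<Longrightarrow> i \<le> k \<Longrightarrow> t i \<in> {a..b}"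
  using dissection_mono[of a b k t 0 i] dissection_mono[of a b k t i k]
  by (auto simp: dissection_def)

lemma dissection_single: "a < b \<Longrightarrow> dissection a b 1 (\<lambda>i. if i = 0 then a else b)"
  by (auto simp: dissection_def)

lemma dissection_exists: "a \<le> b \<Longrightarrow> \<exists>t k. dissection a b k t"
proof (cases "a = b")
  case True
  then have "dissection a b 0 (\<lambda>_. a)" by (auto simp: dissection_def)
  then show ?thesis by blast
next
  case False
  assume "a \<le> b"
  with False have "a < b" by simp
  from dissection_single[OF this] show ?thesis by blast
qed

lemma dissection_shift:
  "dissection a b (Suc k) t \<Longrightarrow> dissection (t 1) b k (\<lambda>i. t (Suc i))"
  by (auto simp: dissection_def)

lemma dissection_shift_less: "dissection a b (Suc k) t \<Longrightarrow> a < t 1"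
  by (auto simp: dissection_def)

lemma dissection_refl: "dissection a a k t \<Longrightarrow> k = 0"
  using dissection_shift_less[of a a "k - 1" t] dissection_mem[of a a k t 1]
  by (cases k) auto

lemma dlength_refl: "dlength d g a a = 0"
proof (rule antisym)
  show "dlength d g a a \<le> 0" by (rule dlength_le) (auto dest: dissection_refl)
  show "0 \<le> dlength d g a a"
    using sum_le_dlength[of a a 0 "\<lambda>_. a" d g] by (auto simp: dissection_def)
qed

lemma dlength_ge:
  assumes "a < b" shows "d (g a) (g b) \<le> dlength d g a b"
  using sum_le_dlength[OF dissection_single[OF assms], of d g] by simp

lemma dlength_cong:
  assumes "\<And>t. t \<in> {a..b} \<Longrightarrow> g t = h t"
  shows "dlength d g a b = dlength d h a b"
  unfolding dlength_SUP
  by (rule SUP_cong) (use assms dissection_mem in \<open>auto intro!: sum.cong\<close>)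

lemma dissection_concat:
  assumes "dissection a b k t" "dissection b c l u"
  defines "v \<equiv> \<lambda>i. if i \<le> k then t i else u (i - k)"
  shows "dissection a c (k + l) v"
    and "(\<Sum>i<k+l. f (v i) (v (Suc i))) = (\<Sum>i<k. f (t i) (t (Suc i))) + (\<Sum>i<l. f (u i) (u (Suc i)))"
proof -
  have jn: "t k = u 0" "t 0 = a" "u l = c" using assms(1,2) by (simp_all add: dissection_def)
  have v1: "v i = t i" if "i \<le> k" for i using that by (simp add: v_def)
  have v2: "v (k + i) = u i" for i
    using jn by (cases "i = 0") (simp_all add: v_def)
  have v2': "v (Suc (k + i)) = u (Suc i)" for i using v2[of "Suc i"] by simp
  have "v i < v (Suc i)" if "i < k + l" for i
  proof (cases "i < k")
    case True
    then have "t i < t (Suc i)" using assms(1) by (simp add: dissection_def)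
    then show ?thesis using True v1[of i] v1[of "Suc i"] by simp
  next
    case False
    define j where "j = i - k"
    have j: "i = k + j" "j < l" using that False by (auto simp: j_def)
    then have "u j < u (Suc j)" using assms(2) by (simp add: dissection_def)
    then show ?thesis using v2[of j] v2'[of j] j by simp
  qed
  then show "dissection a c (k + l) v"
    using jn v1[of 0] v2[of l] by (simp add: dissection_def)
  have "(\<Sum>i<k+l. f (v i) (v (Suc i))) = (\<Sum>i<k. f (v i) (v (Suc i))) + (\<Sum>i<l. f (v (k+i)) (v (Suc (k+i))))"
    by (induction l) (simp_all add: add.assoc)
  then show "(\<Sum>i<k+l. f (v i) (v (Suc i))) = (\<Sum>i<k. f (t i) (t (Suc i))) + (\<Sum>i<l. f (u i) (u (Suc i)))"
    using v1 v2 v2' by simp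
qed

text \<open>Adding extended reals commutes with suprema away from opposite infinities; nonnegativity
  and nonemptiness exclude these.\<close>

lemma Sup_add_Sup_le:
  fixes X :: ereal
  assumes "\<And>x y. x \<in> A \<Longrightarrow> y \<in> B \<Longrightarrow> x + y \<le> X"
    and "\<And>x. x \<in> A \<Longrightarrow> 0 \<le> x" "\<And>y. y \<in> B \<Longrightarrow> 0 \<le> y" "A \<noteq> {}" "B \<noteq> {}"
  shows "Sup A + Sup B \<le> X"
proof -
  have B: "Sup B \<noteq> -\<infinity>" using assms(3,5) Sup_upper2 by fastforce
  have "x + Sup B \<le> X" if x: "x \<in> A" for x
  proof -
    have "x \<noteq> -\<infinity>" using assms(2)[OF x] by auto
    then have "x + Sup B = (SUP y\<in>B. x + y)"
      using SUP_ereal_add_right[of B x "\<lambda>y. y"] assms by simp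
    also have "\<dots> \<le> X" using assms(1) x by (intro SUP_least) auto
    finally show ?thesis .
  qed
  moreover have "Sup A + Sup B = (SUP x\<in>A. x + Sup B)"
    using SUP_ereal_add_left[of A "Sup B" "\<lambda>y. y"] assms B by simp
  ultimately show ?thesis by (auto intro: SUP_least)
qed

text \<open>Concatenated dissections of \<open>{a..b}\<close> and \<open>{b..c}\<close> are among
  those of \<open>{a..c}\<close>. Nonnegativity is asked on the image of the path because the
  Apollonian distance is shown to have it for points of the domain.\<close>

lemma dlength_superadd:
  assumes "\<And>x y. x \<in> g ` {a..c} \<Longrightarrow> y \<in> g ` {a..c} \<Longrightarrow> 0 \<le> d x y" "a \<le> b" "b \<le> c"
  shows "dlength d g a b + dlength d g b c \<le> dlength d g a c"
  unfolding dlength_SUP[of d g a b] dlength_SUP[of d g b c]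
proof -
  let ?S = "\<lambda>a b. (\<lambda>(t, k). \<Sum>i<k. d (g (t i)) (g (t (Suc i)))) ` {(t, k). dissection a b k t}"
  show "Sup (?S a b) + Sup (?S b c) \<le> dlength d g a c"
  proof (rule Sup_add_Sup_le)
    fix x y
    assume "x \<in> ?S a b"
      and "y \<in> ?S b c"
    then obtain t k u l where t: "dissection a b k t" "x = (\<Sum>i<k. d (g (t i)) (g (t (Suc i))))"
      and u: "dissection b c l u" "y = (\<Sum>i<l. d (g (u i)) (g (u (Suc i))))" by auto
    show "x + y \<le> dlength d g a c"
      unfolding t u dissection_concat(2)[OF t(1) u(1), of "\<lambda>x y. d (g x) (g y)", symmetric]
      by (rule sum_le_dlength) (rule dissection_concat[OF t(1) u(1)])
  next
    fix x assume "x \<in> ?S a b"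
    then obtain t k where t: "dissection a b k t" "x = (\<Sum>i<k. d (g (t i)) (g (t (Suc i))))" by auto
    show "0 \<le> x" unfolding t
    proof (intro sum_nonneg assms(1) imageI)
      fix i assume "i \<in> {..<k}"
      then show "t i \<in> {a..c}" "t (Suc i) \<in> {a..c}"
        using dissection_mem[OF t(1), of i] dissection_mem[OF t(1), of "Suc i"] assms(3) by auto
    qed
  next
    fix x assume "x \<in> ?S b c"
    then obtain t k where t: "dissection b c k t" "x = (\<Sum>i<k. d (g (t i)) (g (t (Suc i))))" by auto
    show "0 \<le> x" unfolding t
    proof (intro sum_nonneg assms(1) imageI)
      fix i assume "i \<in> {..<k}"
      then show "t i \<in> {a..c}" "t (Suc i) \<in> {a..c}"
        using dissection_mem[OF t(1), of i] dissection_mem[OF t(1), of "Suc i"] assms(2) by auto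
    qed
  qed (use dissection_exists assms in auto)
qed

lemma dlength_nonneg:
  assumes "\<And>x y. x \<in> g ` {a..b} \<Longrightarrow> y \<in> g ` {a..b} \<Longrightarrow> 0 \<le> d x y" "a \<le> b"
  shows "0 \<le> dlength d g a b"
  using assms dlength_ge[of a b d g] dlength_refl[of d g a] order_trans[of 0 "d (g a) (g b)"]
  by (cases "a = b") auto

text \<open>Extended reals do not cancel, so the estimates of \<open>dlength_subadd\<close> are
  closed by this monoid fact and the next one.\<close>

lemma add_le_via_right:
  fixes x :: "'b::ordered_comm_monoid_add"
  assumes "s \<le> b + c" "x + b \<le> a" shows "x + s \<le> a + c"
  using add_left_mono[OF assms(1), of x] add_right_mono[OF assms(2), of c]
  by (simp add: add.assoc)

lemma add_le_via_left:
  fixes x :: "'b::ordered_comm_monoid_add"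
  assumes "x \<le> a + y" "y + s \<le> c" shows "x + s \<le> a + c"
  using add_right_mono[OF assms(1), of s] add_left_mono[OF assms(2), of a]
  by (simp add: add.assoc)

text \<open>Inserting \<open>b\<close> into a dissection of \<open>{a..c}\<close> does not decrease
  its sum, by the triangle inequality. The induction removes the first interval and moves
  \<open>a\<close> to \<open>t 1\<close>.\<close>

lemma dlength_subadd:
  assumes tri: "\<And>x y z. x \<in> g ` {a..c} \<Longrightarrow> y \<in> g ` {a..c} \<Longrightarrow> z \<in> g ` {a..c} \<Longrightarrow> d x z \<le> d x y + d y z"
    and nn: "\<And>x y. x \<in> g ` {a..c} \<Longrightarrow> y \<in> g ` {a..c} \<Longrightarrow> 0 \<le> d x y"
    and ab: "a \<le> b" "b \<le> c"
  shows "dlength d g a c \<le> dlength d g a b + dlength d g b c"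
proof (rule dlength_le)
  fix t k assume "dissection a c k t"
  with tri nn ab show "(\<Sum>i<k. d (g (t i)) (g (t (Suc i)))) \<le> dlength d g a b + dlength d g b c"
  proof (induction k arbitrary: a t)
    case 0
    then have "a = c" by (auto simp: dissection_def)
    then show ?case using 0 by (auto simp: dlength_refl)
  next
    case (Suc k)
    have p: "dissection a c (Suc k) t" by (rule Suc.prems)
    have tri': "d x z \<le> d x y + d y z"
      if "x \<in> g ` {a'..b'}" "y \<in> g ` {a'..b'}" "z \<in> g ` {a'..b'}" "a \<le> a'" "b' \<le> c" for x y z a' b'
      by (rule Suc.prems) (use that in force)+
    have nn': "0 \<le> d x y"
      if "x \<in> g ` {a'..b'}" "y \<in> g ` {a'..b'}" "a \<le> a'" "b' \<le> c" for x y a' b'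
      by (rule Suc.prems) (use that in force)+
    let ?u = "\<lambda>i. t (Suc i)"
    have a: "a < t 1" "t 0 = a" "t 1 \<le> c" using p dissection_shift_less dissection_mem[OF p, of 1]
      by (auto simp: dissection_def)
    have sum: "(\<Sum>i<Suc k. d (g (t i)) (g (t (Suc i)))) = d (g a) (g (t 1)) + (\<Sum>i<k. d (g (?u i)) (g (?u (Suc i))))"
      unfolding sum.lessThan_Suc_shift using a by simp
    have pu: "dissection (t 1) c k ?u" using p by (rule dissection_shift)
    \<comment> \<open>Either \<open>b\<close> lies beyond the first interval and the induction
      hypothesis handles the rest, or \<open>b = a\<close>, or \<open>b\<close> splits the first
      interval and the triangle inequality is applied there.\<close>
    consider "b \<ge> t 1" | "a = b" | "a < b" "b < t 1" using Suc.prems by linarith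
    then show ?case
    proof cases
      case 1
      have "(\<Sum>i<k. d (g (?u i)) (g (?u (Suc i)))) \<le> dlength d g (t 1) b + dlength d g b c"
        by (rule Suc.IH[OF tri'[of _ "t 1" c] nn'[of _ "t 1" c] 1 Suc.prems(4) pu]) (use a in auto)
      moreover have "d (g a) (g (t 1)) + dlength d g (t 1) b \<le> dlength d g a b"
      proof -
        have "d (g a) (g (t 1)) + dlength d g (t 1) b \<le> dlength d g a (t 1) + dlength d g (t 1) b"
          by (intro add_right_mono dlength_ge a)
        also have "\<dots> \<le> dlength d g a b"
          by (rule dlength_superadd[OF nn'[of _ a b]]) (use a 1 Suc.prems(4) in auto)
        finally show ?thesis .
      qed
      ultimately show ?thesis unfolding sum by (rule add_le_via_right)
    next
      case 2
      then show ?thesis using sum_le_dlength[OF p, of d g] by (simp add: dlength_refl)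
    next
      case 3
      have "d (g a) (g (t 1)) \<le> d (g a) (g b) + d (g b) (g (t 1))"
        by (rule tri'[of _ a c]) (use 3 a Suc.prems(4) in auto)
      also have "d (g a) (g b) \<le> dlength d g a b" by (rule dlength_ge) (rule 3)
      finally have A: "d (g a) (g (t 1)) \<le> dlength d g a b + d (g b) (g (t 1))"
        by (simp add: add_right_mono)
      have "d (g b) (g (t 1)) + (\<Sum>i<k. d (g (?u i)) (g (?u (Suc i)))) \<le> dlength d g b (t 1) + dlength d g (t 1) c"
        by (intro add_mono dlength_ge 3 sum_le_dlength pu)
      also have "\<dots> \<le> dlength d g b c"
        by (rule dlength_superadd[OF nn'[of _ b c]]) (use a 3 in auto)
      finally have "d (g b) (g (t 1)) + (\<Sum>i<k. d (g (?u i)) (g (?u (Suc i)))) \<le> dlength d g b c" .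
      from A this show ?thesis unfolding sum by (rule add_le_via_left)
    qed
  qed
qed

lemma dlength_strict_mono_le:
  assumes "strict_mono \<phi>"
  shows "dlength d (\<lambda>t. g (\<phi> t)) a b \<le> dlength d g (\<phi> a) (\<phi> b)"
proof (rule dlength_le)
  fix t k assume "dissection a b k t"
  then have "dissection (\<phi> a) (\<phi> b) k (\<lambda>i. \<phi> (t i))"
    using assms by (auto simp: dissection_def strict_mono_def)
  from sum_le_dlength[OF this, of d g]
  show "(\<Sum>i<k. d (g (\<phi> (t i))) (g (\<phi> (t (Suc i))))) \<le> dlength d g (\<phi> a) (\<phi> b)" .
qed

text \<open>The inequality of \<open>dlength_strict_mono_le\<close> is used for the affine map and
  for its inverse.\<close>

lemma dlength_affine:
  assumes "m > 0"
  shows "dlength d (\<lambda>t. g (m * t + q)) a b = dlength d g (m * a + q) (m * b + q)"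
proof (rule antisym)
  show "dlength d (\<lambda>t. g (m * t + q)) a b \<le> dlength d g (m * a + q) (m * b + q)"
    using assms by (intro dlength_strict_mono_le[of "\<lambda>t. m * t + q"]) (auto simp: strict_mono_def)
  have "dlength d (\<lambda>t. (\<lambda>t. g (m * t + q)) (inverse m * t + (- q / m))) (m * a + q) (m * b + q)
      \<le> dlength d (\<lambda>t. g (m * t + q)) (inverse m * (m * a + q) + (- q / m)) (inverse m * (m * b + q) + (- q / m))"
    using assms by (intro dlength_strict_mono_le[of "\<lambda>t. inverse m * t + (- q / m)"]) (auto simp: strict_mono_def)
  moreover have "inverse m * (m * a + q) + (- q / m) = a" for a using assms by (simp add: field_simps)
  moreover have "m * (inverse m * a + (- q / m)) + q = a" for a using assms by (simp add: field_simps)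
  ultimately show "dlength d g (m * a + q) (m * b + q) \<le> dlength d (\<lambda>t. g (m * t + q)) a b" by simp
qed

lemma dlength_join_left:
  assumes "a \<le> 1/2" "b \<le> 1/2"
  shows "dlength d (g +++ h) a b = dlength d g (2 * a) (2 * b)"
proof -
  have "dlength d (g +++ h) a b = dlength d (\<lambda>t. g (2 * t + 0)) a b"
    using assms by (intro dlength_cong) (auto simp: joinpaths_def)
  then show ?thesis using dlength_affine[of 2 d g 0] by simp
qed

lemma dlength_join_right:
  assumes "a \<ge> 1/2" "b \<ge> 1/2" "pathfinish g = pathstart h"
  shows "dlength d (g +++ h) a b = dlength d h (2 * a - 1) (2 * b - 1)"
proof -
  have "dlength d (g +++ h) a b = dlength d (\<lambda>t. h (2 * t + (-1))) a b"
  proof (rule dlength_cong)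
    fix t assume "t \<in> {a..b}"
    then have t: "t \<ge> 1/2" using assms by simp
    show "(g +++ h) t = h (2 * t + (-1))"
    proof (cases "t = 1/2")
      case True
      then show ?thesis using assms(3) unfolding True by (simp add: joinpaths_def pathfinish_def pathstart_def)
    qed (use t in \<open>simp add: joinpaths_def\<close>)
  qed
  then show ?thesis using dlength_affine[of 2 d h "-1"] by simp
qed

lemma dlength_subpath:
  assumes "u < v"
  shows "dlength d (subpath u v g) a b = dlength d g ((v - u) * a + u) ((v - u) * b + u)"
  unfolding subpath_def using assms by (intro dlength_affine) auto

lemma dlength_lipschitz:
  assumes "\<And>s t. a \<le> s \<Longrightarrow> s \<le> t \<Longrightarrow> t \<le> b \<Longrightarrow> d (g s) (g t) \<le> ereal (M * (t - s))"
  shows "dlength d g a b \<le> ereal (M * (b - a))"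
proof (rule dlength_le)
  fix t k assume p: "dissection a b k t"
  have "(\<Sum>i<k. d (g (t i)) (g (t (Suc i)))) \<le> (\<Sum>i<k. ereal (M * (t (Suc i) - t i)))"
  proof (rule sum_mono)
    fix i assume "i \<in> {..<k}"
    then have i: "i < k" by simp
    show "d (g (t i)) (g (t (Suc i))) \<le> ereal (M * (t (Suc i) - t i))"
      using dissection_mem[OF p, of i] dissection_mem[OF p, of "Suc i"] i p
      by (intro assms) (auto simp: dissection_def less_imp_le)
  qed
  also have "\<dots> = ereal (M * (\<Sum>i<k. (t (Suc i) - t i)))" by (simp add: sum_distrib_left)
  also have "\<dots> = ereal (M * (b - a))" using p by (simp add: sum_lessThan_telescope dissection_def)
  finally show "(\<Sum>i<k. d (g (t i)) (g (t (Suc i)))) \<le> ereal (M * (b - a))" .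
qed

abbreviation elen :: "(real \<Rightarrow> 'a::metric_space) \<Rightarrow> real \<Rightarrow> real \<Rightarrow> ereal" where
  "elen \<equiv> dlength edist"

lemma dlength_edist_add:
  assumes "a \<le> b" "b \<le> c"
  shows "elen g a c = elen g a b + elen g b c"
proof (rule antisym)
  show "elen g a c \<le> elen g a b + elen g b c"
    using assms by (intro dlength_subadd) (auto simp: dist_triangle)
  show "elen g a b + elen g b c \<le> elen g a c"
    using assms by (intro dlength_superadd) auto
qed

lemma dlength_edist_nonneg: "a \<le> b \<Longrightarrow> 0 \<le> elen g a b"
  by (rule dlength_nonneg) auto

lemma dist_le_dlength: "a \<le> b \<Longrightarrow> edist (g a) (g b) \<le> elen g a b"
  using dlength_ge[of a b edist g] by (cases "a = b") (auto simp: dlength_refl)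

lemma dlength_edist_mono:
  assumes "a' \<le> a" "a \<le> b" "b \<le> b'"
  shows "elen g a b \<le> elen g a' b'"
proof -
  have "elen g a b \<le> elen g a b + elen g b b'"
    using dlength_edist_nonneg[OF assms(3)] by (metis add.right_neutral add_left_mono)
  also have "\<dots> \<le> elen g a' a + (elen g a b + elen g b b')"
    using dlength_edist_nonneg[OF assms(1)] by (metis add.left_neutral add_right_mono)
  also have "\<dots> = elen g a' b'"
    using assms dlength_edist_add[of a b b' g] dlength_edist_add[of a' a b' g] by simp
  finally show ?thesis .
qed

lemma dlength_linepath:
  assumes "0 \<le> a" "a \<le> b"
  shows "elen (linepath x y) a b \<le> ereal (dist x y * (b - a))"
proof (rule dlength_lipschitz)
  fix s t :: real assume "s \<le> t"
  have "linepath x y s - linepath x y t = (t - s) *\<^sub>R (x - y)"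
    by (simp add: linepath_def algebra_simps)
  then show "edist (linepath x y s) (linepath x y t) \<le> ereal (dist x y * (t - s))"
    using \<open>s \<le> t\<close> by (simp add: dist_norm mult.commute)
qed

section \<open>Arc length parametrization\<close>

abbreviation len :: "(real \<Rightarrow> 'a::metric_space) \<Rightarrow> real \<Rightarrow> real" where
  "len g t \<equiv> real_of_ereal (elen g 0 t)"

lemma dlength_rectifiable:
  assumes "rectifiable g" "0 \<le> a" "a \<le> b" "b \<le> 1"
  shows "elen g a b = ereal (len g b - len g a)"
proof -
  have fin: "\<bar>elen g a' b'\<bar> \<noteq> \<infinity>" if "0 \<le> a'" "a' \<le> b'" "b' \<le> 1" for a' b'
    using that dlength_edist_mono[of 0 a' b' 1 g] dlength_edist_nonneg[of a' b' g] assms(1)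
    by (auto simp: rectifiable_def)
  show ?thesis
    using assms(2-) dlength_edist_add[of 0 a b g] fin[of 0 a] fin[of 0 b] fin[of a b]
    by (auto simp: ereal_real)
qed

lemma dlength_len:
  assumes "rectifiable g" "t \<in> {0..1}"
  shows "elen g 0 t = ereal (len g t)"
  using dlength_rectifiable[OF assms(1), of 0 t] assms(2) by (simp add: dlength_refl)

lemma dist_le_len:
  assumes "rectifiable g" "0 \<le> a" "a \<le> b" "b \<le> 1"
  shows "dist (g a) (g b) \<le> len g b - len g a"
  using dist_le_dlength[of a b g] dlength_rectifiable[OF assms] assms by simp

lemma dist_le_len_abs:
  assumes "rectifiable g" "s \<in> {0..1}" "t \<in> {0..1}"
  shows "dist (g s) (g t) \<le> \<bar>len g s - len g t\<bar>"
proof (cases "s \<le> t")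
  case True
  then have "dist (g s) (g t) \<le> len g t - len g s" using assms by (intro dist_le_len) auto
  then show ?thesis by linarith
next
  case False
  then have "dist (g t) (g s) \<le> len g s - len g t" using assms by (intro dist_le_len) auto
  then show ?thesis unfolding dist_commute[of "g s"] by linarith
qed

lemma len_mono:
  assumes "rectifiable g" "0 \<le> a" "a \<le> b" "b \<le> 1"
  shows "len g a \<le> len g b"
  using dist_le_len[OF assms] zero_le_dist[of "g a" "g b"] by linarith

lemma len_0 [simp]: "len g 0 = 0" by (simp add: dlength_refl)

lemma dlength_edist_approx:
  assumes "rectifiable g" "0 \<le> a" "a < b" "b \<le> 1" "e > 0"
  obtains k t where "dissection a b (Suc k) t"
    "(\<Sum>i<Suc k. dist (g (t i)) (g (t (Suc i)))) > len g b - len g a - e"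
proof -
  have "ereal (len g b - len g a - e) < elen g a b"
    unfolding dlength_rectifiable[OF assms(1,2) less_imp_le[OF assms(3)] assms(4)] using assms(5) by simp
  then obtain p where p: "p \<in> {(t, k). dissection a b k t}"
      "ereal (len g b - len g a - e) < (case p of (t, k) \<Rightarrow> \<Sum>i<k. edist (g (t i)) (g (t (Suc i))))"
    unfolding dlength_SUP less_SUP_iff by blast
  obtain t k where tk: "p = (t, k)" by force
  have "k \<noteq> 0" using p(1) assms(3) unfolding tk by (cases k) (auto simp: dissection_def)
  then obtain k' where "k = Suc k'" using not0_implies_Suc by blast
  with p tk that show ?thesis by simp
qed

lemma sum_dist_le_len:
  assumes "rectifiable g" "dissection a b k t" "0 \<le> a" "a \<le> b" "b \<le> 1"
  shows "(\<Sum>i<k. dist (g (t i)) (g (t (Suc i)))) \<le> len g b - len g a"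
  using sum_le_dlength[OF assms(2), of edist g] dlength_rectifiable[OF assms(1,3-)] by simp

text \<open>Take a dissection of \<open>{a..1}\<close> whose sum misses the length by less than e/2,
  and insert a point \<open>s\<close> of its first interval close to \<open>a\<close>. The chord
  from \<open>a\<close> to \<open>s\<close> is shorter than e/2 and the other terms are bounded by
  the length beyond \<open>s\<close>, so no length is concentrated at \<open>a\<close>.\<close>

lemma len_right:
  assumes g: "rectifiable g" and "0 \<le> a" "a < 1" "e > 0"
  shows "\<exists>c>a. c \<le> 1 \<and> (\<forall>s. a \<le> s \<and> s < c \<longrightarrow> len g s < len g a + e)"
proof -
  have cont: "continuous_on {0..1} g" using g by (simp add: rectifiable_def path_def)
  obtain k t where t: "dissection a 1 (Suc k) t"
    "(\<Sum>i<Suc k. dist (g (t i)) (g (t (Suc i)))) > len g 1 - len g a - e / 2"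
    using dlength_edist_approx[OF g assms(2,3), of "e/2"] assms by auto
  obtain \<delta> where d: "\<delta> > 0" "\<And>s. s \<in> {0..1} \<Longrightarrow> dist s a < \<delta> \<Longrightarrow> dist (g s) (g a) < e / 2"
    using continuous_onE[OF cont, of a "e/2"] assms by (metis atLeastAtMost_iff half_gt_zero less_imp_le)
  have t0: "t 0 = a" "a < t 1" "t 1 \<le> 1"
    using t(1) dissection_mem[OF t(1), of 1] by (auto simp: dissection_def)
  define c where "c = min (t 1) (a + \<delta>)"
  have "len g s < len g a + e" if s: "a \<le> s" "s < c" for s
  proof -
    have st: "s < t 1" "s \<in> {0..1}" "dist s a < \<delta>"
      using s t0 assms by (auto simp: c_def dist_real_def)
    have pr: "dissection (t 1) 1 k (\<lambda>i. t (Suc i))" by (rule dissection_shift[OF t(1)])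
    have "(\<Sum>i<Suc k. dist (g (t i)) (g (t (Suc i))))
        = dist (g a) (g (t 1)) + (\<Sum>i<k. dist (g (t (Suc i))) (g (t (Suc (Suc i)))))"
      unfolding sum.lessThan_Suc_shift using t0 by simp
    also have "(\<Sum>i<k. dist (g (t (Suc i))) (g (t (Suc (Suc i))))) \<le> len g 1 - len g (t 1)"
      using sum_dist_le_len[OF g pr] t0 assms by simp
    also have "dist (g a) (g (t 1)) \<le> dist (g s) (g a) + dist (g s) (g (t 1))"
      by (metis dist_commute dist_triangle)
    also have "dist (g s) (g a) < e/2" using d st by blast
    also have "dist (g s) (g (t 1)) \<le> len g (t 1) - len g s"
      using dist_le_len[OF g, of s "t 1"] st t0 by simp
    finally show ?thesis using t(2) by simp
  qed
  moreover have "c > a" "c \<le> 1" using t0 d(1) by (auto simp: c_def)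
  ultimately show ?thesis by blast
qed

text \<open>Mirror image of \<open>len_right\<close>: the last interval of a dissection of
  \<open>{0..b}\<close> is split.\<close>

lemma len_left:
  assumes g: "rectifiable g" and "0 < b" "b \<le> 1" "e > 0"
  shows "\<exists>c<b. 0 \<le> c \<and> (\<forall>s. c < s \<and> s \<le> b \<longrightarrow> len g b - e < len g s)"
proof -
  have cont: "continuous_on {0..1} g" using g by (simp add: rectifiable_def path_def)
  obtain k t where t: "dissection 0 b (Suc k) t"
    "(\<Sum>i<Suc k. dist (g (t i)) (g (t (Suc i)))) > len g b - len g 0 - e / 2"
    using dlength_edist_approx[OF g _ assms(2,3), of "e/2"] assms by auto
  obtain \<delta> where d: "\<delta> > 0" "\<And>s. s \<in> {0..1} \<Longrightarrow> dist s b < \<delta> \<Longrightarrow> dist (g s) (g b) < e / 2"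
    using continuous_onE[OF cont, of b "e/2"] assms by (metis atLeastAtMost_iff half_gt_zero less_imp_le)
  have t0: "t (Suc k) = b" "t k < b" "0 \<le> t k"
    using t(1) dissection_mem[OF t(1), of k] by (auto simp: dissection_def)
  define c where "c = max (t k) (b - \<delta>)"
  have "len g b - e < len g s" if s: "c < s" "s \<le> b" for s
  proof -
    have st: "t k < s" "s \<in> {0..1}" "dist s b < \<delta>"
      using s t0 assms by (auto simp: c_def dist_real_def)
    have pr: "dissection 0 (t k) k t" using t(1) by (auto simp: dissection_def)
    have "(\<Sum>i<Suc k. dist (g (t i)) (g (t (Suc i))))
        = (\<Sum>i<k. dist (g (t i)) (g (t (Suc i)))) + dist (g (t k)) (g b)"
      using t0 by simp
    also have "(\<Sum>i<k. dist (g (t i)) (g (t (Suc i)))) \<le> len g (t k)"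
      using sum_dist_le_len[OF g pr] t0 assms by simp
    also have "dist (g (t k)) (g b) \<le> dist (g (t k)) (g s) + dist (g s) (g b)"
      by (rule dist_triangle)
    also have "dist (g s) (g b) < e/2" using d st by blast
    also have "dist (g (t k)) (g s) \<le> len g s - len g (t k)"
      using dist_le_len[OF g, of "t k" s] st t0 by simp
    finally show ?thesis using t(2) by simp
  qed
  moreover have "c < b" "0 \<le> c" using t0 d(1) by (auto simp: c_def)
  ultimately show ?thesis by blast
qed

lemma continuous_on_len:
  assumes g: "rectifiable g"
  shows "continuous_on {0..1} (len g)"
  unfolding continuous_on_iff
proof (intro ballI allI impI)
  fix b e :: real assume b: "b \<in> {0..1}" and e: "e > 0"
  have "\<exists>d>0. \<forall>s\<in>{0..1}. b \<le> s \<and> s < b + d \<longrightarrow> len g s < len g b + e"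
  proof (cases "b = 1")
    case False
    then obtain c where "c > b" "\<forall>s. b \<le> s \<and> s < c \<longrightarrow> len g s < len g b + e"
      using len_right[OF g, of b e] b e by auto
    then show ?thesis by (intro exI[of _ "c - b"]) auto
  qed (use e in \<open>auto intro!: exI[of _ 1]\<close>)
  then obtain d1 where d1: "d1 > 0" "\<And>s. s \<in> {0..1} \<Longrightarrow> b \<le> s \<Longrightarrow> s < b + d1 \<Longrightarrow> len g s < len g b + e"
    by blast
  have "\<exists>d>0. \<forall>s\<in>{0..1}. b - d < s \<and> s \<le> b \<longrightarrow> len g b - e < len g s"
  proof (cases "b = 0")
    case False
    then obtain c where "c < b" "\<forall>s. c < s \<and> s \<le> b \<longrightarrow> len g b - e < len g s"
      using len_left[OF g, of b e] b e by auto
    then show ?thesis by (intro exI[of _ "b - c"]) auto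
  qed (use e in \<open>auto intro!: exI[of _ 1]\<close>)
  then obtain d2 where d2: "d2 > 0" "\<And>s. s \<in> {0..1} \<Longrightarrow> b - d2 < s \<Longrightarrow> s \<le> b \<Longrightarrow> len g b - e < len g s"
    by blast
  show "\<exists>d>0. \<forall>s\<in>{0..1}. dist s b < d \<longrightarrow> dist (len g s) (len g b) < e"
  proof (intro exI[of _ "min d1 d2"] conjI ballI impI)
    fix s assume s: "s \<in> {0..1}" "dist s b < min d1 d2"
    show "dist (len g s) (len g b) < e"
    proof (cases "b \<le> s")
      case True
      then have "len g s < len g b + e" using d1(2)[of s] s by (auto simp: dist_real_def)
      moreover have "len g b \<le> len g s" using len_mono[OF g, of b s] True s b by auto
      ultimately show ?thesis by (simp add: dist_real_def)
    next
      case False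
      then have "len g b - e < len g s" using d2(2)[of s] s by (auto simp: dist_real_def)
      moreover have "len g s \<le> len g b" using len_mono[OF g, of s b] False s b by auto
      ultimately show ?thesis by (simp add: dist_real_def)
    qed
  qed (use d1 d2 in auto)
qed

lemma len_surj:
  assumes "rectifiable g" "s \<in> {0..len g 1}"
  obtains t where "t \<in> {0..1}" "len g t = s"
  using IVT'[of "len g" 0 s 1] continuous_on_len[OF assms(1)] assms(2) by auto

lemma arclength_param_len:
  assumes g: "rectifiable g" and t: "t \<in> {0..1}"
  shows "arclength_param g (len g t) = g t"
proof -
  define t' where "t' = (SOME u. u \<in> {0..1} \<and> elen g 0 u = ereal (len g t))"
  have "t' \<in> {0..1} \<and> elen g 0 t' = ereal (len g t)"
    unfolding t'_def by (rule someI[of _ t]) (use t dlength_len[OF g t] in auto)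
  then have t': "t' \<in> {0..1}" "len g t' = len g t" by auto
  have "g t' = g t"
    using dist_le_len_abs[OF g t'(1) t] unfolding t'(2) by simp
  then show ?thesis by (simp add: arclength_param_def t'_def)
qed

lemma dist_arclength_param:
  assumes g: "rectifiable g" and s: "s \<in> {0..len g 1}" "s' \<in> {0..len g 1}"
  shows "dist (arclength_param g s) (arclength_param g s') \<le> \<bar>s - s'\<bar>"
proof -
  obtain t where t: "t \<in> {0..1}" "len g t = s" using len_surj[OF g s(1)] .
  obtain t' where t': "t' \<in> {0..1}" "len g t' = s'" using len_surj[OF g s(2)] .
  show ?thesis
    using dist_le_len_abs[OF g t(1) t'(1)] arclength_param_len[OF g t(1)] arclength_param_len[OF g t'(1)]
    unfolding t(2) t'(2) by simp
qed

lemma continuous_on_arclength_param: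
  assumes "rectifiable g"
  shows "continuous_on {0..len g 1} (arclength_param g)"
  unfolding continuous_on_iff
proof (intro ballI allI impI)
  fix s e :: real assume "s \<in> {0..len g 1}" "e > 0"
  then show "\<exists>d>0. \<forall>s'\<in>{0..len g 1}. dist s' s < d \<longrightarrow> dist (arclength_param g s') (arclength_param g s) < e"
    by (intro exI[of _ e] conjI ballI impI le_less_trans[OF dist_arclength_param[OF assms]])
      (simp_all add: dist_real_def)
qed

lemma arclength_param_mem:
  assumes "rectifiable g" "s \<in> {0..len g 1}"
  shows "arclength_param g s \<in> path_image g"
  using len_surj[OF assms] arclength_param_len[OF assms(1)] by (metis imageI path_image_def)

lemma arclength_param_integrable:
  fixes f :: "'a::euclidean_space \<Rightarrow> real"
  assumes "rectifiable g" "continuous_on (path_image g) f"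
  shows "continuous_on {0..len g 1} (\<lambda>s. f (arclength_param g s))"
    and "(\<lambda>s. f (arclength_param g s)) integrable_on {0..len g 1}"
proof -
  show "continuous_on {0..len g 1} (\<lambda>s. f (arclength_param g s))"
    by (rule continuous_on_compose2[OF assms(2) continuous_on_arclength_param[OF assms(1)]])
      (use arclength_param_mem[OF assms(1)] in blast)
  then show "(\<lambda>s. f (arclength_param g s)) integrable_on {0..len g 1}"
    by (rule integrable_continuous_real)
qed

lemma rectifiable_join:
  assumes "rectifiable g" "rectifiable h" "pathfinish g = pathstart h"
  shows "rectifiable (g +++ h)"
    and "\<And>t. t \<in> {0..1/2} \<Longrightarrow> len (g +++ h) t = len g (2 * t)"
    and "\<And>t. t \<in> {1/2..1} \<Longrightarrow> len (g +++ h) t = len g 1 + len h (2 * t - 1)"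
proof -
  have l: "elen (g +++ h) 0 t = elen g 0 (2 * t)" if "t \<in> {0..1/2}" for t
    using dlength_join_left[of 0 t edist g h] that by simp
  have r: "elen (g +++ h) 0 t = ereal (len g 1 + len h (2 * t - 1))" if "t \<in> {1/2..1}" for t
    using dlength_edist_add[of 0 "1/2" t "g +++ h"] dlength_join_right[of "1/2" t g h edist]
      l[of "1/2"] that assms dlength_len[of g 1] dlength_len[of h "2 * t - 1"]
    by simp (metis plus_ereal.simps(1))
  show "rectifiable (g +++ h)" using assms r[of 1] by (auto simp: rectifiable_def)
  show "len (g +++ h) t = len g (2 * t)" if "t \<in> {0..1/2}" for t using l that by simp
  show "len (g +++ h) t = len g 1 + len h (2 * t - 1)" if "t \<in> {1/2..1}" for t using r that by simp
qed

text \<open>The parametrization of the join runs through that of \<open>g\<close> and then, shifted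
  by the length of \<open>g\<close>, through that of \<open>h\<close>.\<close>

lemma arclength_integral_join:
  fixes g h :: "real \<Rightarrow> 'a::euclidean_space"
  assumes g: "rectifiable g" and h: "rectifiable h" and gh: "pathfinish g = pathstart h"
    and f: "continuous_on (path_image g \<union> path_image h) f"
  shows "arclength_integral f (g +++ h) = arclength_integral f g + arclength_integral f h"
proof -
  note j = rectifiable_join[OF g h gh]
  let ?p = "\<lambda>g s. f (arclength_param g s)"
  have L: "len (g +++ h) 1 = len g 1 + len h 1" using j(3)[of 1] by simp
  have nn: "0 \<le> len g 1" "0 \<le> len h 1" using len_mono[OF g, of 0 1] len_mono[OF h, of 0 1] by simp_all
  have pj: "path_image (g +++ h) = path_image g \<union> path_image h" by (rule path_image_join[OF gh])
  have int: "?p (g +++ h) integrable_on {0..len (g +++ h) 1}"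
    by (rule arclength_param_integrable[OF j(1)]) (use f pj in simp)
  have left: "arclength_param (g +++ h) s = arclength_param g s" if s: "s \<in> {0..len g 1}" for s
  proof -
    obtain t where t: "t \<in> {0..1}" "len g t = s" using len_surj[OF g s] .
    have "arclength_param (g +++ h) (len (g +++ h) (t/2)) = (g +++ h) (t/2)"
      by (rule arclength_param_len[OF j(1)]) (use t in auto)
    then show ?thesis using t j(2)[of "t/2"] arclength_param_len[OF g, of t] by (simp add: joinpaths_def)
  qed
  have right: "arclength_param (g +++ h) (s + len g 1) = arclength_param h s" if s: "s \<in> {0..len h 1}" for s
  proof -
    obtain t where t: "t \<in> {0..1}" "len h t = s" using len_surj[OF h s] .
    have "arclength_param (g +++ h) (len (g +++ h) ((t + 1) / 2)) = (g +++ h) ((t + 1) / 2)"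
      by (rule arclength_param_len[OF j(1)]) (use t in auto)
    moreover have "(g +++ h) ((t + 1) / 2) = h t"
      using t gh by (cases "t = 0") (auto simp: joinpaths_def pathfinish_def pathstart_def add_divide_distrib)
    ultimately show ?thesis using t j(3)[of "(t + 1) / 2"] arclength_param_len[OF h, of t]
      by (simp add: add.commute add_divide_distrib)
  qed
  have "arclength_integral f (g +++ h) = integral {0..len g 1} (?p (g +++ h)) + integral {len g 1..len g 1 + len h 1} (?p (g +++ h))"
    unfolding arclength_integral_def L
    by (rule Henstock_Kurzweil_Integration.integral_combine[symmetric]) (use nn int L in auto)
  also have "integral {0..len g 1} (?p (g +++ h)) = arclength_integral f g"
    unfolding arclength_integral_def by (rule integral_cong) (use left in auto)
  also have "integral {len g 1..len g 1 + len h 1} (?p (g +++ h)) = integral {0..len h 1} (\<lambda>s. ?p (g +++ h) (s + len g 1))"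
    using integral_shift_Icc_real[of 0 "len h 1" "?p (g +++ h)" "len g 1"]
    by (simp add: add.commute o_def)
  also have "\<dots> = arclength_integral f h"
    unfolding arclength_integral_def by (rule integral_cong) (use right in auto)
  finally show ?thesis .
qed

section \<open>Polygonal arcs\<close>

lemma rectifiable_linepath: "rectifiable (linepath x y)"
  using dlength_linepath[of 0 1 x y] by (auto simp: rectifiable_def)

lemma dlength_join_0_1:
  assumes "pathfinish g = pathstart h"
  shows "elen (g +++ h) 0 1 = elen g 0 1 + elen h 0 1"
  using dlength_edist_add[of 0 "1/2" 1 "g +++ h"] dlength_join_right[of "1/2" 1 g h edist]
    dlength_join_left[of 0 "1/2" edist g h] assms by simp

lemma rectifiable_subpath:
  assumes "rectifiable P" "0 \<le> u" "u < v" "v \<le> 1"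
  shows "rectifiable (subpath u v P)"
  using assms dlength_subpath[of u v edist P 0 1] dlength_edist_mono[of 0 u v 1 P]
  by (auto simp: rectifiable_def)

lemma subpath_param:
  fixes P :: "real \<Rightarrow> 'a::real_normed_vector"
  assumes "0 \<le> u" "u < 1" "t \<in> {0..1}"
  defines "t' \<equiv> (1 - u) * t + u"
  shows "t' \<in> {u..1}" "subpath u 1 P t = P t'"
    "dlength d (subpath u 1 P) 0 t = dlength d P u t'" "dlength d (subpath u 1 P) t 1 = dlength d P t' 1"
proof -
  have "(1 - u) * t \<le> 1 - u" "0 \<le> (1 - u) * t"
    using assms(1-3) mult_left_mono[of t 1 "1 - u"] by auto
  then show "t' \<in> {u..1}" unfolding t'_def by simp
  show "subpath u 1 P t = P t'" by (simp add: subpath_def t'_def)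
  show "dlength d (subpath u 1 P) 0 t = dlength d P u t'" "dlength d (subpath u 1 P) t 1 = dlength d P t' 1"
    using dlength_subpath[of u 1 d P] assms(2) by (simp_all add: t'_def)
qed

text \<open>Loop erasure must not lose track of where a point came from. Each point of
  \<open>g\<close> is located on the new segment or on \<open>P\<close>, and its lengths to both
  ends of \<open>g\<close> are at most those along the segment followed by \<open>P\<close>.\<close>

abbreviation follows :: "'a::euclidean_space \<Rightarrow> (real \<Rightarrow> 'a) \<Rightarrow> (real \<Rightarrow> 'a) \<Rightarrow> real \<Rightarrow> bool" where
  "follows x P g t \<equiv>
     g t \<in> closed_segment x (pathstart P) \<and> elen g 0 t \<le> edist x (pathstart P)
           \<and> elen g t 1 \<le> edist x (pathstart P) + elen P 0 1 \<or>
         (\<exists>t'\<in>{0..1}. g t = P t' \<and> elen g 0 t \<le> edist x (pathstart P) + elen P 0 t'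
           \<and> elen g t 1 \<le> elen P t' 1)"

text \<open>Loop erasure: the segment is cut at its first meeting point with the arc.\<close>

lemma arc_prepend_segment:
  fixes P :: "real \<Rightarrow> 'a::euclidean_space"
  assumes P: "arc P" "rectifiable P" and x: "x \<noteq> pathfinish P"
  obtains g where "arc g" "rectifiable g" "pathstart g = x" "pathfinish g = pathfinish P"
    "\<And>t. t \<in> {0..1} \<Longrightarrow>
       follows x P g t"
proof -
  let ?y = "pathstart P"
  let ?l = "linepath x ?y"
  \<comment> \<open>The parameters at which the segment meets the arc; 1 belongs to them since the
    segment ends at \<open>pathstart P\<close>.\<close>
  define S where "S = {0..1} \<inter> ?l -` path_image P"
  have "compact S"
    unfolding S_def
    by (intro compact_Int_closed closed_vimage_Int compact_Icc continuous_closed_vimage closed_path_image arc_imp_path P)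
       (auto simp: linepath_def intro!: continuous_intros)
  moreover have "1 \<in> S" by (simp add: S_def linepath_1' pathstart_in_path_image)
  ultimately obtain s where s: "s \<in> S" "\<And>r. r \<in> S \<Longrightarrow> s \<le> r"
    using compact_attains_inf[of S] by blast
  define q where "q = ?l s"
  have s01: "0 \<le> s" "s \<le> 1" and qP: "q \<in> path_image P" using s(1) by (auto simp: S_def q_def)
  then obtain u where u: "u \<in> {0..1}" "P u = q" by (auto simp: path_image_def)
  have qseg: "closed_segment x q \<subseteq> closed_segment x ?y"
    using s01 by (auto simp: q_def linepath_in_path subset_closed_segment)
  have xq: "dist x q \<le> dist x ?y"
    using qseg dist_in_closed_segment(1)[of q x ?y] by (auto simp: dist_commute)
  have lq: "elen (linepath x q) r t \<le> edist x ?y" if "0 \<le> r" "r \<le> t" "t \<le> 1" for r t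
  proof -
    have "dist x q * (t - r) \<le> dist x ?y * 1" by (intro mult_mono xq) (use that in auto)
    then show ?thesis using dlength_linepath[of r t x q] that by (auto intro: order_trans)
  qed
  have mono: "elen P 0 t \<ge> 0" if "t \<in> {0..1}" for t using that by (auto intro: dlength_edist_nonneg)
  \<comment> \<open>Before \<open>q\<close> the segment avoids the arc, as an earlier meeting point
    would give a smaller element of \<open>S\<close>. This makes the join below injective.\<close>
  have first: "r = 1" if r: "r \<in> {0..1}" "linepath x q r \<in> path_image P" "x \<noteq> q" for r
  proof -
    have "linepath x q r = ?l (r * s)" by (simp add: q_def linepath_def algebra_simps)
    moreover have "r * s \<le> 1" using r s01 mult_mono[of r 1 s 1] by auto
    ultimately have "r * s \<in> S" using r s01 by (auto simp: S_def)
    then have "s \<le> r * s" using s(2) by blast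
    moreover have "s > 0"
    proof -
      have "s \<noteq> 0" using r(3) by (auto simp: q_def linepath_0')
      then show ?thesis using s01 by simp
    qed
    ultimately have "1 \<le> r" by (metis mult_1 mult_le_cancel_right_pos)
    then show "r = 1" using r(1) by simp
  qed
  \<comment> \<open>The loop-free path is the segment cut at \<open>q\<close>, followed by
    \<open>P\<close> from parameter \<open>u\<close> on. If \<open>u = 1\<close> the second part
    degenerates to a point, if \<open>x = q\<close> the first one does; a constant path is not an
    arc, so these cases are split off.\<close>
  show thesis
  proof (cases "u = 1")
    case True
    then have q: "q = pathfinish P" using u by (simp add: pathfinish_def)
    show thesis
    proof (rule that[of "linepath x q"])
      show "arc (linepath x q)" using x q by (simp add: arc_linepath)
    next
      fix t :: real assume t: "t \<in> {0..1}"
      have "elen (linepath x q) 0 t \<le> edist x ?y" "elen (linepath x q) t 1 \<le> edist x ?y"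
        using t by (intro lq; simp)+
      moreover have "edist x ?y \<le> edist x ?y + elen P 0 1"
        using mono[of 1] by (metis add.right_neutral add_left_mono atLeastAtMost_iff order_refl zero_le_one)
      ultimately show "follows x P (linepath x q) t"
        using qseg t linepath_in_path[of t x q] by (auto intro: order_trans)
    qed (use q rectifiable_linepath in auto)
  next
    case False
    then have u1: "0 \<le> u" "u < 1" using u by auto
    let ?Q = "subpath u 1 P"
    have Q: "arc ?Q" "rectifiable ?Q" "pathstart ?Q = q" "pathfinish ?Q = pathfinish P"
      using arc_subpath_arc[OF P(1), of u 1] rectifiable_subpath[OF P(2), of u 1] u u1
      by (auto simp: pathfinish_def subpath_def pathstart_def)
    have QP: "path_image ?Q \<subseteq> path_image P" using u by (intro path_image_subpath_subset) auto
    have Qt: "\<exists>t'\<in>{0..1}. ?Q t = P t' \<and> elen ?Q 0 t \<le> elen P 0 t'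
         \<and> elen ?Q t 1 \<le> elen P t' 1" if t: "t \<in> {0..1}" for t
    proof -
      note sp = subpath_param(1)[OF u1 t] subpath_param(2)[OF u1 t, of P] subpath_param(3,4)[OF u1 t, of edist P]
      show ?thesis using sp u1
        by (intro bexI[of _ "(1 - u) * t + u"]) (auto intro: dlength_edist_mono)
    qed
    have PQ: "elen ?Q 0 1 \<le> elen P 0 1"
      using Qt[of 0] u1 dlength_subpath[of u 1 edist P 0 1] dlength_edist_mono[of 0 u 1 1 P] by simp
    show thesis
    proof (cases "x = q")
      case True
      show thesis
      proof (rule that[of ?Q])
        fix t :: real assume t: "t \<in> {0..1}"
        obtain t' where t': "t' \<in> {0..1}" "?Q t = P t'" "elen ?Q 0 t \<le> elen P 0 t'"
         "elen ?Q t 1 \<le> elen P t' 1" using Qt[OF t] by blast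
        have "elen P 0 t' \<le> edist x ?y + elen P 0 t'"
          by (metis add.left_neutral add_right_mono ereal_less_eq(5) zero_le_dist)
        then have "elen ?Q 0 t \<le> edist x ?y + elen P 0 t'" using t'(3) by order
        then show "follows x P ?Q t"
          using t' by blast
      qed (use Q True in auto)
    next
      case False
      let ?g = "linepath x q +++ ?Q"
      have fs: "pathfinish (linepath x q) = pathstart ?Q" using Q by simp
      have len1: "elen ?g 0 1 = elen (linepath x q) 0 1 + elen ?Q 0 1"
        by (rule dlength_join_0_1[OF fs])
      have gl: "elen ?g 0 1 \<le> edist x ?y + elen P 0 1"
        unfolding len1 by (intro add_mono lq PQ) auto
      show thesis
      proof (rule that[of ?g])
        show "arc ?g"
        proof (rule arc_join[OF _ Q(1) fs])
          show "arc (linepath x q)" using False by (simp add: arc_linepath)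
          show "path_image (linepath x q) \<inter> path_image ?Q \<subseteq> {pathstart ?Q}"
          proof
            fix z assume z: "z \<in> path_image (linepath x q) \<inter> path_image ?Q"
            then obtain r where r: "r \<in> {0..1}" "z = linepath x q r" by (auto simp: path_image_def)
            then have "r = 1" using first[of r] z QP False by auto
            then show "z \<in> {pathstart ?Q}" using r Q by (simp add: linepath_1')
          qed
        qed
        have "path ?g" using Q(1) fs by (simp add: arc_imp_path)
        moreover have "elen ?g 0 1 < \<infinity>"
          unfolding len1 using Q(2) rectifiable_linepath[of x q] by (auto simp: rectifiable_def)
        ultimately show "rectifiable ?g" by (simp add: rectifiable_def)
        show "pathstart ?g = x" "pathfinish ?g = pathfinish P" using Q by auto
      next
        fix t :: real assume t: "t \<in> {0..1}"
        show "follows x P ?g t"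
        proof (cases "t \<le> 1/2")
          case True
          then have "?g t = linepath x q (2 * t)" by (simp add: joinpaths_def)
          then have "?g t \<in> closed_segment x ?y" using qseg linepath_in_path[of "2 * t" x q] t True by auto
          moreover have "elen ?g 0 t \<le> edist x ?y"
            using dlength_join_left[of 0 t edist "linepath x q" ?Q] True lq[of 0 "2 * t"] t by simp
          moreover have "elen ?g t 1 \<le> elen ?g 0 1"
            using t by (intro dlength_edist_mono) auto
          ultimately show ?thesis using gl by (auto intro: order_trans)
        next
          case F: False
          let ?r = "2 * t - 1"
          have r: "?r \<in> {0..1}" using F t by auto
          have gt: "?g t = ?Q ?r" using F by (simp add: joinpaths_def)
          obtain t' where t': "t' \<in> {0..1}" "?Q ?r = P t'" "elen ?Q 0 ?r \<le> elen P 0 t'"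
            "elen ?Q ?r 1 \<le> elen P t' 1" using Qt[OF r] by blast
          have "elen ?g 0 t = elen ?g 0 (1/2) + elen ?g (1/2) t"
            using F t by (intro dlength_edist_add) auto
          also have "elen ?g 0 (1/2) = elen (linepath x q) 0 1"
            using dlength_join_left[of 0 "1/2" edist "linepath x q" ?Q] by simp
          also have "elen ?g (1/2) t = elen ?Q 0 ?r"
            using dlength_join_right[of "1/2" t "linepath x q" ?Q edist] F fs by simp
          also have "elen (linepath x q) 0 1 + elen ?Q 0 ?r \<le> edist x ?y + elen P 0 t'"
            by (intro add_mono lq t') auto
          finally have "elen ?g 0 t \<le> edist x ?y + elen P 0 t'" .
          moreover have "elen ?g t 1 = elen ?Q ?r 1"
            using dlength_join_right[of t 1 "linepath x q" ?Q edist] F fs by simp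
          ultimately show ?thesis using t' gt by auto
        qed
      qed
    qed
  qed
qed

abbreviation plen :: "(nat \<Rightarrow> 'a::metric_space) \<Rightarrow> nat set \<Rightarrow> real" where
  "plen p I \<equiv> \<Sum>l\<in>I. dist (p l) (p (Suc l))"

text \<open>The arc is built from the far end, prepending one edge at a time. Edge \<open>i\<close>
  carries the point and is counted in both sums, so the position on the edge is irrelevant.\<close>

lemma polygon_arc:
  fixes p :: "nat \<Rightarrow> 'a::euclidean_space"
  assumes "p 0 \<noteq> p m"
  shows "\<exists>g. arc g \<and> rectifiable g \<and> pathstart g = p 0 \<and> pathfinish g = p m \<and>
    (\<forall>t\<in>{0..1}. \<exists>i<m. g t \<in> closed_segment (p i) (p (Suc i)) \<and>
       elen g 0 t \<le> ereal (plen p {..i}) \<and>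
       elen g t 1 \<le> ereal (plen p {i..<m}))"
  using assms
proof (induction m arbitrary: p)
  case 0
  then show ?case by simp
next
  case (Suc m)
  let ?D = "\<lambda>l. dist (p l) (p (Suc l))"
  show ?case
  \<comment> \<open>If the rest of the polygon starts where it ends, the induction hypothesis does
    not apply, but then the first edge alone is an arc between the right points.\<close>
  proof (cases "p 1 = p (Suc m)")
    case True
    let ?g = "linepath (p 0) (p 1)"
    have "?g t \<in> closed_segment (p 0) (p (Suc 0)) \<and>
       elen ?g 0 t \<le> ereal (\<Sum>l\<le>0. ?D l) \<and>
       elen ?g t 1 \<le> ereal (\<Sum>l\<in>{0..<Suc m}. ?D l)" if t: "t \<in> {0..1}" for t :: real
    proof -
      have "dist (p 0) (p 1) * t \<le> dist (p 0) (p 1) * 1" "dist (p 0) (p 1) * (1 - t) \<le> dist (p 0) (p 1) * 1"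
        by (intro mult_left_mono; use t in auto)+
      moreover have "?D 0 \<le> (\<Sum>l\<in>{0..<Suc m}. ?D l)" by (rule member_le_sum) auto
      ultimately show ?thesis
        using dlength_linepath[of 0 t "p 0" "p 1"] dlength_linepath[of t 1 "p 0" "p 1"] t
          linepath_in_path[of t "p 0" "p 1"] by (auto intro: order_trans simp del: sum.op_ivl_Suc)
    qed
    then show ?thesis using True Suc.prems
      by (intro exI[of _ ?g]) (auto simp: arc_linepath rectifiable_linepath)
  next
    case False
    then obtain P where P: "arc P" "rectifiable P" "pathstart P = p 1" "pathfinish P = p (Suc m)"
      and Pt: "\<And>t. t \<in> {0..1} \<Longrightarrow> \<exists>i<m. P t \<in> closed_segment (p (Suc i)) (p (Suc (Suc i))) \<and>
       elen P 0 t \<le> ereal (\<Sum>l\<le>i. ?D (Suc l)) \<and>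
       elen P t 1 \<le> ereal (\<Sum>l\<in>{i..<m}. ?D (Suc l))"
      using Suc.IH[of "\<lambda>i. p (Suc i)"] by auto
    obtain i0 where i0: "i0 < m" "elen P 0 1 \<le> ereal (\<Sum>l\<in>{i0..<m}. ?D (Suc l))"
      using Pt[of 0] by auto
    have "(\<Sum>l\<in>{i0..<m}. ?D (Suc l)) \<le> (\<Sum>l\<in>{0..<m}. ?D (Suc l))" by (rule sum_mono2) auto
    then have "ereal (\<Sum>l\<in>{i0..<m}. ?D (Suc l)) \<le> ereal (\<Sum>l\<in>{0..<m}. ?D (Suc l))" by simp
    with i0(2) have "elen P 0 1 \<le> ereal (\<Sum>l\<in>{0..<m}. ?D (Suc l))" by order
    then have PL: "edist (p 0) (p 1) + elen P 0 1 \<le> ereal (\<Sum>l\<in>{0..<Suc m}. ?D l)"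
      unfolding sum.atLeast0_lessThan_Suc_shift
      using add_left_mono[of _ _ "edist (p 0) (p 1)"] by fastforce
    obtain g where g: "arc g" "rectifiable g" "pathstart g = p 0" "pathfinish g = p (Suc m)"
      and gt: "\<And>t. t \<in> {0..1} \<Longrightarrow>
       g t \<in> closed_segment (p 0) (p 1) \<and> elen g 0 t \<le> edist (p 0) (p 1)
         \<and> elen g t 1 \<le> edist (p 0) (p 1) + elen P 0 1 \<or>
       (\<exists>t'\<in>{0..1}. g t = P t' \<and> elen g 0 t \<le> edist (p 0) (p 1) + elen P 0 t'
         \<and> elen g t 1 \<le> elen P t' 1)"
      using arc_prepend_segment[OF P(1,2), of "p 0"] P Suc.prems by metis
    have "\<exists>i<Suc m. g t \<in> closed_segment (p i) (p (Suc i)) \<and>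
       elen g 0 t \<le> ereal (\<Sum>l\<le>i. ?D l) \<and>
       elen g t 1 \<le> ereal (\<Sum>l\<in>{i..<Suc m}. ?D l)" if t: "t \<in> {0..1}" for t
      using gt[OF t]
    proof
      assume "g t \<in> closed_segment (p 0) (p 1) \<and> elen g 0 t \<le> edist (p 0) (p 1)
         \<and> elen g t 1 \<le> edist (p 0) (p 1) + elen P 0 1"
      then show ?thesis using PL by (intro exI[of _ 0]) auto
    next
      assume "\<exists>t'\<in>{0..1}. g t = P t' \<and> elen g 0 t \<le> edist (p 0) (p 1) + elen P 0 t'
         \<and> elen g t 1 \<le> elen P t' 1"
      then obtain t' where t': "t' \<in> {0..1}" "g t = P t'"
        "elen g 0 t \<le> edist (p 0) (p 1) + elen P 0 t'"
        "elen g t 1 \<le> elen P t' 1" by blast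
      obtain i where i: "i < m" "P t' \<in> closed_segment (p (Suc i)) (p (Suc (Suc i)))"
       "elen P 0 t' \<le> ereal (\<Sum>l\<le>i. ?D (Suc l))"
       "elen P t' 1 \<le> ereal (\<Sum>l\<in>{i..<m}. ?D (Suc l))" using Pt[OF t'(1)] by blast
      have "edist (p 0) (p 1) + elen P 0 t' \<le> edist (p 0) (p 1) + ereal (\<Sum>l\<le>i. ?D (Suc l))"
        by (rule add_left_mono) (rule i(3))
      also have "\<dots> = ereal (\<Sum>l\<le>Suc i. ?D l)" unfolding sum.atMost_Suc_shift by simp
      finally have "elen g 0 t \<le> ereal (\<Sum>l\<le>Suc i. ?D l)" using t'(3) by order
      moreover have "elen g t 1 \<le> ereal (\<Sum>l\<in>{Suc i..<Suc m}. ?D l)"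
        using t'(4) i(4) unfolding sum.shift_bounds_Suc_ivl by order
      ultimately show ?thesis using i(1,2) t'(2) by (intro exI[of _ "Suc i"]) auto
    qed
    then show ?thesis using g by blast
  qed
qed

text \<open>The classes of the reflexive transitive closure are relatively open, so a connected set
  is a single class.\<close>

lemma connected_rtrancl:
  assumes K: "connected K" "u \<in> K" "v \<in> K"
    and sym: "\<And>x y. E x y \<Longrightarrow> E y x"
    and loc: "\<And>x. x \<in> K \<Longrightarrow> \<exists>e>0. \<forall>y\<in>K. dist x y < e \<longrightarrow> E x y"
  shows "(u, v) \<in> {(x, y). x \<in> K \<and> y \<in> K \<and> E x y}\<^sup>*"
proof -
  let ?R = "{(x, y). x \<in> K \<and> y \<in> K \<and> E x y}"
  show ?thesis
  proof (rule connected_equivalence_relation[OF K, of "\<lambda>u v. (u, v) \<in> ?R\<^sup>*"])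
    have "sym ?R" using sym by (auto simp: sym_def)
    then show "(y, x) \<in> ?R\<^sup>*" if "(x, y) \<in> ?R\<^sup>*" for x y
      using that by (metis sym_rtrancl symD)
    show "(x, z) \<in> ?R\<^sup>*" if "(x, y) \<in> ?R\<^sup>*" "(y, z) \<in> ?R\<^sup>*" for x y z
      using that by (rule rtrancl_trans)
    fix a assume a: "a \<in> K"
    then obtain e where e: "e > 0" "\<forall>y\<in>K. dist a y < e \<longrightarrow> E a y" using loc by blast
    show "\<exists>T. openin (top_of_set K) T \<and> a \<in> T \<and> (\<forall>x\<in>T. (a, x) \<in> ?R\<^sup>*)"
      by (rule exI[of _ "K \<inter> ball a e"]) (use a e in \<open>auto intro!: openin_open_Int r_into_rtrancl\<close>)
  qed
qed

text \<open>Used twice: with \<open>K = U = D\<close> for the existence of rectifiable arcs, and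
  with \<open>U\<close> a thin neighbourhood of \<open>K\<close> to approximate a connected set by
  arcs.\<close>

lemma connected_polygonal_arc:
  fixes U :: "'a::euclidean_space set"
  assumes "open U" "connected K" "K \<subseteq> U" "u \<in> K" "v \<in> K" "u \<noteq> v"
  obtains g where "joining_arc U u v g"
proof -
  let ?E = "\<lambda>x y. closed_segment x y \<subseteq> U"
  have "(u, v) \<in> {(x, y). x \<in> K \<and> y \<in> K \<and> ?E x y}\<^sup>*"
  proof (rule connected_rtrancl[OF assms(2,4,5)])
    fix x assume "x \<in> K"
    then obtain e where e: "e > 0" "ball x e \<subseteq> U" using assms open_contains_ball by blast
    have "closed_segment x y \<subseteq> U" if "dist x y < e" for y
      using e that closed_segment_subset[of x "ball x e" y] by auto
    then show "\<exists>e>0. \<forall>y\<in>K. dist x y < e \<longrightarrow> ?E x y" using e by blast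
  qed (simp add: closed_segment_commute)
  then obtain m p where p: "p 0 = u" "p m = v" "\<And>i. i < m \<Longrightarrow> closed_segment (p i) (p (Suc i)) \<subseteq> U"
    unfolding rtrancl_is_UN_relpow by (auto simp: relpow_fun_conv)
  obtain g where g: "arc g" "rectifiable g" "pathstart g = u" "pathfinish g = v"
    "\<And>t. t \<in> {0..1} \<Longrightarrow> \<exists>i<m. g t \<in> closed_segment (p i) (p (Suc i))"
    using polygon_arc[of p m] p assms(6) by blast
  have "path_image g \<subseteq> U" unfolding path_image_def image_subset_iff using g(5) p(3) by (meson subsetD)
  then show thesis using that[of g] g by (auto simp: joining_arc_def joining_path_def)
qed

section \<open>Chains of short steps\<close>

text \<open>A packing function, uniform in scale and centre. The type argument stands for the
  dimension, so constants built from \<open>N\<close> and the given constant are independent of the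
  domain.\<close>

definition separation_bound :: "(real \<Rightarrow> nat) \<Rightarrow> 'a::metric_space itself \<Rightarrow> bool" where
  "separation_bound N _ \<longleftrightarrow> (\<forall>M s (p::'a) F. s > 0 \<longrightarrow> F \<subseteq> cball p (M * s) \<longrightarrow>
     (\<forall>x\<in>F. \<forall>y\<in>F. x \<noteq> y \<longrightarrow> dist x y > s) \<longrightarrow> card F \<le> N M)"

text \<open>After rescaling to \<open>s = 1\<close>, two points in the same one of finitely many
  balls of radius 1/2 covering \<open>cball 0 M\<close> would be closer than 1.\<close>

lemma separation_bound_exists: "\<exists>N. separation_bound N TYPE('a::euclidean_space)"
proof -
  have "\<exists>n. \<forall>s (p::'a) F. s > 0 \<longrightarrow> F \<subseteq> cball p (M * s) \<longrightarrow>
     (\<forall>x\<in>F. \<forall>y\<in>F. x \<noteq> y \<longrightarrow> dist x y > s) \<longrightarrow> card F \<le> n" for M :: real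
  proof -
    obtain T where T: "finite T" "T \<subseteq> cball (0::'a) M" "cball 0 M \<subseteq> (\<Union>x\<in>T. ball x (1/2))"
      using compactE_image[of "cball (0::'a) M" "cball 0 M" "\<lambda>x. ball x (1/2)"] by force
    have "card F \<le> card T"
      if s: "s > 0" and F: "F \<subseteq> cball p (M * s)" and sep: "\<forall>x\<in>F. \<forall>y\<in>F. x \<noteq> y \<longrightarrow> dist x y > s"
      for s p and F :: "'a set"
    proof -
      have "\<exists>t\<in>T. dist t ((1 / s) *\<^sub>R (x - p)) < 1 / 2" if "x \<in> F" for x
      proof -
        have "norm (x - p) \<le> M * s" using F that by (auto simp: dist_norm norm_minus_commute)
        then have "(1 / s) *\<^sub>R (x - p) \<in> cball 0 M" using s by (simp add: pos_divide_le_eq del: scaleR_diff_right)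
        then obtain t where "t \<in> T" "(1 / s) *\<^sub>R (x - p) \<in> ball t (1/2)" using T(3) by blast
        then show ?thesis by auto
      qed
      then obtain h where h: "\<And>x. x \<in> F \<Longrightarrow> h x \<in> T \<and> dist (h x) ((1 / s) *\<^sub>R (x - p)) < 1 / 2" by metis
      have "inj_on h F"
      proof (rule inj_onI, rule ccontr)
        fix x y assume xy: "x \<in> F" "y \<in> F" "h x = h y" "x \<noteq> y"
        have "dist ((1 / s) *\<^sub>R (x - p)) ((1 / s) *\<^sub>R (y - p)) < 1"
          using h[OF xy(1)] h[OF xy(2)] xy(3)
            dist_triangle2[of "(1 / s) *\<^sub>R (x - p)" "(1 / s) *\<^sub>R (y - p)" "h x"]
          by (simp add: dist_commute)
        moreover have "dist ((1 / s) *\<^sub>R (x - p)) ((1 / s) *\<^sub>R (y - p)) = dist x y / s"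
          using s by (simp add: dist_norm flip: scaleR_diff_right)
        ultimately have "dist x y < s" using s by (simp add: pos_divide_less_eq)
        then show False using sep xy by fastforce
      qed
      then show ?thesis using h T(1) by (intro card_inj_on_le[of h]) auto
    qed
    then show ?thesis by blast
  qed
  then show ?thesis unfolding separation_bound_def by metis
qed

text \<open>In a shortest chain, points at least two steps apart are not related, so the images of
  the points of even index are separated.\<close>

lemma packing_chain:
  fixes f :: "'b::metric_space \<Rightarrow> 'a::euclidean_space"
  assumes N: "separation_bound N TYPE('a)"
    and K: "connected K" "u \<in> K" "v \<in> K"
    and s: "s > 0" and f: "\<And>x. x \<in> K \<Longrightarrow> f x \<in> cball p (M * s)"
    and sym: "\<And>x y. E x y \<Longrightarrow> E y x"
    and loc: "\<And>x. x \<in> K \<Longrightarrow> \<exists>e>0. \<forall>y\<in>K. dist x y < e \<longrightarrow> E x y"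
    and near: "\<And>x y. x \<in> K \<Longrightarrow> y \<in> K \<Longrightarrow> dist (f x) (f y) \<le> s \<Longrightarrow> E x y"
  shows "\<exists>m \<le> 2 * N M. (u, v) \<in> {(x, y). x \<in> K \<and> y \<in> K \<and> E x y} ^^ m"
proof -
  let ?R = "{(x, y). x \<in> K \<and> y \<in> K \<and> E x y}"
  have "\<exists>m. (u, v) \<in> ?R ^^ m"
    using connected_rtrancl[OF K sym loc] by (simp add: rtrancl_is_UN_relpow)
  then obtain m where m: "(u, v) \<in> ?R ^^ m" "\<And>k. k < m \<Longrightarrow> (u, v) \<notin> ?R ^^ k"
    using exists_least_iff[of "\<lambda>m. (u, v) \<in> ?R ^^ m"] by auto
  obtain q where q: "q 0 = u" "q m = v" "\<And>i. i < m \<Longrightarrow> (q i, q (Suc i)) \<in> ?R"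
    using m(1) by (auto simp: relpow_fun_conv)
  have sub: "(q i, q (i + k)) \<in> ?R ^^ k" if "i + k \<le> m" for i k
    unfolding relpow_fun_conv by (rule exI[of _ "\<lambda>j. q (i + j)"]) (use that q(3) in auto)
  have qK: "q i \<in> K" if "i \<le> m" for i
    using q that K by (cases "i = m") (auto simp: le_less)
  have noE: "\<not> E (q i) (q j)" if "i + 2 \<le> j" "j \<le> m" for i j
  proof
    assume "E (q i) (q j)"
    then have "(q i, q j) \<in> ?R" using qK that by auto
    moreover have "(u, q i) \<in> ?R ^^ i" using sub[of 0 i] that q by simp
    ultimately have "(u, q j) \<in> ?R ^^ Suc i" by auto
    moreover have "(q j, v) \<in> ?R ^^ (m - j)" using sub[of j "m - j"] that q by simp
    ultimately have "(u, v) \<in> ?R ^^ (Suc i + (m - j))" unfolding relpow_add by blast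
    with m(2)[of "Suc i + (m - j)"] that show False by simp
  qed
  define h where "h a = f (q (2 * a))" for a
  have far: "dist (h a) (h b) > s" if "a < b" "b \<le> m div 2" for a b
    using near[of "q (2 * a)" "q (2 * b)"] noE[of "2 * a" "2 * b"] qK[of "2 * a"] qK[of "2 * b"] that
    unfolding h_def by force
  have far': "dist (h a) (h b) > s" if "a \<noteq> b" "a \<le> m div 2" "b \<le> m div 2" for a b
    using that far[of a b] far[of b a] by (cases "a < b") (auto simp: dist_commute)
  have "inj_on h {..m div 2}"
    using far' s by (fastforce simp: inj_on_def)
  then have "card (h ` {..m div 2}) = m div 2 + 1" by (simp add: card_image)
  moreover have "card (h ` {..m div 2}) \<le> N M"
  proof -
    have "h ` {..m div 2} \<subseteq> cball p (M * s)" using f qK by (auto simp: h_def)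
    moreover have "\<forall>x\<in>h ` {..m div 2}. \<forall>y\<in>h ` {..m div 2}. x \<noteq> y \<longrightarrow> dist x y > s"
      unfolding ball_simps(9) by (metis atMost_iff far')
    ultimately show ?thesis using N s unfolding separation_bound_def by blast
  qed
  ultimately have "m \<le> 2 * N M" by simp
  then show ?thesis using m(1) by blast
qed

lemma diameter_Un_le:
  fixes A B :: "'b::real_normed_vector set"
  assumes "bounded A" "bounded B" "w \<in> A" "w \<in> B"
  shows "diameter (A \<union> B) \<le> diameter A + diameter B"
proof (rule diameter_le)
  fix x y assume "x \<in> A \<union> B" "y \<in> A \<union> B"
  then have "dist x y \<le> diameter A + diameter B"
    using diameter_bounded_bound[OF assms(1)] diameter_bounded_bound[OF assms(2)] assms(3,4)
      diameter_ge_0[OF assms(1)] diameter_ge_0[OF assms(2)] dist_triangle[of x y w]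
    by (smt (verit) UnE dist_commute)
  then show "norm (x - y) \<le> diameter A + diameter B" by (simp add: dist_norm)
qed (use assms in auto)

lemma diameter_closed_segment:
  fixes u v :: "'a::euclidean_space"
  shows "diameter (closed_segment u v) \<le> dist u v"
proof (rule diameter_le)
  fix x y assume x: "x \<in> closed_segment u v" and y: "y \<in> closed_segment u v"
  show "norm (x - y) \<le> dist u v"
    using segment_furthest_le[OF y, of x] dist_in_closed_segment[OF x]
    by (auto simp: dist_norm norm_minus_commute)
qed simp

section \<open>Steps and chains in a domain\<close>

locale subdomain =
  fixes D :: "'a::euclidean_space set" and N :: "real \<Rightarrow> nat"
  assumes dom: "proper_subdomain D" and N: "separation_bound N TYPE('a)"
begin

lemma open_D: "open D" and connected_D: "connected D"
  using dom by (auto simp: proper_subdomain_def)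

lemma frontier_nonempty: "frontier D \<noteq> {}"
  using dom connected_Int_frontier[of UNIV D] by (auto simp: proper_subdomain_def)

abbreviation "bd \<equiv> bdist D"

lemma bdist_pos: "z \<in> D \<Longrightarrow> 0 < bd z"
  unfolding bdist_def
  by (rule infdist_pos_not_in_closed)
    (use frontier_nonempty open_D in \<open>auto simp: frontier_def interior_open\<close>)

lemma bdist_triangle: "bd x \<le> bd y + dist x y"
  unfolding bdist_def by (rule infdist_triangle)

lemma bdist_le: "p \<in> frontier D \<Longrightarrow> bd z \<le> dist z p"
  unfolding bdist_def by (rule infdist_le)

lemma bdist_attained: obtains p where "p \<in> frontier D" "bd z = dist z p"
  unfolding bdist_def using infdist_attains_inf[OF frontier_closed frontier_nonempty] by blast

lemma ball_bdist_subset: "z \<in> D \<Longrightarrow> ball z (bd z) \<subseteq> D"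
proof
  fix w assume z: "z \<in> D" and w: "w \<in> ball z (bd z)"
  show "w \<in> D"
  proof (rule ccontr)
    assume "w \<notin> D"
    then obtain p where p: "p \<in> frontier D" "p \<in> closed_segment z w"
      using connected_Int_frontier[of "closed_segment z w" D] z by auto
    have "dist z p \<le> dist z w" using dist_in_closed_segment(1)[OF p(2)] by (simp add: dist_commute)
    with bdist_le[OF p(1), of z] w show False by simp
  qed
qed

definition step :: "'a \<Rightarrow> 'a \<Rightarrow> bool" where
  "step u v \<longleftrightarrow> u \<in> D \<and> v \<in> D \<and> 4 * dist u v \<le> min (bd u) (bd v)"

text \<open>\<open>l\<close> is an upper bound for the Euclidean length, not its value, and
  \<open>m\<close> can always be increased by stationary steps. Keeping both allows a chain that is
  short in length to be replaced by one with few steps.\<close>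

inductive chain :: "nat \<Rightarrow> real \<Rightarrow> 'a \<Rightarrow> 'a \<Rightarrow> bool" where
  chain_refl: "u \<in> D \<Longrightarrow> 0 \<le> l \<Longrightarrow> chain 0 l u u"
| chain_step: "step u v \<Longrightarrow> chain m l v w \<Longrightarrow> dist u v + l \<le> l' \<Longrightarrow> chain (Suc m) l' u w"

lemma step_sym: "step u v \<Longrightarrow> step v u" by (auto simp: step_def dist_commute)

lemma step_refl: "u \<in> D \<Longrightarrow> step u u" using bdist_pos by (force simp: step_def)

lemma step_segment: "step u v \<Longrightarrow> closed_segment u v \<subseteq> D"
proof -
  assume s: "step u v"
  have "0 < bd u" using s bdist_pos by (simp add: step_def)
  then have "closed_segment u v \<subseteq> ball u (bd u)"
    using s by (intro closed_segment_subset) (auto simp: step_def)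
  then show ?thesis using ball_bdist_subset[of u] s by (auto simp: step_def)
qed

lemma chain_mem: "chain m l u v \<Longrightarrow> u \<in> D \<and> v \<in> D"
  by (induction rule: chain.induct) (auto simp: step_def)

lemma chain_mono: "chain m l u v \<Longrightarrow> l \<le> l' \<Longrightarrow> chain m l' u v"
  by (erule chain.cases) (auto intro: chain.intros)

lemma chain_pad: "chain m l u v \<Longrightarrow> m \<le> m' \<Longrightarrow> chain m' l u v"
proof (induction "m' - m" arbitrary: m')
  case (Suc n)
  then have m': "m' = Suc (m' - 1)" by simp
  have "chain (m' - 1) l u v" using Suc by auto
  then have "chain (Suc (m' - 1)) l u v"
    using step_refl chain_mem by (intro chain_step[of u u]) auto
  then show ?case using m' by simp
qed simp

lemma chain_trans: "chain m l u v \<Longrightarrow> chain m' l' v z \<Longrightarrow> chain (m + m') (l + l') u z"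
proof (induction rule: chain.induct)
  case (chain_step u v m l w l'')
  have "chain (m + m') (l + l') v z" by (rule chain_step.IH[OF chain_step.prems])
  from chain.chain_step[OF chain_step.hyps(1) this, of "l'' + l'"] chain_step.hyps(3)
  show ?case by simp
qed (auto intro: chain_mono)

lemma chain_single: "step u v \<Longrightarrow> chain 1 (dist u v) u v"
  using chain_step[of u v 0 0 v] chain_refl[of v 0] by (auto simp: step_def)

lemma chain_sym: "chain m l u v \<Longrightarrow> chain m l v u"
proof (induction rule: chain.induct)
  case (chain_step u v m l w l')
  have "chain (m + 1) (l + dist v u) w u"
    by (rule chain_trans[OF chain_step.IH chain_single[OF step_sym]]) (rule chain_step)
  then have "chain (Suc m) (l + dist v u) w u" by simp
  then show ?case by (rule chain_mono) (use chain_step.hyps(3) in \<open>simp add: dist_commute\<close>)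
qed (auto intro: chain_refl)

lemma relpow_chain:
  assumes "(u, v) \<in> R ^^ m" "u \<in> D" "\<And>x y. (x, y) \<in> R \<Longrightarrow> chain k l x y"
  shows "chain (m * k) (m * l) u v"
  using assms(1,2)
proof (induction m arbitrary: v)
  case (Suc m)
  then obtain w where w: "(u, w) \<in> R ^^ m" "(w, v) \<in> R" by auto
  show ?case using chain_trans[OF Suc.IH[OF w(1) Suc.prems(2)] assms(3)[OF w(2)]]
    by (simp add: algebra_simps)
qed (auto intro: chain_refl)

lemma chain_fun:
  assumes "chain m l u v"
  obtains p where "p 0 = u" "p m = v" "\<And>i. i < m \<Longrightarrow> step (p i) (p (Suc i))"
    "plen p {..<m} \<le> l"
proof -
  have "\<exists>p. p 0 = u \<and> p m = v \<and> (\<forall>i<m. step (p i) (p (Suc i))) \<and> plen p {..<m} \<le> l"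
    using assms
  proof (induction rule: chain.induct)
    case (chain_refl u l)
    then show ?case by (intro exI[of _ "\<lambda>_. u"]) auto
  next
    case (chain_step u v m l w l')
    then obtain p where p: "p 0 = v" "p m = w" "\<forall>i<m. step (p i) (p (Suc i))" "plen p {..<m} \<le> l"
      by blast
    show ?case
    proof (intro exI[of _ "case_nat u p"] conjI allI impI)
      fix i assume "i < Suc m"
      then show "step (case_nat u p i) (case_nat u p (Suc i))"
        using p chain_step(1) by (cases i) auto
    next
      show "(\<Sum>i<Suc m. dist (case_nat u p i) (case_nat u p (Suc i))) \<le> l'"
        unfolding sum.lessThan_Suc_shift using p chain_step(3,4) by simp
    qed (use p in auto)
  qed
  then show thesis using that by blast
qed

lemma fun_chain:
  assumes "\<And>i. i < m \<Longrightarrow> step (p i) (p (Suc i))" "p 0 \<in> D"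
  shows "chain m (plen p {..<m}) (p 0) (p m)"
  using assms(1)
proof (induction m)
  case (Suc m)
  then show ?case using chain_trans[of m _ "p 0" "p m" 1 "dist (p m) (p (Suc m))" "p (Suc m)"] chain_single
    by auto
qed (auto intro: chain_refl assms)

text \<open>Points of \<open>K\<close> at distance at most \<open>s / 4\<close> form a step, and in
  units of \<open>s / 4\<close> the ball has radius \<open>4 * M\<close>; the packing argument
  bounds the number of such steps.\<close>

lemma cover_chain:
  assumes K: "connected K" "K \<subseteq> D" "u \<in> K" "v \<in> K" "K \<subseteq> cball p (M * s)"
    and s: "s > 0" "\<And>z. z \<in> K \<Longrightarrow> s \<le> bd z"
  shows "chain (2 * N (4 * M)) (real (2 * N (4 * M)) * s) u v"
proof -
  let ?R = "{(x, y). x \<in> K \<and> y \<in> K \<and> dist x y \<le> s / 4}"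
  have "\<exists>m \<le> 2 * N (4 * M). (u, v) \<in> ?R ^^ m"
    by (rule packing_chain[OF N K(1,3,4), of "s / 4" "\<lambda>x. x" p])
      (use s K in \<open>auto simp: dist_commute intro!: exI[of _ "s/4"]\<close>)
  then obtain m where m: "m \<le> 2 * N (4 * M)" "(u, v) \<in> ?R ^^ m" by blast
  have "chain (m * 1) (m * s) u v"
  proof (rule relpow_chain[OF m(2)])
    fix x y assume "(x, y) \<in> ?R"
    then have xy: "x \<in> K" "y \<in> K" "dist x y \<le> s / 4" by auto
    then have "step x y" using s(2)[of x] s(2)[of y] K(2) by (auto simp: step_def)
    then show "chain 1 s x y" using chain_single chain_mono xy(3) s(1) by fastforce
  qed (use K in auto)
  then have "chain (2 * N (4 * M)) (m * s) u v" using m(1) by (auto intro: chain_pad)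
  then show ?thesis by (rule chain_mono) (use m(1) s(1) in \<open>auto intro!: mult_right_mono simp flip: of_nat_mult\<close>)
qed

lemma chain_exists: "u \<in> D \<Longrightarrow> v \<in> D \<Longrightarrow> \<exists>m l. chain m l u v"
proof -
  assume uv: "u \<in> D" "v \<in> D"
  have "(u, v) \<in> {(x, y). x \<in> D \<and> y \<in> D \<and> step x y}\<^sup>*"
  proof (rule connected_rtrancl[OF connected_D uv])
    fix x assume x: "x \<in> D"
    have "step x y" if "y \<in> D" "dist x y < bd x / 8" for y
      using x that bdist_triangle[of x y] bdist_pos[OF x] unfolding step_def by auto
    then show "\<exists>e>0. \<forall>y\<in>D. dist x y < e \<longrightarrow> step x y"
      using bdist_pos[OF x] by (intro exI[of _ "bd x / 8"]) auto
  qed (rule step_sym)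
  then show ?thesis
  proof (induction rule: rtrancl_induct)
    case base
    then show ?case using chain_refl[OF uv(1), of 0] by blast
  next
    case (step y z)
    then show ?case using chain_trans chain_single by blast
  qed
qed

section \<open>The inner diameter metric\<close>

abbreviation \<rho> where "\<rho> \<equiv> inner_diam_metric D"

lemma joining_arc_const: "u \<in> D \<Longrightarrow> joining_arc D u u (linepath u u)"
  by (auto simp: joining_arc_def joining_path_def rectifiable_linepath)

lemma joining_arc_exists: "u \<in> D \<Longrightarrow> v \<in> D \<Longrightarrow> \<exists>g. joining_arc D u v g"
  using joining_arc_const connected_polygonal_arc[OF open_D connected_D order_refl] by metis

lemma rho_bdd: "bdd_below ((\<lambda>g. diameter (path_image g)) ` {g. joining_arc D u v g})"
  by (rule bdd_belowI2[of _ 0]) (auto simp: joining_arc_def joining_path_def rectifiable_def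
      intro!: diameter_ge_0 bounded_path_image)

lemma rho_le_arc: "joining_arc D u v g \<Longrightarrow> \<rho> u v \<le> diameter (path_image g)"
  unfolding inner_diam_metric_def by (rule cINF_lower[OF rho_bdd]) simp

lemma rho_arc:
  assumes "u \<in> D" "v \<in> D" "\<rho> u v < r"
  obtains g where "joining_arc D u v g" "diameter (path_image g) < r"
  using assms joining_arc_exists[OF assms(1,2)]
  unfolding inner_diam_metric_def by (subst (asm) cINF_less_iff) (auto simp: rho_bdd)

lemma joining_arc_bounded: "joining_arc D u v g \<Longrightarrow> bounded (path_image g)"
  by (auto simp: joining_arc_def joining_path_def rectifiable_def intro: bounded_path_image)

lemma dist_le_rho: "u \<in> D \<Longrightarrow> v \<in> D \<Longrightarrow> dist u v \<le> \<rho> u v"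
proof (rule ccontr)
  assume uv: "u \<in> D" "v \<in> D" and "\<not> dist u v \<le> \<rho> u v"
  then obtain g where g: "joining_arc D u v g" "diameter (path_image g) < dist u v"
    using rho_arc[OF uv, of "dist u v"] by auto
  have "u \<in> path_image g" "v \<in> path_image g"
    using g(1) by (auto simp: joining_arc_def joining_path_def)
  then show False using diameter_bounded_bound[OF joining_arc_bounded[OF g(1)]] g(2) by fastforce
qed

lemma rho_nonneg: "u \<in> D \<Longrightarrow> v \<in> D \<Longrightarrow> 0 \<le> \<rho> u v"
  using dist_le_rho zero_le_dist order_trans by blast

text \<open>A polygonal arc in the e/2-neighbourhood of \<open>K\<close> has diameter at most that
  of \<open>K\<close> plus e. Unions and non-injective paths can thus be used in place of
  arcs.\<close>

lemma rho_le_connected: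
  assumes K: "connected K" "bounded K" "K \<subseteq> D" "u \<in> K" "v \<in> K"
  shows "\<rho> u v \<le> diameter K"
proof (cases "u = v")
  case True
  then have "\<rho> u v \<le> diameter (path_image (linepath u u))"
    using joining_arc_const[of u] K by (intro rho_le_arc) auto
  also have "\<dots> = 0" by simp
  finally show ?thesis using diameter_ge_0[OF K(2)] by simp
next
  case False
  show ?thesis
  proof (rule field_le_epsilon)
    fix e :: real assume e: "e > 0"
    define U where "U = D \<inter> (\<Union>z\<in>K. ball z (e/2))"
    have "K \<subseteq> U" using K(3) e by (force simp: U_def)
    moreover have "open U" unfolding U_def by (intro open_Int open_D open_UN) auto
    ultimately obtain g where g: "joining_arc U u v g"
      using connected_polygonal_arc[OF _ K(1) _ K(4,5) False] by blast
    have gU: "path_image g \<subseteq> U" using g by (auto simp: joining_arc_def joining_path_def)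
    have "joining_arc D u v g" using g gU by (auto simp: joining_arc_def joining_path_def U_def)
    then have "\<rho> u v \<le> diameter (path_image g)" by (rule rho_le_arc)
    also have "\<dots> \<le> diameter K + e"
    proof (rule diameter_le)
      fix x y assume "x \<in> path_image g" "y \<in> path_image g"
      then have "x \<in> (\<Union>z\<in>K. ball z (e/2))" "y \<in> (\<Union>z\<in>K. ball z (e/2))"
        using gU unfolding U_def by blast+
      then obtain x' y' where xy: "x' \<in> K" "dist x' x < e / 2" "y' \<in> K" "dist y' y < e / 2"
        by (auto simp only: UN_iff mem_ball)
      have "dist x y \<le> dist x' x + dist x' y' + dist y' y"
        by (smt (verit) dist_commute dist_triangle)
      also have "dist x' y' \<le> diameter K" by (rule diameter_bounded_bound[OF K(2) xy(1,3)])
      finally show "norm (x - y) \<le> diameter K + e" using xy by (simp add: dist_norm)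
    qed (use diameter_ge_0[OF K(2)] e in auto)
    finally show "\<rho> u v \<le> diameter K + e" .
  qed
qed

text \<open>Two arcs meeting at \<open>v\<close> need not form an arc, so their union is passed to
  \<open>rho_le_connected\<close>.\<close>

lemma rho_triangle:
  assumes "u \<in> D" "v \<in> D" "w \<in> D"
  shows "\<rho> u w \<le> \<rho> u v + \<rho> v w"
proof (rule field_le_epsilon)
  fix e :: real assume e: "e > 0"
  obtain g where g: "joining_arc D u v g" "diameter (path_image g) < \<rho> u v + e / 2"
    using rho_arc[OF assms(1,2), of "\<rho> u v + e / 2"] e by auto
  obtain h where h: "joining_arc D v w h" "diameter (path_image h) < \<rho> v w + e / 2"
    using rho_arc[OF assms(2,3), of "\<rho> v w + e / 2"] e by auto
  have gh: "path g" "path h" "pathstart g = u" "pathfinish g = v" "pathstart h = v" "pathfinish h = w"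
      "path_image g \<subseteq> D" "path_image h \<subseteq> D"
    using g(1) h(1) by (simp_all add: joining_arc_def joining_path_def rectifiable_def)
  then have gh': "u \<in> path_image g" "v \<in> path_image g" "v \<in> path_image h" "w \<in> path_image h"
    using pathstart_in_path_image pathfinish_in_path_image by metis+
  have "\<rho> u w \<le> diameter (path_image g \<union> path_image h)"
    by (rule rho_le_connected)
      (use gh gh' in \<open>auto intro!: connected_Un connected_path_image bounded_path_image\<close>)
  also have "\<dots> \<le> diameter (path_image g) + diameter (path_image h)"
    by (rule diameter_Un_le[OF _ _ gh'(2,3)]) (use gh in \<open>auto intro: bounded_path_image\<close>)
  finally show "\<rho> u w \<le> \<rho> u v + \<rho> v w + e" using g h by simp
qed

lemma rho_le_step: "step u v \<Longrightarrow> \<rho> u v \<le> dist u v"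
  using rho_le_connected[of "closed_segment u v" u v] step_segment[of u v] diameter_closed_segment[of u v]
  by (simp add: compact_imp_bounded compact_segment)

lemma rho_le_chain: "chain m l u v \<Longrightarrow> \<rho> u v \<le> l"
proof (induction rule: chain.induct)
  case (chain_refl u l)
  then show ?case using rho_le_connected[of "{u}" u u] by simp
next
  case (chain_step u v m l w l')
  then show ?case using rho_triangle[of u v w] rho_le_step[of u v] chain_mem[of m l v w]
    by (simp add: step_def)
qed

end

section \<open>Shortest chains\<close>

text \<open>The tangent to \<open>ln\<close> at \<open>8 * A\<close> replaces the logarithmic term
  by \<open>x / 2\<close> plus a constant, and half of \<open>x\<close> is absorbed.\<close>

lemma linear_le_log:
  fixes x A :: real
  assumes "0 < A" "0 \<le> x" "x \<le> A * ln (1 + 4 * x) + A"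
  shows "x \<le> 2 * A * ln (8 * A) + 1 / 4"
proof -
  define M where "M = 8 * A"
  have M: "M > 0" using assms by (simp add: M_def)
  have "ln ((1 + 4 * x) / M) \<le> (1 + 4 * x) / M - 1" using M assms by (intro ln_le_minus_one) auto
  then have "ln (1 + 4 * x) \<le> ln M + (1 + 4 * x) / M - 1" using M assms by (simp add: ln_div)
  then have "A * ln (1 + 4 * x) \<le> A * (ln M + (1 + 4 * x) / M - 1)"
    using assms by (intro mult_left_mono) auto
  also have "\<dots> = A * ln M + 1 / 8 + x / 2 - A"
    using assms by (simp add: M_def field_simps)
  finally show ?thesis using assms unfolding M_def by simp
qed

lemma finite_argmax:
  fixes a :: "'b \<Rightarrow> real"
  assumes "finite S" "S \<noteq> {}"
  obtains w where "w \<in> S" "\<And>l. l \<in> S \<Longrightarrow> a l \<le> a w"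
proof -
  have "Max (a ` S) \<in> a ` S" using assms by simp
  then obtain w where "w \<in> S" "Max (a ` S) = a w" by blast
  then show thesis using that[of w] Max_ge[of "a ` S"] assms by (metis finite_imageI imageI)
qed

text \<open>Constants for \<open>geodesic_sequence\<close> below: \<open>seq_T\<close> bounds the length of a plateau, \<open>seq_B\<close> is the
  cigar constant, and \<open>seq_C\<close> bounds the total sum, where \<open>seq_G\<close> bounds the two outer parts and
  \<open>seq_L\<close> the number of terms of the middle part.\<close>

definition seq_T :: "real \<Rightarrow> nat" where
  "seq_T A = nat \<lceil>2 * (A + 1) * ln (8 * (A + 1)) + 1 / 4\<rceil>"

definition seq_B :: "real \<Rightarrow> real" where
  "seq_B A = (3 * real (seq_T A) + 2) * 2 ^ seq_T A"

definition seq_G :: "real \<Rightarrow> real \<Rightarrow> real" where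
  "seq_G A E = 2 * (real (seq_T A) + 1) * E"

definition seq_L :: "real \<Rightarrow> real \<Rightarrow> nat" where
  "seq_L A E = nat \<lceil>A * ln (2 + 2 * seq_G A E) + A\<rceil>"

definition seq_C :: "real \<Rightarrow> real \<Rightarrow> real" where
  "seq_C A E = 2 * seq_G A E + (real (seq_L A E) + 1) * (2 ^ seq_L A E * E)"

text \<open>In the application, \<open>a i\<close> is the distance of the \<open>i\<close>-th point of a shortest chain to
  the boundary.\<close>

locale geodesic_sequence =
  fixes a :: "nat \<Rightarrow> real" and m :: nat and A :: real
  assumes A: "0 < A"
    and pos: "l \<le> m \<Longrightarrow> 0 < a l"
    and up: "l < m \<Longrightarrow> a (Suc l) \<le> 2 * a l"
    and down: "l < m \<Longrightarrow> a l \<le> 2 * a (Suc l)"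
    and grow: "i \<le> j \<Longrightarrow> j \<le> m \<Longrightarrow> real (j - i) \<le> A * ln (1 + sum a {i..j} / min (a i) (a j)) + A"
begin

text \<open>By reversal, each statement about the beginning of the sequence yields one about its
  end.\<close>

lemma reversed: "geodesic_sequence (\<lambda>l. a (m - l)) m A"
proof
  fix l assume "l < m"
  then have l: "m - l = Suc (m - Suc l)" "m - Suc l < m" by auto
  show "a (m - Suc l) \<le> 2 * a (m - l)" "a (m - l) \<le> 2 * a (m - Suc l)"
    using up[OF l(2)] down[OF l(2)] l(1) by simp_all
next
  fix i j assume ij: "i \<le> j" "j \<le> m"
  have "sum (\<lambda>l. a (m - l)) {i..j} = sum a {m - j..m - i}"
    by (rule sum.reindex_bij_witness[of _ "\<lambda>l. m - l" "\<lambda>l. m - l"]) (use ij in auto)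
  then show "real (j - i) \<le> A * ln (1 + sum (\<lambda>l. a (m - l)) {i..j} / min (a (m - i)) (a (m - j))) + A"
    using grow[of "m - j" "m - i"] ij by (simp add: min.commute)
qed (use A pos in auto)

lemma le_power:
  assumes "i \<le> j" "j \<le> m"
  shows "a j \<le> 2 ^ (j - i) * a i" "a i \<le> 2 ^ (j - i) * a j"
proof -
  have "a j \<le> 2 ^ (j - i) * a i \<and> a i \<le> 2 ^ (j - i) * a j"
    using assms
  proof (induction j rule: dec_induct)
    case (step n)
    then have n: "Suc n - i = Suc (n - i)" by auto
    have "a (Suc n) \<le> 2 * (2 ^ (n - i) * a i)" using step up[of n] by auto
    moreover have "a i \<le> 2 ^ (n - i) * (2 * a (Suc n))"
    proof -
      have "2 ^ (n - i) * a n \<le> 2 ^ (n - i) * (2 * a (Suc n))" using step down[of n] by simp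
      moreover have "a i \<le> 2 ^ (n - i) * a n" using step by simp
      ultimately show ?thesis by linarith
    qed
    ultimately show ?case unfolding n by (simp add: mult_ac)
  qed simp
  then show "a j \<le> 2 ^ (j - i) * a i" "a i \<le> 2 ^ (j - i) * a j" by auto
qed

text \<open>For \<open>x\<close> terms of size at most \<open>r\<close> with ends at least
  \<open>r / 4\<close>, the quotient in \<open>grow\<close> is at most \<open>4 * x\<close>, so
  \<open>x\<close> is bounded by a logarithm of itself.\<close>

lemma plateau:
  assumes ij: "i \<le> j" "j \<le> m" and r: "0 < r" "\<And>l. i \<le> l \<Longrightarrow> l \<le> j \<Longrightarrow> a l \<le> r" "r \<le> 4 * a i" "r \<le> 4 * a j"
  shows "j - i \<le> seq_T A"
proof -
  define x where "x = real (j - i) + 1"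
  have "sum a {i..j} \<le> real (card {i..j}) * r"
    using r by (intro sum_bounded_above) auto
  also have "real (card {i..j}) = x" using ij by (auto simp: x_def)
  finally have S: "sum a {i..j} \<le> x * r" .
  have nn: "0 \<le> sum a {i..j}" using pos ij by (intro sum_nonneg) (simp add: less_imp_le)
  have "sum a {i..j} / min (a i) (a j) \<le> x * r / (r / 4)"
    by (rule frac_le) (use S r nn in \<open>auto simp: x_def\<close>)
  also have "\<dots> = 4 * x" using r by simp
  finally have "1 + sum a {i..j} / min (a i) (a j) \<le> 1 + 4 * x" by simp
  moreover have "0 \<le> sum a {i..j} / min (a i) (a j)" using nn pos[of i] pos[of j] ij by simp
  ultimately have "ln (1 + sum a {i..j} / min (a i) (a j)) \<le> ln (1 + 4 * x)"
    by (subst ln_le_cancel_iff) auto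
  then have "A * ln (1 + sum a {i..j} / min (a i) (a j)) \<le> A * ln (1 + 4 * x)"
    using A by simp
  then have "x \<le> A * ln (1 + 4 * x) + (A + 1)" using grow[OF ij] unfolding x_def by linarith
  \<comment> \<open>Both coefficients become \<open>A + 1\<close>, as \<open>linear_le_log\<close>
    requires; the additive one arose because \<open>x\<close> exceeds \<open>j - i\<close> by
    1.\<close>
  also have "A * ln (1 + 4 * x) \<le> (A + 1) * ln (1 + 4 * x)"
    by (intro mult_right_mono) (auto simp: x_def)
  finally have "x \<le> 2 * (A + 1) * ln (8 * (A + 1)) + 1 / 4"
    using A by (intro linear_le_log) (auto simp: x_def)
  then show ?thesis unfolding seq_T_def x_def by linarith
qed

text \<open>The maximum over the indices before the first \<open>l\<close> with \<open>a u \<le> 2 * a l\<close> is at most half of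
  \<open>a u\<close>, so the sum splits into a plateau and a prefix to which induction applies.\<close>

lemma prefix_sum:
  assumes "u \<le> m" "\<And>l. l \<le> u \<Longrightarrow> a l \<le> a u"
  shows "sum a {..u} \<le> 2 * (real (seq_T A) + 1) * a u"
  using assms
proof (induction u rule: less_induct)
  case (less u)
  let ?T = "real (seq_T A)"
  have au: "0 < a u" using pos less.prems by auto
  define v where "v = (LEAST l. a u \<le> 2 * a l)"
  have v: "a u \<le> 2 * a v" "v \<le> u" "\<And>l. l < v \<Longrightarrow> 2 * a l < a u"
  proof -
    show "a u \<le> 2 * a v" unfolding v_def by (rule LeastI[of _ u]) (use au in auto)
    show "v \<le> u" unfolding v_def by (rule Least_le) (use au in auto)
    show "2 * a l < a u" if "l < v" for l
      using not_less_Least[of l "\<lambda>l. a u \<le> 2 * a l"] that unfolding v_def by auto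
  qed
  show ?case
  proof (cases "v = 0")
    case True
    then have "u - 0 \<le> seq_T A"
      using less.prems v au by (intro plateau[of 0 u "a u"]) auto
    then have u: "real u \<le> ?T" by simp
    have "sum a {..u} \<le> real (card {..u}) * a u"
      using less.prems by (intro sum_bounded_above) auto
    also have "\<dots> \<le> 2 * (?T + 1) * a u" using u au by (intro mult_right_mono) auto
    finally show ?thesis .
  next
    case False
    obtain w where w: "w < v" "\<And>l. l < v \<Longrightarrow> a l \<le> a w"
      using finite_argmax[of "{..<v}" a] False by auto
    have "a v \<le> 2 * a (v - 1)" using up[of "v - 1"] False v(2) less.prems by simp
    also have "\<dots> \<le> 2 * a w" using w(2)[of "v - 1"] False by simp
    \<comment> \<open>One doubling comes from the choice of \<open>v\<close>, the other from the
      step leading to \<open>v\<close>; together they give the factor 4 that \<open>plateau\<close>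
      tolerates.\<close>
    finally have w4: "a u \<le> 4 * a w" using v(1) by simp
    have w2: "2 * a w < a u" using v(3) w(1) by simp
    have "sum a {..w} \<le> 2 * (?T + 1) * a w"
      by (rule less.IH) (use w v(2) less.prems in auto)
    also have "\<dots> \<le> (?T + 1) * a u"
    proof -
      have "(?T + 1) * (2 * a w) \<le> (?T + 1) * a u" using w2 by (intro mult_left_mono) auto
      then show ?thesis by (simp add: mult_ac)
    qed
    finally have S1: "sum a {..w} \<le> (?T + 1) * a u" .
    have "u - w \<le> seq_T A"
      using less.prems w w4 v(2) au by (intro plateau[of w u "a u"]) auto
    then have u: "real (u - w) \<le> ?T" by simp
    have "sum a {w<..u} \<le> real (card {w<..u}) * a u"
      using less.prems by (intro sum_bounded_above) auto
    also have "\<dots> \<le> ?T * a u" using u au by (intro mult_right_mono) auto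
    finally have S2: "sum a {w<..u} \<le> ?T * a u" .
    have "{..u} = {..w} \<union> {w<..u}" using w v(2) by auto
    then have "sum a {..u} = sum a {..w} + sum a {w<..u}" by (simp add: sum.union_disjoint ivl_disj_int)
    \<comment> \<open>Because \<open>a w\<close> is less than half of \<open>a u\<close>, the
      recursion closes: (T + 1) + T is at most 2 (T + 1).\<close>
    also have "\<dots> \<le> 2 * (?T + 1) * a u" using S1 S2 au by (simp add: algebra_simps)
    finally show ?thesis .
  qed
qed

text \<open>At or after \<open>i\<close> the sequence regains the height \<open>a u\<close> of its
  maximum up to \<open>i\<close>. Between \<open>u\<close> and the first such return lies a plateau,
  so \<open>i\<close> is within T of \<open>u\<close> and \<open>a u\<close> is at most 2^T times
  \<open>a i\<close>; the terms up to \<open>u\<close> are covered by \<open>prefix_sum\<close>. The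
  count 2 (T + 1) + T and the factor 2^T give \<open>seq_B\<close>.\<close>

lemma cigar_left:
  assumes u: "u \<le> i" "\<And>l. l \<le> i \<Longrightarrow> a l \<le> a u" and w: "i \<le> w" "w \<le> m" "a u \<le> a w"
  shows "sum a {..i} \<le> seq_B A * a i"
proof -
  let ?T = "real (seq_T A)"
  have au: "0 < a u" using pos u w by auto
  define v where "v = (LEAST l. i \<le> l \<and> a u \<le> a l)"
  have v: "i \<le> v" "a u \<le> a v" "v \<le> w" "\<And>l. i \<le> l \<Longrightarrow> l < v \<Longrightarrow> a l < a u"
  proof -
    have "i \<le> v \<and> a u \<le> a v" unfolding v_def by (rule LeastI[of _ w]) (use w in auto)
    then show "i \<le> v" "a u \<le> a v" by auto
    show "v \<le> w" unfolding v_def by (rule Least_le) (use w in auto)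
    show "a l < a u" if "i \<le> l" "l < v" for l
      using not_less_Least[of l "\<lambda>l. i \<le> l \<and> a u \<le> a l"] that unfolding v_def by auto
  qed
  have av: "a v \<le> 2 * a u"
  proof (cases "v = i")
    case True
    then show ?thesis using u(2)[of i] au by simp
  next
    case False
    then have "a v \<le> 2 * a (v - 1)" "a (v - 1) < a u" using up[of "v - 1"] v(4)[of "v - 1"] v(1,3) w by auto
    then show ?thesis by simp
  qed
  have "v - u \<le> seq_T A"
  proof (rule plateau[of u v "2 * a u"])
    fix l assume l: "u \<le> l" "l \<le> v"
    consider "l \<le> i" | "i \<le> l" "l < v" | "l = v" using l by linarith
    then show "a l \<le> 2 * a u" using u(2)[of l] v(4)[of l] av au by cases auto
  qed (use u v w au in auto)
  then have iu: "i - u \<le> seq_T A" using v(1) by simp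
  have "sum a {..u} \<le> 2 * (?T + 1) * a u" by (rule prefix_sum) (use u w in auto)
  moreover have "sum a {u<..i} \<le> ?T * a u"
  proof -
    have "sum a {u<..i} \<le> real (card {u<..i}) * a u" using u by (intro sum_bounded_above) auto
    also have "\<dots> \<le> ?T * a u" using iu au by (intro mult_right_mono) auto
    finally show ?thesis .
  qed
  moreover have "sum a {..i} = sum a {..u} + sum a {u<..i}"
  proof -
    have "{..i} = {..u} \<union> {u<..i}" using u by auto
    then show ?thesis by (simp add: sum.union_disjoint ivl_disj_int)
  qed
  ultimately have "sum a {..i} \<le> (3 * ?T + 2) * a u" by (simp add: algebra_simps)
  also have "a u \<le> 2 ^ seq_T A * a i"
  proof -
    have "a u \<le> 2 ^ (i - u) * a i" using le_power(2)[of u i] u w by simp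
    also have "\<dots> \<le> 2 ^ seq_T A * a i"
      using iu pos[of i] w by (intro mult_right_mono power_increasing) auto
    finally show ?thesis .
  qed
  finally show ?thesis by (simp add: seq_B_def mult_left_mono mult.assoc)
qed

text \<open>The smaller of the maxima on the two sides of \<open>i\<close> is regained on the other
  side, so \<open>cigar_left\<close> applies to its side, directly or after reversal.\<close>

lemma cigar:
  assumes i: "i \<le> m"
  shows "sum a {..i} \<le> seq_B A * a i \<or> sum a {i..m} \<le> seq_B A * a i"
proof -
  interpret R: geodesic_sequence "\<lambda>l. a (m - l)" m A by (rule reversed)
  obtain u where u: "u \<le> i" "\<And>l. l \<le> i \<Longrightarrow> a l \<le> a u"
    using finite_argmax[of "{..i}" a] by auto
  obtain w where w: "i \<le> w" "w \<le> m" "\<And>l. i \<le> l \<Longrightarrow> l \<le> m \<Longrightarrow> a l \<le> a w"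
  proof -
    have "finite {i..m}" "{i..m} \<noteq> {}" using i by auto
    from finite_argmax[OF this, of a] obtain w where "w \<in> {i..m}" "\<And>l. l \<in> {i..m} \<Longrightarrow> a l \<le> a w" by blast
    then show thesis using that[of w] by simp
  qed
  show ?thesis
  proof (cases "a u \<le> a w")
    case True
    then show ?thesis using cigar_left[OF u w(1,2)] by blast
  next
    case False
    have "sum (\<lambda>l. a (m - l)) {..m - i} \<le> seq_B A * a (m - (m - i))"
      by (rule R.cigar_left[of "m - w" _ "m - u"]) (use u w i False in auto)
    moreover have "sum (\<lambda>l. a (m - l)) {..m - i} = sum a {i..m}"
      by (rule sum.reindex_bij_witness[of _ "\<lambda>l. m - l" "\<lambda>l. m - l"]) (use i in auto)
    ultimately show ?thesis using i by simp
  qed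
qed

lemma suffix_sum:
  assumes "u \<le> m" "\<And>l. u \<le> l \<Longrightarrow> l \<le> m \<Longrightarrow> a l \<le> a u"
  shows "sum a {u..m} \<le> 2 * (real (seq_T A) + 1) * a u"
proof -
  interpret R: geodesic_sequence "\<lambda>l. a (m - l)" m A by (rule reversed)
  have "sum (\<lambda>l. a (m - l)) {..m - u} \<le> 2 * (real (seq_T A) + 1) * a (m - (m - u))"
    by (rule R.prefix_sum) (use assms in auto)
  moreover have "sum (\<lambda>l. a (m - l)) {..m - u} = sum a {u..m}"
    by (rule sum.reindex_bij_witness[of _ "\<lambda>l. m - l" "\<lambda>l. m - l"]) (use assms in auto)
  ultimately show ?thesis using assms by simp
qed

text \<open>In the application \<delta> is the inner diameter distance of the ends. Cut at the first
  and last index with value at least \<delta>. The outer parts have their maxima at the cuts, hence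
  sums bounded by a multiple of \<delta>. For the middle, \<open>grow\<close> would involve the very
  sum to be estimated, so \<open>mid\<close> uses only the outer sums: it bounds the number of
  middle terms, and each of them is bounded by repeated doubling.\<close>

lemma total_sum:
  assumes \<delta>: "0 < \<delta>" and E: "2 \<le> E" and ends: "a 0 \<le> E * \<delta>" "a m \<le> E * \<delta>"
    and mid: "\<And>i j. i \<le> j \<Longrightarrow> j \<le> m \<Longrightarrow> \<delta> \<le> a i \<Longrightarrow> \<delta> \<le> a j \<Longrightarrow>
       real (j - i) \<le> A * ln (1 + (sum a {..i} + \<delta> + sum a {j..m}) / \<delta>) + A"
  shows "sum a {..m} \<le> seq_C A E * \<delta>"
proof -
  let ?T = "real (seq_T A)"
  let ?G = "seq_G A E"
  let ?L = "seq_L A E"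
  have G: "0 \<le> ?G" using E by (simp add: seq_G_def)
  show ?thesis
  proof (cases "\<exists>l\<le>m. \<delta> \<le> a l")
    case False
    obtain u where u: "u \<le> m" "\<And>l. l \<le> m \<Longrightarrow> a l \<le> a u"
      using finite_argmax[of "{..m}" a] by auto
    have au: "2 * (?T + 1) * a u \<le> 2 * (?T + 1) * (E * \<delta>)"
    proof -
      have "a u \<le> 1 * \<delta>" using False u(1) by auto
      also have "\<dots> \<le> E * \<delta>" using E \<delta> by (intro mult_right_mono) auto
      finally show ?thesis by (intro mult_left_mono) auto
    qed
    have "sum a {..m} \<le> sum a {..u} + sum a {u..m}"
    proof -
      have "sum a {..m} = sum a ({..u} \<union> {u<..m})" using u by (intro sum.cong) auto
      also have "\<dots> = sum a {..u} + sum a {u<..m}" by (simp add: sum.union_disjoint ivl_disj_int)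
      also have "sum a {u<..m} \<le> sum a {u..m}" using pos by (intro sum_mono2) (auto simp: less_imp_le)
      finally show ?thesis by simp
    qed
    also have "\<dots> \<le> 2 * (?T + 1) * a u + 2 * (?T + 1) * a u"
      by (intro add_mono prefix_sum suffix_sum) (use u in auto)
    also have "\<dots> \<le> 2 * ?G * \<delta>" using au by (simp add: seq_G_def mult.assoc)
    also have "\<dots> \<le> seq_C A E * \<delta>" using \<delta> E by (simp add: seq_C_def)
    finally show ?thesis .
  next
    case True
    define S where "S = {l. l \<le> m \<and> \<delta> \<le> a l}"
    have S: "finite S" "S \<noteq> {}" using True by (auto simp: S_def)
    define i where "i = Min S"
    define j where "j = Max S"
    have i: "i \<le> m" "\<delta> \<le> a i" and j: "j \<le> m" "\<delta> \<le> a j" and ij: "i \<le> j"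
      using Min_in[OF S] Max_in[OF S] Min_le[OF S(1)] unfolding i_def j_def by (auto simp: S_def)
    have less_i: "a l < \<delta>" if "l < i" for l
    proof -
      have "l \<notin> S" using Min_le[OF S(1), of l] that unfolding i_def by auto
      then show ?thesis using that i by (simp add: S_def not_le)
    qed
    have greater_j: "a l < \<delta>" if "j < l" "l \<le> m" for l
    proof -
      have "l \<notin> S" using Max_ge[OF S(1), of l] that unfolding j_def by auto
      then show ?thesis using that by (simp add: S_def not_le)
    qed
    have ai: "a i \<le> E * \<delta>"
    proof (cases "i = 0")
      case False
      then have "a i \<le> 2 * a (i - 1)" "a (i - 1) < \<delta>" using up[of "i - 1"] less_i[of "i - 1"] i by auto
      then have "a i \<le> 2 * \<delta>" by simp
      also have "\<dots> \<le> E * \<delta>" using E \<delta> by (intro mult_right_mono) auto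
      finally show ?thesis .
    qed (use ends in simp)
    have aj: "a j \<le> E * \<delta>"
    proof (cases "j = m")
      case False
      then have "a j \<le> 2 * a (j + 1)" "a (j + 1) < \<delta>" using down[of j] greater_j[of "j + 1"] j by auto
      then have "a j \<le> 2 * \<delta>" by simp
      also have "\<dots> \<le> E * \<delta>" using E \<delta> by (intro mult_right_mono) auto
      finally show ?thesis .
    qed (use ends in simp)
    have "sum a {..i} \<le> 2 * (?T + 1) * a i"
    proof (rule prefix_sum[OF i(1)])
      fix l assume "l \<le> i"
      then show "a l \<le> a i" using less_i[of l] i(2) by (cases "l = i") auto
    qed
    also have "\<dots> \<le> 2 * (?T + 1) * (E * \<delta>)" using ai by (intro mult_left_mono) auto
    finally have Si: "sum a {..i} \<le> ?G * \<delta>" by (simp add: seq_G_def mult.assoc)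
    have "sum a {j..m} \<le> 2 * (?T + 1) * a j"
    proof (rule suffix_sum[OF j(1)])
      fix l assume "j \<le> l" "l \<le> m"
      then show "a l \<le> a j" using greater_j[of l] j(2) by (cases "l = j") auto
    qed
    also have "\<dots> \<le> 2 * (?T + 1) * (E * \<delta>)" using aj by (intro mult_left_mono) auto
    finally have Sj: "sum a {j..m} \<le> ?G * \<delta>" by (simp add: seq_G_def mult.assoc)
    have "(sum a {..i} + \<delta> + sum a {j..m}) / \<delta> \<le> 2 * ?G + 1"
      using Si Sj \<delta> by (simp add: pos_divide_le_eq algebra_simps)
    moreover have "0 \<le> sum a {..i} + \<delta> + sum a {j..m}"
      using pos i j \<delta> by (intro add_nonneg_nonneg sum_nonneg) (auto simp: less_imp_le)
    ultimately have "ln (1 + (sum a {..i} + \<delta> + sum a {j..m}) / \<delta>) \<le> ln (2 + 2 * ?G)"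
      using \<delta> G by (subst ln_le_cancel_iff) (auto intro: add_pos_nonneg)
    then have "A * ln (1 + (sum a {..i} + \<delta> + sum a {j..m}) / \<delta>) \<le> A * ln (2 + 2 * ?G)"
      using A by (intro mult_left_mono) auto
    with mid[OF ij j(1) i(2) j(2)] have "real (j - i) \<le> A * ln (2 + 2 * ?G) + A" by linarith
    then have L: "j - i \<le> ?L" unfolding seq_L_def by linarith
    have al: "a l \<le> 2 ^ ?L * E * \<delta>" if "i \<le> l" "l \<le> j" for l
    proof -
      have "a l \<le> 2 ^ (l - i) * a i" using le_power(1)[of i l] that j by simp
      also have "\<dots> \<le> 2 ^ ?L * (E * \<delta>)"
        using that L ai i \<delta> by (intro mult_mono power_increasing) auto
      finally show ?thesis by (simp add: mult.assoc)
    qed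
    have Sij: "sum a {i..j} \<le> (real ?L + 1) * (2 ^ ?L * E) * \<delta>"
    proof -
      have "sum a {i..j} \<le> real (card {i..j}) * (2 ^ ?L * E * \<delta>)"
        using al by (intro sum_bounded_above) auto
      also have "\<dots> \<le> (real ?L + 1) * (2 ^ ?L * E * \<delta>)"
        using L ij E \<delta> by (intro mult_right_mono) auto
      finally show ?thesis by (simp add: mult.assoc)
    qed
    have "sum a {..m} \<le> sum a {..i} + sum a {i..j} + sum a {j..m}"
    proof -
      have "sum a {..m} = sum a ({..i} \<union> ({i<..j} \<union> {j<..m}))" using ij j by (intro sum.cong) auto
      also have "\<dots> = sum a {..i} + sum a ({i<..j} \<union> {j<..m})" by (rule sum.union_disjoint) (use ij in auto)
      also have "sum a ({i<..j} \<union> {j<..m}) = sum a {i<..j} + sum a {j<..m}" by (rule sum.union_disjoint) auto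
      also have "sum a {i<..j} \<le> sum a {i..j}" using pos j by (intro sum_mono2) (auto simp: less_imp_le)
      also have "sum a {j<..m} \<le> sum a {j..m}" using pos j by (intro sum_mono2) (auto simp: less_imp_le)
      finally show ?thesis by simp
    qed
    also have "\<dots> \<le> ?G * \<delta> + (real ?L + 1) * (2 ^ ?L * E) * \<delta> + ?G * \<delta>"
      by (intro add_mono Si Sij Sj)
    also have "\<dots> = seq_C A E * \<delta>" by (simp add: seq_C_def algebra_simps)
    finally show ?thesis .
  qed
qed

end

lemma diameter_le_dlength:
  fixes g :: "real \<Rightarrow> 'a::euclidean_space"
  assumes "0 \<le> a" "a \<le> b" "b \<le> 1"
  shows "ereal (diameter (g ` {a..b})) \<le> elen g a b"
proof (cases "elen g a b")
  case (real r)
  have "diameter (g ` {a..b}) \<le> r"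
  proof (rule diameter_le)
    fix x y assume "x \<in> g ` {a..b}" "y \<in> g ` {a..b}"
    then obtain s t where st: "s \<in> {a..b}" "t \<in> {a..b}" "x = g s" "y = g t" by blast
    have "edist (g (min s t)) (g (max s t)) \<le> elen g (min s t) (max s t)"
      by (rule dist_le_dlength) auto
    also have "\<dots> \<le> elen g a b" using st by (intro dlength_edist_mono) auto
    finally show "norm (x - y) \<le> r"
      using real st by (auto simp: dist_norm min_def max_def norm_minus_commute split: if_splits)
  qed (use assms in auto)
  then show ?thesis using real by simp
next
  case MInf
  then show ?thesis using dlength_edist_nonneg[OF assms(2), of g] by simp
qed simp

section \<open>From the chain bound to both forms of uniformity\<close>

context subdomain
begin

lemma rho_le_dlength:
  assumes "joining_path D u v g"
  shows "ereal (\<rho> u v) \<le> elen g 0 1"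
proof -
  have "\<rho> u v \<le> diameter (path_image g)"
    by (rule rho_le_connected)
      (use assms in \<open>auto simp: joining_path_def rectifiable_def intro!: connected_path_image bounded_path_image\<close>)
  then show ?thesis
    using diameter_le_dlength[of 0 1 g] unfolding path_image_def
    by (meson ereal_less_eq(3) order.refl order_trans zero_le_one)
qed

lemma rho_le_inner_length: "ereal (\<rho> u v) \<le> inner_length_metric D u v"
  unfolding inner_length_metric_def inner_metric_def by (rule INF_greatest) (use rho_le_dlength in auto)

lemma step_polygon_arc:
  assumes p: "\<And>i. i < m \<Longrightarrow> step (p i) (p (Suc i))" and ne: "p 0 \<noteq> p m"
  shows "\<exists>g. joining_arc D (p 0) (p m) g \<and>
    (\<forall>t\<in>{0..1}. \<exists>i<m. g t \<in> closed_segment (p i) (p (Suc i)) \<and>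
       elen g 0 t \<le> ereal (plen p {..i}) \<and> elen g t 1 \<le> ereal (plen p {i..<m}))"
proof -
  obtain g where g: "arc g" "rectifiable g" "pathstart g = p 0" "pathfinish g = p m"
    "\<forall>t\<in>{0..1}. \<exists>i<m. g t \<in> closed_segment (p i) (p (Suc i)) \<and>
       elen g 0 t \<le> ereal (plen p {..i}) \<and> elen g t 1 \<le> ereal (plen p {i..<m})"
    using polygon_arc[OF ne] by blast
  have "path_image g \<subseteq> D"
    unfolding path_image_def image_subset_iff using g(5) step_segment p by (meson subsetD)
  then have "joining_arc D (p 0) (p m) g" using g by (auto simp: joining_arc_def joining_path_def)
  then show ?thesis using g(5) by blast
qed

definition chain_le_j :: "real \<Rightarrow> bool" where
  "chain_le_j c \<longleftrightarrow> (\<forall>x\<in>D. \<forall>y\<in>D. \<exists>m l. chain m l x y \<and> real m \<le> c * (j_inner D x y + 1))"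

text \<open>Minimality passes to subchains: a chain with fewer steps between two of the points could
  be spliced into the whole.\<close>

lemma minimal_chain:
  assumes "x \<in> D" "y \<in> D"
  obtains p m where "p 0 = x" "p m = y" "\<And>i. i < m \<Longrightarrow> step (p i) (p (Suc i))"
    "\<And>i. i \<le> m \<Longrightarrow> p i \<in> D" "\<And>i j k l. i \<le> j \<Longrightarrow> j \<le> m \<Longrightarrow> chain k l (p i) (p j) \<Longrightarrow> j - i \<le> k"
    "\<And>i j. i \<le> j \<Longrightarrow> j \<le> m \<Longrightarrow> chain (j - i) (plen p {i..<j}) (p i) (p j)"
proof -
  obtain m where m: "\<exists>l. chain m l x y" "\<And>k. k < m \<Longrightarrow> \<not> (\<exists>l. chain k l x y)"
    using chain_exists[OF assms] exists_least_iff[of "\<lambda>m. \<exists>l. chain m l x y"] by blast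
  then obtain l0 where "chain m l0 x y" by blast
  then obtain p where p: "p 0 = x" "p m = y" "\<And>i. i < m \<Longrightarrow> step (p i) (p (Suc i))"
    using chain_fun by metis
  have pD: "p i \<in> D" if "i \<le> m" for i
    using that p(3)[of i] assms p(1,2) by (cases "i = m") (auto simp: step_def)
  have sub: "chain (j - i) (plen p {i..<j}) (p i) (p j)" if "i \<le> j" "j \<le> m" for i j
  proof -
    have "chain (j - i) (\<Sum>l<j - i. dist (p (i + l)) (p (i + Suc l))) (p (i + 0)) (p (i + (j - i)))"
      by (rule fun_chain[of _ "\<lambda>l. p (i + l)"]) (use that p(3) pD in auto)
    moreover have "(\<Sum>l<j - i. dist (p (i + l)) (p (i + Suc l))) = plen p {i..<j}"
      by (rule sum.reindex_bij_witness[of _ "\<lambda>l. l - i" "\<lambda>l. i + l"]) (use that in auto)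
    ultimately show ?thesis using that by simp
  qed
  have min: "j - i \<le> k" if "i \<le> j" "j \<le> m" "chain k l (p i) (p j)" for i j k l
  proof (rule ccontr)
    assume "\<not> j - i \<le> k"
    have "\<exists>l. chain (i + k + (m - j)) l x y"
      using chain_trans[OF chain_trans[OF sub[of 0 i] that(3)] sub[of j m]] that p by auto
    then show False using m(2)[of "i + k + (m - j)"] that \<open>\<not> j - i \<le> k\<close> by force
  qed
  show thesis using that[of p m] p pD sub min by metis
qed

text \<open>Bounding the length by \<rho>, not only by the inner length metric, lets one arc serve
  both notions of uniformity. In \<open>C\<close>, the summand \<open>2 * seq_B c\<close> is for the
  cigar condition, \<open>seq_C c 5\<close> for the total length and 1 for the case of a plain
  segment.\<close>

lemma inner_uniform_arc:
  assumes c: "0 < c" "chain_le_j c" and xy: "x \<in> D" "y \<in> D"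
  defines "C \<equiv> 2 * seq_B c + seq_C c 5 + 1"
  shows "\<exists>g. joining_arc D x y g \<and>
     (\<forall>t\<in>{0..1}. min (elen g 0 t) (elen g t 1) \<le> ereal (C * bd (g t))) \<and>
     elen g 0 1 \<le> ereal (C * \<rho> x y)"
proof -
  have C: "1 \<le> C" "2 * seq_B c \<le> C" "seq_C c 5 \<le> C"
    by (auto simp: C_def seq_B_def seq_C_def seq_G_def)
  define \<delta> where "\<delta> = \<rho> x y"
  have xyd: "dist x y \<le> \<delta>" unfolding \<delta>_def by (rule dist_le_rho[OF xy])
  show ?thesis
  proof (cases "x = y \<or> 4 * \<delta> \<le> bd x")
    case True
    let ?g = "linepath x y"
    have bx: "0 < bd x" by (rule bdist_pos[OF xy(1)])
    have d4: "4 * dist x y \<le> bd x" using True xyd bx by auto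
    have near: "dist x z \<le> dist x y" "3 * dist x y \<le> bd z" if "z \<in> closed_segment x y" for z
    proof -
      show *: "dist x z \<le> dist x y" using dist_in_closed_segment(1)[OF that] by (simp add: dist_commute)
      show "3 * dist x y \<le> bd z" using bdist_triangle[of x z] d4 * by linarith
    qed
    have "closed_segment x y \<subseteq> ball x (bd x)"
      using near(1) d4 bx by (smt (verit) mem_ball subsetI zero_le_dist)
    then have "closed_segment x y \<subseteq> D" using ball_bdist_subset[OF xy(1)] by blast
    then have arc: "joining_arc D x y ?g"
      using rectifiable_linepath[of x y] arc_linepath[of x y]
      by (cases "x = y") (auto simp: joining_arc_def joining_path_def)
    have "min (elen ?g 0 t) (elen ?g t 1) \<le> ereal (C * bd (?g t))"
      if t: "t \<in> {0..1}" for t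
    proof -
      have b: "dist x y \<le> bd (?g t)"
        using near(2)[of "?g t"] linepath_in_path[of t x y] t zero_le_dist[of x y] by linarith
      have "dist x y * (t - 0) \<le> dist x y * 1" using t by (intro mult_left_mono) auto
      also have "\<dots> \<le> 1 * bd (?g t)" using b by simp
      also have "\<dots> \<le> C * bd (?g t)"
        using b zero_le_dist[of x y] C(1) by (intro mult_right_mono) linarith+
      finally have "ereal (dist x y * (t - 0)) \<le> ereal (C * bd (?g t))" by simp
      moreover have "elen ?g 0 t \<le> ereal (dist x y * (t - 0))"
        using t by (intro dlength_linepath) auto
      ultimately show ?thesis by (meson min.coboundedI1 order_trans)
    qed
    moreover have "elen ?g 0 1 \<le> ereal (C * \<rho> x y)"
    proof -
      have "dist x y \<le> 1 * \<delta>" using xyd by simp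
      also have "\<dots> \<le> C * \<delta>" using C(1) xyd zero_le_dist[of x y] by (intro mult_right_mono) linarith+
      finally have "ereal (dist x y) \<le> ereal (C * \<rho> x y)" by (simp add: \<delta>_def)
      moreover have "elen ?g 0 1 \<le> ereal (dist x y)" using dlength_linepath[of 0 1 x y] by simp
      ultimately show ?thesis by order
    qed
    ultimately show ?thesis using arc by blast
  next
    case False
    then have "x \<noteq> y" and bx: "bd x < 4 * \<delta>" by auto
    have \<delta>: "0 < \<delta>" using xyd zero_less_dist_iff[of x y] \<open>x \<noteq> y\<close> by linarith
    obtain p m where p: "p 0 = x" "p m = y" "\<And>i. i < m \<Longrightarrow> step (p i) (p (Suc i))"
      "\<And>i. i \<le> m \<Longrightarrow> p i \<in> D" "\<And>i j k l. i \<le> j \<Longrightarrow> j \<le> m \<Longrightarrow> chain k l (p i) (p j) \<Longrightarrow> j - i \<le> k"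
      "\<And>i j. i \<le> j \<Longrightarrow> j \<le> m \<Longrightarrow> chain (j - i) (plen p {i..<j}) (p i) (p j)"
      by (rule minimal_chain[OF xy]) (rule that)
    define a where "a l = bd (p l)" for l
    have a0: "0 < a l" if "l \<le> m" for l using bdist_pos[OF p(4)[OF that]] by (simp add: a_def)
    have da: "4 * dist (p l) (p (Suc l)) \<le> min (a l) (a (Suc l))" if "l < m" for l
      using p(3)[OF that] by (simp add: step_def a_def)
    have da': "dist (p l) (p (Suc l)) \<le> a l" if "l < m" for l
      using da[OF that] zero_le_dist[of "p l" "p (Suc l)"] by linarith
    \<comment> \<open>Each edge is charged to the boundary distance of its initial vertex, so
      lengths along the chain are bounded by sums of \<open>a\<close>.\<close>
    have dsum: "plen p I \<le> sum a J" if "I \<subseteq> J" "I \<subseteq> {..<m}" "J \<subseteq> {..m}" for I J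
    proof -
      have "plen p I \<le> sum a I" using da' that by (intro sum_mono) auto
      also have "\<dots> \<le> sum a J"
      proof (rule sum_mono2)
        show "finite J" by (rule finite_subset[OF that(3)]) simp
        show "0 \<le> a b" if "b \<in> J - I" for b using that a0[of b] \<open>J \<subseteq> {..m}\<close> by (auto simp: less_imp_le)
      qed (rule that)
      finally show ?thesis .
    qed
    have chain_bound: "real (j - i) \<le> c * ln (1 + s / min (a i) (a j)) + c"
      if ij: "i \<le> j" "j \<le> m" and s: "\<rho> (p i) (p j) \<le> s" for i j s
    proof -
      obtain k l where k: "chain k l (p i) (p j)" "real k \<le> c * (j_inner D (p i) (p j) + 1)"
        using c(2) p(4)[of i] p(4)[of j] ij unfolding chain_le_j_def by fastforce
      have M: "0 < min (a i) (a j)" using a0 ij by simp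
      have r0: "0 \<le> \<rho> (p i) (p j)" using rho_nonneg p(4) ij by simp
      have "j_inner D (p i) (p j) \<le> ln (1 + s / min (a i) (a j))"
        unfolding j_inner_def a_def[symmetric]
        using M r0 s by (subst ln_le_cancel_iff) (auto intro!: add_pos_nonneg divide_right_mono)
      then have "c * j_inner D (p i) (p j) \<le> c * ln (1 + s / min (a i) (a j))" using c by simp
      moreover have "j - i \<le> k" using p(5) ij k(1) by blast
      ultimately show ?thesis using k(2) by (simp add: algebra_simps)
    qed
    interpret geodesic_sequence a m c
    proof
      fix l assume "l < m"
      then show "a (Suc l) \<le> 2 * a l" "a l \<le> 2 * a (Suc l)"
        using da[of l] a0[of l] a0[of "Suc l"] bdist_triangle[of "p l" "p (Suc l)"] bdist_triangle[of "p (Suc l)" "p l"]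
        by (auto simp: a_def dist_commute)
    next
      fix i j assume ij: "i \<le> j" "j \<le> m"
      have "\<rho> (p i) (p j) \<le> plen p {i..<j}" by (rule rho_le_chain[OF p(6)[OF ij]])
      also have "\<dots> \<le> sum a {i..j}" using ij by (intro dsum) auto
      finally show "real (j - i) \<le> c * ln (1 + sum a {i..j} / min (a i) (a j)) + c"
        by (rule chain_bound[OF ij])
    qed (use c a0 in auto)
    have total: "sum a {..m} \<le> seq_C c 5 * \<delta>"
    proof (rule total_sum[OF \<delta>])
      \<comment> \<open>The value 5 of \<open>E\<close> comes from
        \<open>bd x < 4 * \<delta>\<close> together with
        \<open>bd y \<le> bd x + dist x y\<close>.\<close>
      show "a 0 \<le> 5 * \<delta>" using bx \<delta> p(1) by (simp add: a_def)
      show "a m \<le> 5 * \<delta>" using bx xyd bdist_triangle[of y x] p(2) by (simp add: a_def dist_commute)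
    next
      fix i j assume ij: "i \<le> j" "j \<le> m" and aij: "\<delta> \<le> a i" "\<delta> \<le> a j"
      let ?s = "sum a {..i} + \<delta> + sum a {j..m}"
      have D: "p i \<in> D" "p j \<in> D" using ij p(4) by auto
      have 1: "\<rho> (p i) x \<le> sum a {..i}"
        using rho_le_chain[OF chain_sym[OF p(6)[of 0 i]]] dsum[of "{0..<i}" "{..i}"] ij p(1) by fastforce
      have 2: "\<rho> y (p j) \<le> sum a {j..m}"
        using rho_le_chain[OF chain_sym[OF p(6)[of j m]]] dsum[of "{j..<m}" "{j..m}"] ij p(2) by fastforce
      \<comment> \<open>The route from \<open>p i\<close> back to \<open>x\<close>, across to
        \<open>y\<close> and back along the chain to \<open>p j\<close> avoids the middle of the
        chain, whose sum is not yet under control.\<close>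
      have "\<rho> (p i) (p j) \<le> ?s"
        using rho_triangle[OF D(1) xy(1) D(2)] rho_triangle[OF xy D(2)] 1 2 by (simp add: \<delta>_def)
      from chain_bound[OF ij this]
      have "real (j - i) \<le> c * ln (1 + ?s / min (a i) (a j)) + c" .
      also have "?s / min (a i) (a j) \<le> ?s / \<delta>"
      proof (rule divide_left_mono)
        show "0 \<le> ?s" using a0 ij \<delta> by (intro add_nonneg_nonneg sum_nonneg) (auto intro: less_imp_le)
      qed (use aij \<delta> a0 ij in auto)
      finally show "real (j - i) \<le> c * ln (1 + ?s / \<delta>) + c"
      proof -
        have "0 \<le> ?s" using a0 ij \<delta> by (intro add_nonneg_nonneg sum_nonneg) (auto intro: less_imp_le)
        then have "0 \<le> ?s / min (a i) (a j)" using a0[of i] a0[of j] ij by (auto intro!: divide_nonneg_nonneg)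
        then have "ln (1 + ?s / min (a i) (a j)) \<le> ln (1 + ?s / \<delta>)"
          using \<open>?s / min (a i) (a j) \<le> ?s / \<delta>\<close> by (subst ln_le_cancel_iff) linarith+
        then have "c * ln (1 + ?s / min (a i) (a j)) \<le> c * ln (1 + ?s / \<delta>)" using c by simp
        with \<open>real (j - i) \<le> c * ln (1 + ?s / min (a i) (a j)) + c\<close> show ?thesis by linarith
      qed
    qed simp
    have "p 0 \<noteq> p m" using p(1,2) \<open>x \<noteq> y\<close> by simp
    then obtain g where g: "joining_arc D (p 0) (p m) g"
      and gt': "\<forall>t\<in>{0..1}. \<exists>i<m. g t \<in> closed_segment (p i) (p (Suc i)) \<and>
       elen g 0 t \<le> ereal (plen p {..i}) \<and> elen g t 1 \<le> ereal (plen p {i..<m})"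
      using step_polygon_arc[of m p, OF p(3)] by blast
    note gt = gt'[rule_format]
    have "joining_arc D x y g" using g p(1,2) by simp
    moreover have "min (elen g 0 t) (elen g t 1) \<le> ereal (C * bd (g t))"
      if t: "t \<in> {0..1}" for t
    proof -
      obtain i where i: "i < m" "g t \<in> closed_segment (p i) (p (Suc i))"
       "elen g 0 t \<le> ereal (plen p {..i})"
       "elen g t 1 \<le> ereal (plen p {i..<m})" using gt[OF t] by blast
      have "plen p {..i} \<le> sum a {..i}" using i(1) by (intro dsum) auto
      then have 1: "elen g 0 t \<le> ereal (sum a {..i})" using i(3) by (meson ereal_less_eq(3) order_trans)
      have "plen p {i..<m} \<le> sum a {i..m}" by (intro dsum) auto
      then have 2: "elen g t 1 \<le> ereal (sum a {i..m})" using i(4) by (meson ereal_less_eq(3) order_trans)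
      \<comment> \<open>The edge is no longer than a quarter of \<open>a i\<close>, so the boundary
        distance on it is at least half of \<open>a i\<close>. This is the factor 2 in
        \<open>C\<close>.\<close>
      have "a i \<le> 2 * bd (g t)"
        using da[OF i(1)] dist_in_closed_segment(1)[OF i(2)] bdist_triangle[of "p i" "g t"] a0[of i] i(1)
        by (auto simp: a_def dist_commute)
      then have "seq_B c * a i \<le> seq_B c * (2 * bd (g t))"
        by (intro mult_left_mono) (auto simp: seq_B_def)
      also have "\<dots> \<le> C * bd (g t)"
      proof -
        have "(2 * seq_B c) * bd (g t) \<le> C * bd (g t)"
          using C(2) \<open>a i \<le> 2 * bd (g t)\<close> a0[of i] i(1) by (intro mult_right_mono) auto
        then show ?thesis by (simp add: mult_ac)
      qed
      finally have B: "seq_B c * a i \<le> C * bd (g t)" .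
      show ?thesis using cigar[OF less_imp_le[OF i(1)]]
      proof
        assume "sum a {..i} \<le> seq_B c * a i"
        with B have "ereal (sum a {..i}) \<le> ereal (C * bd (g t))" by simp
        with 1 show ?thesis by (meson min.coboundedI1 order_trans)
      next
        assume "sum a {i..m} \<le> seq_B c * a i"
        with B have "ereal (sum a {i..m}) \<le> ereal (C * bd (g t))" by simp
        with 2 show ?thesis by (meson min.coboundedI2 order_trans)
      qed
    qed
    moreover have "elen g 0 1 \<le> ereal (C * \<rho> x y)"
    proof -
      obtain i where i: "i < m" "elen g 0 1 \<le> ereal (plen p {i..<m})" using gt[of 0] by auto
      have "plen p {i..<m} \<le> sum a {..m}" by (intro dsum) auto
      also have "\<dots> \<le> C * \<delta>" using total C(3) \<delta> mult_right_mono[of "seq_C c 5" C \<delta>] by linarith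
      finally show ?thesis using i(2) unfolding \<delta>_def by (meson ereal_less_eq(3) order_trans)
    qed
    ultimately show ?thesis by blast
  qed
qed

lemma chain_le_j_imp_inner_uniform:
  assumes c: "0 < c" "chain_le_j c"
  shows "inner_uniform (2 * seq_B c + seq_C c 5 + 1) D"
    and "diameter_inner_uniform (2 * seq_B c + seq_C c 5 + 1) D"
proof -
  let ?C = "2 * seq_B c + seq_C c 5 + 1"
  have C: "0 \<le> ?C" by (auto simp: seq_B_def seq_C_def seq_G_def)
  show "inner_uniform ?C D"
    unfolding inner_uniform_def
  proof (intro ballI)
    fix x y assume xy: "x \<in> D" "y \<in> D"
    obtain g where g: "joining_arc D x y g"
     "\<forall>t\<in>{0..1}. min (elen g 0 t) (elen g t 1) \<le> ereal (?C * bd (g t))"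
     "elen g 0 1 \<le> ereal (?C * \<rho> x y)" using inner_uniform_arc[OF c xy] by blast
    have "ereal (?C * \<rho> x y) = ereal ?C * ereal (\<rho> x y)" by simp
    also have "\<dots> \<le> ereal ?C * inner_length_metric D x y"
      using C by (intro ereal_mult_left_mono rho_le_inner_length) auto
    finally have "elen g 0 1 \<le> ereal ?C * inner_length_metric D x y" using g(3) by order
    then show "\<exists>g. joining_arc D x y g \<and>
     (\<forall>t\<in>{0..1}. min (elen g 0 t) (elen g t 1) \<le> ereal (?C * bd (g t))) \<and>
     elen g 0 1 \<le> ereal ?C * inner_length_metric D x y" using g by blast
  qed
  show "diameter_inner_uniform ?C D"
    unfolding diameter_inner_uniform_def
  proof (intro ballI)
    fix x y assume xy: "x \<in> D" "y \<in> D"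
    obtain g where g: "joining_arc D x y g"
     "\<forall>t\<in>{0..1}. min (elen g 0 t) (elen g t 1) \<le> ereal (?C * bd (g t))"
     "elen g 0 1 \<le> ereal (?C * \<rho> x y)" using inner_uniform_arc[OF c xy] by blast
    have "diameter (path_image g) \<le> ?C * \<rho> x y"
      using diameter_le_dlength[of 0 1 g] g(3) unfolding path_image_def by (meson ereal_less_eq(3) order.refl order_trans zero_le_one)
    moreover have "min (diameter (g ` {0..t})) (diameter (g ` {t..1})) \<le> ?C * bd (g t)"
      if t: "t \<in> {0..1}" for t
    proof -
      have "ereal (diameter (g ` {0..t})) \<le> elen g 0 t" "ereal (diameter (g ` {t..1})) \<le> elen g t 1"
        using t by (auto intro!: diameter_le_dlength)
      then have "min (ereal (diameter (g ` {0..t}))) (ereal (diameter (g ` {t..1}))) \<le> ereal (?C * bd (g t))"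
        using g(2) t min.mono order_trans by blast
      then show ?thesis by (auto simp: min_le_iff_disj)
    qed
    ultimately show "\<exists>g. joining_arc D x y g \<and>
        (\<forall>t\<in>{0..1}. min (diameter (g ` {0..t})) (diameter (g ` {t..1})) \<le> ?C * bd (g t)) \<and>
        diameter (path_image g) \<le> ?C * \<rho> x y" using g(1) by blast
  qed
qed

end

section \<open>Cigars and carrots\<close>

lemma first_hit:
  fixes h :: "real \<Rightarrow> real"
  assumes h: "continuous_on {a..t0} h" "h a \<le> r" "r \<le> h t0" "a \<le> t0"
  obtains T where "T \<in> {a..t0}" "h T = r" "\<And>t. t \<in> {a..T} \<Longrightarrow> h t \<le> r"
proof -
  define S where "S = {t \<in> {a..t0}. h t = r}"
  have "S = {a..t0} \<inter> h -` {r}" by (auto simp: S_def)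
  moreover have "closed ({a..t0} \<inter> h -` {r})"
    by (rule continuous_closed_preimage[OF h(1)]) auto
  ultimately have "compact S" by (metis compact_Icc compact_Int_closed inf.idem inf_assoc)
  moreover have "S \<noteq> {}" using IVT'[of h a r t0] h by (auto simp: S_def)
  ultimately obtain T where T: "T \<in> S" "\<And>t. t \<in> S \<Longrightarrow> T \<le> t" using compact_attains_inf by metis
  have "h t \<le> r" if t: "t \<in> {a..T}" for t
  proof (rule ccontr)
    assume "\<not> h t \<le> r"
    then have "t \<noteq> T" using T(1) by (auto simp: S_def)
    moreover have "continuous_on {a..t} h"
      by (rule continuous_on_subset[OF h(1)]) (use t T(1) in \<open>auto simp: S_def\<close>)
    then obtain u where "a \<le> u" "u \<le> t" "h u = r"
      using IVT'[of h a r t] h(2) t \<open>\<not> h t \<le> r\<close> by auto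
    moreover have "u \<in> S" using calculation t T(1) by (auto simp: S_def)
    ultimately show False using T(2)[of u] t by auto
  qed
  then show thesis using that[of T] T(1) by (auto simp: S_def)
qed

context subdomain
begin

lemma stepI: "u \<in> D \<Longrightarrow> v \<in> D \<Longrightarrow> 8 * dist u v \<le> bd u \<Longrightarrow> step u v"
  using bdist_triangle[of u v] zero_le_dist[of u v] unfolding step_def by linarith

text \<open>The cost of one doubling of the distance from the tip in \<open>carrot_chain\<close>. It
  involves \<open>N\<close> and \<open>c\<close> but not the domain.\<close>

definition carrot_steps :: "real \<Rightarrow> real" where
  "carrot_steps c = real (2 * N (8 * c))"

text \<open>The boundary distance at \<open>g t\<close> controls the distance to the tip of every
  earlier point, not just of \<open>g t\<close>. Once the path has reached distance 2^n d / 8, where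
  d is \<open>bd (g 0)\<close>, it stays away from the boundary even if it turns back towards the
  tip. The remainder, confined to twice that radius, costs one application of
  \<open>cover_chain\<close>. Lengths add up like a geometric series, hence the factor 2^n.\<close>

lemma carrot_chain:
  fixes g :: "real \<Rightarrow> 'a"
  assumes c: "1 \<le> c" and T: "0 \<le> T" and g: "continuous_on {0..T} g" "g ` {0..T} \<subseteq> D"
    and carrot: "\<And>t' t. 0 \<le> t' \<Longrightarrow> t' \<le> t \<Longrightarrow> t \<le> T \<Longrightarrow> dist (g t') (g 0) \<le> c * bd (g t)"
    and n: "\<And>t. t \<in> {0..T} \<Longrightarrow> 8 * dist (g t) (g 0) \<le> 2 ^ n * bd (g 0)"
  shows "chain (n * (2 * N (8 * c)) + 1) ((carrot_steps c + 1) * (2 ^ n * bd (g 0))) (g 0) (g T)"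
  using T g carrot n
proof (induction n arbitrary: T)
  case 0
  let ?z = "g 0"
  have z: "?z \<in> D" "g T \<in> D" using 0(1) by (auto intro!: subsetD[OF 0(3)] imageI)
  have d: "8 * dist (g T) ?z \<le> bd ?z" using 0(1) 0(5)[of T] by simp
  have "step ?z (g T)"
    using d z by (intro stepI) (auto simp: dist_commute)
  then have "chain 1 (dist ?z (g T)) ?z (g T)" by (rule chain_single)
  moreover have "dist ?z (g T) \<le> (carrot_steps c + 1) * bd ?z"
  proof -
    have "dist ?z (g T) \<le> 1 * bd ?z" using d zero_le_dist[of "g T" ?z] unfolding dist_commute[of "g T"] by linarith
    also have "\<dots> \<le> (carrot_steps c + 1) * bd ?z"
      using bdist_pos[OF z(1)] by (intro mult_right_mono) (auto simp: carrot_steps_def)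
    finally show ?thesis .
  qed
  ultimately show ?case by (auto intro: chain_mono)
next
  case (Suc n)
  let ?z = "g 0" and ?k = "2 * N (8 * c)"
  have z: "?z \<in> D" using Suc.prems(1) by (auto intro!: subsetD[OF Suc.prems(3)] imageI)
  have dz: "0 < bd ?z" by (rule bdist_pos[OF z])
  show ?case
  proof (cases "\<exists>t0\<in>{0..T}. 2 ^ n * bd ?z \<le> 8 * dist (g t0) ?z")
    case False
    then have "chain (n * ?k + 1) ((carrot_steps c + 1) * (2 ^ n * bd ?z)) ?z (g T)"
      by (intro Suc.IH Suc.prems) (auto simp: not_le less_imp_le)
    then have "chain (Suc n * ?k + 1) ((carrot_steps c + 1) * (2 ^ n * bd ?z)) ?z (g T)"
      by (rule chain_pad) simp
    then show ?thesis
      by (rule chain_mono) (use dz in \<open>auto intro!: mult_left_mono simp: carrot_steps_def\<close>)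
  next
    case True
    then obtain t0 where t0: "t0 \<in> {0..T}" "2 ^ n * bd ?z \<le> 8 * dist (g t0) ?z" by blast
    have "continuous_on {0..t0} (\<lambda>t. 8 * dist (g t) ?z)"
      by (intro continuous_intros continuous_on_subset[OF Suc.prems(2)]) (use t0 in auto)
    then obtain T1 where T1: "T1 \<in> {0..t0}" "8 * dist (g T1) ?z = 2 ^ n * bd ?z"
        "\<And>t. t \<in> {0..T1} \<Longrightarrow> 8 * dist (g t) ?z \<le> 2 ^ n * bd ?z"
      by (rule first_hit[of 0 t0 _ "2 ^ n * bd ?z"]) (use t0 dz in auto)
    have T1T: "0 \<le> T1" "T1 \<le> T" using T1(1) t0(1) by auto
    have 1: "chain (n * ?k + 1) ((carrot_steps c + 1) * (2 ^ n * bd ?z)) ?z (g T1)"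
    proof (rule Suc.IH)
      show "continuous_on {0..T1} g" by (rule continuous_on_subset[OF Suc.prems(2)]) (use T1T in auto)
      show "g ` {0..T1} \<subseteq> D" using Suc.prems(3) T1T by (auto simp: image_subset_iff)
      show "dist (g t') ?z \<le> c * bd (g t)" if "0 \<le> t'" "t' \<le> t" "t \<le> T1" for t' t
        using Suc.prems(4)[of t' t] that T1T by auto
    qed (use T1 in auto)
    \<comment> \<open>\<open>c * s\<close> is the distance from the tip reached at
      \<open>T1\<close>; hence \<open>s\<close> bounds \<open>bd\<close> from below after
      \<open>T1\<close>, and \<open>2 * c * s\<close> is the radius containing the
      remainder.\<close>
    define s where "s = 2 ^ n * bd ?z / (8 * c)"
    have s: "0 < s" "8 * (c * s) = 2 ^ n * bd ?z" using dz c by (auto simp: s_def)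
    have "chain (2 * N (4 * (2 * c))) (real (2 * N (4 * (2 * c))) * s) (g T1) (g T)"
    proof (rule cover_chain[of "g ` {T1..T}" _ _ ?z])
      show "connected (g ` {T1..T})"
        by (intro connected_continuous_image continuous_on_subset[OF Suc.prems(2)]) (use T1T in auto)
      show "g ` {T1..T} \<subseteq> D" using Suc.prems(3) T1T by (auto simp: image_subset_iff)
      show "g ` {T1..T} \<subseteq> cball ?z (2 * c * s)"
      proof
        fix w assume "w \<in> g ` {T1..T}"
        then obtain t where t: "t \<in> {T1..T}" "w = g t" by blast
        then have "8 * dist w ?z \<le> 2 ^ Suc n * bd ?z" using Suc.prems(5)[of t] T1T by auto
        then have "dist w ?z \<le> 2 * (c * s)" using s(2) unfolding power_Suc mult.assoc[of 2] by linarith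
        then show "w \<in> cball ?z (2 * c * s)" by (simp add: dist_commute mult.assoc)
      qed
      fix w assume "w \<in> g ` {T1..T}"
      then obtain t where t: "t \<in> {T1..T}" "w = g t" by blast
      have "dist (g T1) ?z \<le> c * bd w" using Suc.prems(4)[of T1 t] T1T t by auto
      then have "c * s \<le> c * bd w" using T1(2) s(2) by linarith
      then show "s \<le> bd w" using c by simp
    qed (use s T1T in auto)
    then have 2: "chain ?k (carrot_steps c * s) (g T1) (g T)" by (simp add: carrot_steps_def)
    have "chain (n * ?k + 1 + ?k) ((carrot_steps c + 1) * (2 ^ n * bd ?z) + carrot_steps c * s) ?z (g T)"
      by (rule chain_trans[OF 1 2])
    moreover have "carrot_steps c * s \<le> (carrot_steps c + 1) * (2 ^ n * bd ?z)"
    proof (rule mult_mono)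
      have "s \<le> c * s" using c s(1) by simp
      then show "s \<le> 2 ^ n * bd ?z" using s by linarith
    qed (use s in \<open>auto simp: carrot_steps_def\<close>)
    ultimately show ?thesis by (auto intro: chain_mono simp: algebra_simps)
  qed
qed

section \<open>From uniformity to the chain bound\<close>

definition cigar_path :: "real \<Rightarrow> (real \<Rightarrow> 'a) \<Rightarrow> bool" where
  "cigar_path c g \<longleftrightarrow> (\<forall>t\<in>{0..1}.
     (\<forall>t1\<in>{0..t}. \<forall>t2\<in>{0..t}. dist (g t1) (g t2) \<le> c * bd (g t)) \<or>
     (\<forall>t1\<in>{t..1}. \<forall>t2\<in>{t..1}. dist (g t1) (g t2) \<le> c * bd (g t)))"

text \<open>A common weakening of the conditions \<^const>\<open>inner_uniform\<close> and
  \<^const>\<open>diameter_inner_uniform\<close>.\<close>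

definition weakly_uniform :: "real \<Rightarrow> bool" where
  "weakly_uniform c \<longleftrightarrow> (\<forall>x\<in>D. \<forall>y\<in>D. \<exists>g. path g \<and> path_image g \<subseteq> D \<and> pathstart g = x \<and> pathfinish g = y \<and>
     cigar_path c g \<and> (\<forall>m l. chain m l x y \<longrightarrow> (\<forall>t1\<in>{0..1}. \<forall>t2\<in>{0..1}. dist (g t1) (g t2) \<le> c * l)))"

text \<open>For the least \<open>n\<close> with 2^n d at least 8 r, minimality gives 2^n \<le> 16 (1
  + r / d); taking logarithms and using ln 2 \<ge> 1/2 bounds \<open>n\<close>.\<close>

lemma dyadic_scale:
  fixes r d :: real
  assumes "0 < d" "0 < r"
  obtains n :: nat where "8 * r \<le> 2 ^ n * d" "2 ^ n * d \<le> d + 16 * r" "real n \<le> 8 + 2 * ln (1 + r / d)"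
proof -
  have "\<exists>n. 8 * r / d < 2 ^ n" using real_arch_pow[of 2] by simp
  then have ex: "\<exists>n. 8 * r \<le> 2 ^ n * d" using assms by (auto simp: pos_divide_less_eq intro: less_imp_le)
  define n where "n = (LEAST n. 8 * r \<le> 2 ^ n * d)"
  have n: "8 * r \<le> 2 ^ n * d" unfolding n_def by (rule LeastI_ex[OF ex])
  have up: "2 ^ n * d \<le> d + 16 * r"
  proof (cases n)
    case 0
    then show ?thesis using assms by simp
  next
    case (Suc k)
    then have "\<not> 8 * r \<le> 2 ^ k * d" using not_less_Least[of k "\<lambda>n. 8 * r \<le> 2 ^ n * d"] n_def by auto
    then show ?thesis using Suc assms by simp
  qed
  have "2 ^ n \<le> 1 + 16 * (r / d)" using up assms by (simp add: field_simps)
  also have "\<dots> \<le> 16 * (1 + r / d)" by simp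
  finally have "ln (2 ^ n) \<le> ln (16 * (1 + r / d))" using assms by (subst ln_le_cancel_iff) (auto intro: add_pos_pos)
  also have "\<dots> = ln (2 ^ 4) + ln (1 + r / d)"
  proof -
    have "0 < 1 + r / d" using assms by (simp add: add_pos_pos)
    then show ?thesis using ln_mult_pos[of 16 "1 + r / d"] by simp
  qed
  finally have "real n * ln 2 \<le> 4 * ln 2 + ln (1 + r / d)"
    using ln_realpow[of 2 n] ln_realpow[of 2 4] by simp
  moreover have "real n * (1 / 2) \<le> real n * ln 2"
    by (intro mult_left_mono) (use ln2_ge_two_thirds in auto)
  moreover have "4 * ln 2 \<le> (4::real)" using ln_le_minus_one[of 2] by simp
  ultimately have "real n \<le> 8 + 2 * ln (1 + r / d)" by linarith
  with n up show thesis using that by blast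
qed

text \<open>Up to the first time \<open>T\<close> at distance \<open>r\<close> from
  \<open>z\<close>, the path is a carrot with tip \<open>z\<close>. This is immediate where the
  cigar condition concerns the initial part. Where it concerns the final part, that part contains
  both \<open>g T\<close> and \<open>g t0\<close>, which are at least \<open>r\<close> apart, so
  \<open>c * bd (g t)\<close> is at least \<open>r\<close>, which bounds all earlier distances to
  \<open>z\<close>.\<close>

lemma carrot:
  assumes c: "1 \<le> c" and g: "path g" "path_image g \<subseteq> D" "pathstart g = z" "cigar_path c g"
    and r: "0 < r" "t0 \<in> {0..1}" "2 * r \<le> dist (g t0) z"
  obtains w m where "chain m ((carrot_steps c + 1) * (bd z + 16 * r)) z w"
    "real m \<le> carrot_steps c * (8 + 2 * ln (1 + r / bd z)) + 1"
    "dist w z = r" "r \<le> c * bd w"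
proof -
  have z0: "g 0 = z" using g by (simp add: pathstart_def)
  have cont: "continuous_on {0..1} g" using g by (simp add: path_def)
  have gD: "g t \<in> D" if "t \<in> {0..1}" for t using g that by (auto simp: path_image_def)
  have dz: "0 < bd z" using bdist_pos[of z] gD[of 0] z0 by auto
  have "continuous_on {0..t0} (\<lambda>t. dist (g t) z)"
    by (intro continuous_intros continuous_on_subset[OF cont]) (use r in auto)
  then obtain T where T: "T \<in> {0..t0}" "dist (g T) z = r" "\<And>t. t \<in> {0..T} \<Longrightarrow> dist (g t) z \<le> r"
    by (rule first_hit[of 0 t0 _ r]) (use r z0 in auto)
  have T01: "0 \<le> T" "T \<le> 1" using T(1) r by auto
  have car: "dist (g t') (g 0) \<le> c * bd (g t)" if t: "0 \<le> t'" "t' \<le> t" "t \<le> T" for t' t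
  proof -
    have "t \<in> {0..1}" using t T01 by auto
    then consider "\<forall>t1\<in>{0..t}. \<forall>t2\<in>{0..t}. dist (g t1) (g t2) \<le> c * bd (g t)"
      | "\<forall>t1\<in>{t..1}. \<forall>t2\<in>{t..1}. dist (g t1) (g t2) \<le> c * bd (g t)"
      using g(4) unfolding cigar_path_def by blast
    then show ?thesis
    proof cases
      case 1
      then show ?thesis using t by auto
    next
      case 2
      then have "dist (g t0) (g T) \<le> c * bd (g t)" using t T(1) r(2) T01 by auto
      moreover have "r \<le> dist (g t0) (g T)" using dist_triangle[of "g t0" z "g T"] T(2) r(3) by linarith
      ultimately show ?thesis using T(3)[of t'] t z0 by auto
    qed
  qed
  obtain n where n: "8 * r \<le> 2 ^ n * bd z" "2 ^ n * bd z \<le> bd z + 16 * r"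
      "real n \<le> 8 + 2 * ln (1 + r / bd z)" using dyadic_scale[OF dz r(1)] by blast
  have "chain (n * (2 * N (8 * c)) + 1) ((carrot_steps c + 1) * (2 ^ n * bd (g 0))) (g 0) (g T)"
  proof (rule carrot_chain[OF c T01(1)])
    show "continuous_on {0..T} g" by (rule continuous_on_subset[OF cont]) (use T01 in auto)
    show "g ` {0..T} \<subseteq> D" using gD T01 by auto
    show "8 * dist (g t) (g 0) \<le> 2 ^ n * bd (g 0)" if "t \<in> {0..T}" for t
      using T(3)[OF that] n(1) z0 by simp
  qed (rule car)
  then have ch: "chain (n * (2 * N (8 * c)) + 1) ((carrot_steps c + 1) * (bd z + 16 * r)) z (g T)"
    unfolding z0 by (rule chain_mono) (use n(2) in \<open>auto intro!: mult_left_mono simp: carrot_steps_def\<close>)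
  have "real (n * (2 * N (8 * c)) + 1) = carrot_steps c * real n + 1" by (simp add: carrot_steps_def)
  also have "\<dots> \<le> carrot_steps c * (8 + 2 * ln (1 + r / bd z)) + 1"
    using n(3) by (intro add_right_mono mult_left_mono) (auto simp: carrot_steps_def)
  finally show thesis
    using that[OF ch] T(2) car[of T T] T01 z0 by auto
qed

text \<open>Otherwise the union of the two paths, which connects \<open>x\<close> to
  \<open>y\<close>, would lie within \<rho>/4 of \<open>z\<close> and have diameter at most
  \<rho>/2.\<close>

lemma far_point:
  assumes xyz: "x \<in> D" "y \<in> D" "0 < \<rho> x y"
    and g: "path g" "path_image g \<subseteq> D" "pathstart g = z" "pathfinish g = x"
    and h: "path h" "path_image h \<subseteq> D" "pathstart h = z" "pathfinish h = y"
  shows "\<exists>k\<in>{g, h}. \<exists>t\<in>{0..1}. \<rho> x y / 4 \<le> dist (k t) z"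
proof (rule ccontr)
  assume "\<not> ?thesis"
  then have near: "dist w z \<le> \<rho> x y / 4" if "w \<in> path_image g \<union> path_image h" for w
    using that by (force simp: path_image_def not_le)
  have mem: "z \<in> path_image g" "z \<in> path_image h" "x \<in> path_image g" "y \<in> path_image h"
    using g h pathstart_in_path_image pathfinish_in_path_image by metis+
  have "\<rho> x y \<le> diameter (path_image g \<union> path_image h)"
  proof (rule rho_le_connected)
    show "connected (path_image g \<union> path_image h)"
      using mem g h by (intro connected_Un connected_path_image) auto
  qed (use mem g h in \<open>auto intro: bounded_path_image\<close>)
  also have "\<dots> \<le> \<rho> x y / 2"
  proof (rule diameter_le)
    fix u v assume "u \<in> path_image g \<union> path_image h" "v \<in> path_image g \<union> path_image h"
    then have "dist u v \<le> \<rho> x y / 2" using near[of u] near[of v] dist_triangle2[of u v z] by linarith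
    then show "norm (u - v) \<le> \<rho> x y / 2" by (simp add: dist_norm)
  qed (use xyz in auto)
  finally show False using xyz by simp
qed

text \<open>The radius \<rho>/8 is half of what \<open>far_point\<close> supplies, since
  \<open>carrot\<close> needs a point of the path at distance \<open>2 * r\<close> from its
  start.\<close>

lemma carrot_exists:
  assumes c: "1 \<le> c" "weakly_uniform c" and xy: "x \<in> D" "y \<in> D" "0 < \<rho> x y" and z: "z \<in> D"
  shows "\<exists>w m. chain m ((carrot_steps c + 1) * (bd z + 2 * \<rho> x y)) z w \<and>
    real m \<le> carrot_steps c * (8 + 2 * ln (1 + \<rho> x y / bd z)) + 1 \<and>
    dist w z = \<rho> x y / 8 \<and> \<rho> x y \<le> 8 * c * bd w"
proof -
  obtain g where g: "path g" "path_image g \<subseteq> D" "pathstart g = z" "pathfinish g = x" "cigar_path c g"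
    using c(2) z xy unfolding weakly_uniform_def by blast
  obtain h where h: "path h" "path_image h \<subseteq> D" "pathstart h = z" "pathfinish h = y" "cigar_path c h"
    using c(2) z xy unfolding weakly_uniform_def by blast
  obtain k t where k: "k \<in> {g, h}" "t \<in> {0..1}" "\<rho> x y / 4 \<le> dist (k t) z"
    using far_point[OF xy g(1-4) h(1-4)] by blast
  have kp: "path k" "path_image k \<subseteq> D" "pathstart k = z" "cigar_path c k" using k(1) g h by auto
  obtain w m where w: "chain m ((carrot_steps c + 1) * (bd z + 16 * (\<rho> x y / 8))) z w"
    "real m \<le> carrot_steps c * (8 + 2 * ln (1 + \<rho> x y / 8 / bd z)) + 1"
    "dist w z = \<rho> x y / 8" "\<rho> x y / 8 \<le> c * bd w"
    by (rule carrot[OF c(1) kp, of "\<rho> x y / 8" t]) (use xy k in auto)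
  have "\<rho> x y / 8 / bd z \<le> \<rho> x y / bd z"
    using xy(3) bdist_pos[OF z] by (intro divide_right_mono) auto
  moreover have "0 \<le> \<rho> x y / 8 / bd z" using xy(3) bdist_pos[OF z] by simp
  ultimately have "ln (1 + \<rho> x y / 8 / bd z) \<le> ln (1 + \<rho> x y / bd z)"
    by (subst ln_le_cancel_iff) linarith+
  then have "carrot_steps c * (8 + 2 * ln (1 + \<rho> x y / 8 / bd z)) \<le> carrot_steps c * (8 + 2 * ln (1 + \<rho> x y / bd z))"
    by (intro mult_left_mono) (auto simp: carrot_steps_def)
  with w show ?thesis by (intro exI[of _ w] exI[of _ m]) (auto simp: algebra_simps)
qed

text \<open>416 is 26 * 16: the size \<open>c * (26 * (carrot_steps c + 1) * \<delta>)\<close> of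
  the path in \<open>cigar_chain\<close> is measured in units of \<delta> / (16 c^2). The final 1
  makes room for a single step.\<close>

definition cigar_steps :: "real \<Rightarrow> nat" where
  "cigar_steps c = 2 * N (4 * (416 * c ^ 3 * (carrot_steps c + 1))) + 1"

text \<open>The given chain is used for its length, which bounds the size of a cigar path from
  \<open>u\<close> to \<open>v\<close>; the number of its steps is replaced. Every point
  \<open>p\<close> of that path has \<open>bd p\<close> at least \<open>s\<close>: otherwise
  \<open>p\<close> would be farther than \<open>c * s\<close> from both \<open>u\<close> and
  \<open>v\<close>, as their boundary distances are at least \<open>2 * (c * s)\<close>, against the
  cigar condition at \<open>p\<close>.\<close>

lemma cigar_chain:
  assumes c: "1 \<le> c" "weakly_uniform c" and w: "\<delta> \<le> 8 * c * bd u" "\<delta> \<le> 8 * c * bd v"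
    and \<delta>: "0 < \<delta>" and ch: "chain m (26 * (carrot_steps c + 1) * \<delta>) u v"
  shows "\<exists>l. chain (cigar_steps c) l u v"
proof -
  have uv: "u \<in> D" "v \<in> D" using chain_mem[OF ch] by auto
  obtain g where g: "path g" "path_image g \<subseteq> D" "pathstart g = u" "pathfinish g = v" "cigar_path c g"
    "\<And>t1 t2. t1 \<in> {0..1} \<Longrightarrow> t2 \<in> {0..1} \<Longrightarrow> dist (g t1) (g t2) \<le> c * (26 * (carrot_steps c + 1) * \<delta>)"
    using c(2) uv ch unfolding weakly_uniform_def by blast
  have g01: "g 0 = u" "g 1 = v" using g by (auto simp: pathstart_def pathfinish_def)
  define s where "s = \<delta> / (16 * c\<^sup>2)"
  have s0: "0 < s" using \<delta> c by (simp add: s_def)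
  have s: "16 * (c * (c * s)) = \<delta>" using c by (simp add: s_def power2_eq_square)
  have cs: "s \<le> c * s" using c s0 by simp
  have bw: "2 * (c * s) \<le> bd u" "2 * (c * s) \<le> bd v"
  proof -
    have "c * (2 * (c * s)) \<le> c * bd u" "c * (2 * (c * s)) \<le> c * bd v" using w s by auto
    then show "2 * (c * s) \<le> bd u" "2 * (c * s) \<le> bd v" using c by auto
  qed
  have "chain (2 * N (4 * (416 * c ^ 3 * (carrot_steps c + 1)))) (real (2 * N (4 * (416 * c ^ 3 * (carrot_steps c + 1)))) * s) u v"
  proof (rule cover_chain[of "path_image g" _ _ u])
    show "u \<in> path_image g" "v \<in> path_image g" using g pathstart_in_path_image pathfinish_in_path_image by metis+
    show "path_image g \<subseteq> cball u (416 * c ^ 3 * (carrot_steps c + 1) * s)"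
    proof
      fix p assume "p \<in> path_image g"
      then obtain t where "t \<in> {0..1}" "p = g t" by (auto simp: path_image_def)
      then have "dist u p \<le> c * (26 * (carrot_steps c + 1) * \<delta>)" using g(6)[of 0 t] g01 by simp
      also have "\<dots> = 416 * c ^ 3 * (carrot_steps c + 1) * s"
        using s by (simp add: power3_eq_cube flip: s)
      finally show "p \<in> cball u (416 * c ^ 3 * (carrot_steps c + 1) * s)" by simp
    qed
    fix p assume "p \<in> path_image g"
    then obtain t where t: "t \<in> {0..1}" "p = g t" by (auto simp: path_image_def)
    show "s \<le> bd p"
    proof (rule ccontr)
      assume "\<not> s \<le> bd p"
      then have p: "bd p < s" "c * bd p < c * s" using c by auto
      have "c * s < dist p u" "c * s < dist p v"
        using bdist_triangle[of u p] bdist_triangle[of v p] bw p(1) cs by (auto simp: dist_commute)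
      moreover have "dist p u \<le> c * bd p \<or> dist p v \<le> c * bd p"
        using g(5) t g01 unfolding cigar_path_def by fastforce
      ultimately show False using p(2) by linarith
    qed
  qed (use g s0 in \<open>auto intro: connected_path_image\<close>)
  from chain_pad[OF this, of "cigar_steps c"] show ?thesis by (auto simp: cigar_steps_def)
qed

lemma weakly_uniform_imp_chain_le_j:
  assumes c: "1 \<le> c" "weakly_uniform c"
  shows "chain_le_j (20 * carrot_steps c + 3 + real (2 * N (96 * c) * cigar_steps c))"
  unfolding chain_le_j_def
proof (intro ballI)
  fix x y assume xy: "x \<in> D" "y \<in> D"
  let ?k = "carrot_steps c"
  let ?C = "20 * ?k + 3 + real (2 * N (96 * c) * cigar_steps c)"
  have k0: "0 \<le> ?k" by (simp add: carrot_steps_def)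
  define \<delta> where "\<delta> = \<rho> x y"
  have bx: "0 < bd x" "0 < bd y" using bdist_pos xy by auto
  have d0: "0 \<le> \<delta>" "dist x y \<le> \<delta>" unfolding \<delta>_def using rho_nonneg dist_le_rho xy by auto
  have j0: "0 \<le> j_inner D x y" unfolding j_inner_def \<delta>_def[symmetric] using d0 bx by simp
  show "\<exists>m l. chain m l x y \<and> real m \<le> ?C * (j_inner D x y + 1)"
  \<comment> \<open>Such close points form a single step. Otherwise
    \<open>bd x < 8 * \<delta>\<close>, which bounds the boundary distance on all of \<sigma> by a
    multiple of \<delta>.\<close>
  proof (cases "8 * \<delta> \<le> bd x")
    case True
    then have "step x y" using xy d0 by (intro stepI) auto
    then have "chain 1 (dist x y) x y" by (rule chain_single)
    moreover have "real 1 \<le> ?C * (j_inner D x y + 1)"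
      using mult_mono[of 1 ?C 1 "j_inner D x y + 1"] k0 j0 by simp
    ultimately show ?thesis by blast
  next
    case False
    then have \<delta>: "0 < \<delta>" "bd x < 8 * \<delta>" using bx by auto
    obtain \<sigma> where \<sigma>: "joining_arc D x y \<sigma>" "diameter (path_image \<sigma>) < 2 * \<delta>"
      using rho_arc[OF xy, of "2 * \<delta>"] \<delta> by (auto simp: \<delta>_def)
    let ?K = "path_image \<sigma>"
    have K: "connected ?K" "x \<in> ?K" "y \<in> ?K" "?K \<subseteq> D"
      using \<sigma>(1) by (auto simp: joining_arc_def joining_path_def rectifiable_def intro: connected_path_image)
    have xz: "dist x z \<le> 2 * \<delta>" if "z \<in> ?K" for z
      using diameter_bounded_bound[OF joining_arc_bounded[OF \<sigma>(1)] K(2) that] \<sigma>(2) by simp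
    have bz: "bd z \<le> 10 * \<delta>" if "z \<in> ?K" for z
      using bdist_triangle[of z x] xz[OF that] \<delta>(2) by (simp add: dist_commute)
    have "\<forall>z\<in>?K. \<exists>w m. chain m ((?k + 1) * (bd z + 2 * \<delta>)) z w \<and>
      real m \<le> ?k * (8 + 2 * ln (1 + \<delta> / bd z)) + 1 \<and>
      dist w z = \<delta> / 8 \<and> \<delta> \<le> 8 * c * bd w"
      unfolding \<delta>_def using carrot_exists[OF c xy] \<delta>(1) K(4) by (auto simp: \<delta>_def)
    then obtain f \<mu> where f: "\<And>z. z \<in> ?K \<Longrightarrow> chain (\<mu> z) ((?k + 1) * (bd z + 2 * \<delta>)) z (f z)"
      "\<And>z. z \<in> ?K \<Longrightarrow> real (\<mu> z) \<le> ?k * (8 + 2 * ln (1 + \<delta> / bd z)) + 1"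
      "\<And>z. z \<in> ?K \<Longrightarrow> dist (f z) z = \<delta> / 8" "\<And>z. z \<in> ?K \<Longrightarrow> \<delta> \<le> 8 * c * bd (f z)"
      by metis
    have fl: "chain (\<mu> z) ((?k + 1) * (12 * \<delta>)) z (f z)" if "z \<in> ?K" for z
      by (rule chain_mono[OF f(1)[OF that]]) (use bz[OF that] k0 in \<open>auto intro!: mult_left_mono\<close>)
    let ?E = "\<lambda>u v. \<exists>l. chain (cigar_steps c) l (f u) (f v)"
    have "\<exists>m \<le> 2 * N (96 * c). (x, y) \<in> {(u, v). u \<in> ?K \<and> v \<in> ?K \<and> ?E u v} ^^ m"
    \<comment> \<open>The boundary distance at each \<open>f z\<close> is at least \<delta> / (8 c),
      so images within \<delta> / (32 c) of each other form a step. The images lie within 3 \<delta>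
      of \<open>x\<close>, which is 96 c times this scale.\<close>
    proof (rule packing_chain[OF N K(1-3), of "\<delta> / (32 * c)" f x])
      show "0 < \<delta> / (32 * c)" using \<delta> c by simp
      show "f z \<in> cball x (96 * c * (\<delta> / (32 * c)))" if "z \<in> ?K" for z
        using f(3)[OF that] xz[OF that] dist_triangle[of x "f z" z] \<delta> c by (simp add: dist_commute)
      show "?E v u" if "?E u v" for u v using that chain_sym by blast
      show "?E u v" if uv: "u \<in> ?K" "v \<in> ?K" "dist (f u) (f v) \<le> \<delta> / (32 * c)" for u v
      proof -
        have "c * (32 * dist (f u) (f v)) \<le> \<delta>" using uv(3) c by (simp add: field_simps)
        then have "c * (32 * dist (f u) (f v)) \<le> c * (8 * bd (f u))" "c * (32 * dist (f u) (f v)) \<le> c * (8 * bd (f v))"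
          using f(4)[OF uv(1)] f(4)[OF uv(2)] by (auto simp: mult.commute mult.left_commute)
        then have "step (f u) (f v)"
          using c chain_mem[OF f(1)[OF uv(1)]] chain_mem[OF f(1)[OF uv(2)]] by (auto simp: step_def)
        from chain_pad[OF chain_single[OF this], of "cigar_steps c"] show ?thesis
          by (auto simp: cigar_steps_def)
      qed
      fix u assume u: "u \<in> ?K"
      have bu: "0 < bd u" using bdist_pos K(4) u by blast
      have "?E u v" if v: "v \<in> ?K" "dist u v < bd u / 8" for v
      proof -
        have st: "step u v" using v u K(4) by (intro stepI) auto
        \<comment> \<open>Down one carrot, across one step and up the other. The number of steps is
          unbounded as \<open>u\<close> nears the boundary, but the length is at most (12 + 2 + 12)
          (k + 1) \<delta>, where k is \<open>carrot_steps c\<close>; this is all that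
          \<open>cigar_chain\<close> needs.\<close>
        have "chain (\<mu> u + 1 + \<mu> v) ((?k + 1) * (12 * \<delta>) + dist u v + (?k + 1) * (12 * \<delta>)) (f u) (f v)"
          by (intro chain_trans[OF chain_trans[OF chain_sym[OF fl[OF u]] chain_single[OF st]] fl[OF v(1)]])
        moreover have "dist u v \<le> (?k + 1) * (2 * \<delta>)"
        proof -
          have "dist u v \<le> 1 * (2 * \<delta>)" using v(2) bz[OF u] \<delta> by simp
          also have "\<dots> \<le> (?k + 1) * (2 * \<delta>)" using k0 \<delta> by (intro mult_right_mono) auto
          finally show ?thesis .
        qed
        ultimately have "chain (\<mu> u + 1 + \<mu> v) (26 * (?k + 1) * \<delta>) (f u) (f v)"
          by (elim chain_mono) (simp add: algebra_simps)
        then show ?thesis by (rule cigar_chain[OF c f(4)[OF u] f(4)[OF v(1)] \<delta>(1)])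
      qed
      then show "\<exists>e>0. \<forall>v\<in>?K. dist u v < e \<longrightarrow> ?E u v"
        using bu by (intro exI[of _ "bd u / 8"]) auto
    qed
    then obtain m where m: "m \<le> 2 * N (96 * c)" "(x, y) \<in> {(u, v). u \<in> ?K \<and> v \<in> ?K \<and> ?E u v} ^^ m" by blast
    have "\<exists>l. chain (m * cigar_steps c) l (f x) (f v)" if "(x, v) \<in> {(u, v). u \<in> ?K \<and> v \<in> ?K \<and> ?E u v} ^^ m" for v
      using that
    proof (induction m arbitrary: v)
      case 0
      then show ?case using chain_mem[OF f(1)[OF K(2)]] chain_refl[of "f x" 0] by auto
    next
      case (Suc m)
      then obtain u where u: "(x, u) \<in> {(u, v). u \<in> ?K \<and> v \<in> ?K \<and> ?E u v} ^^ m" "?E u v" by auto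
      obtain l1 l2 where "chain (m * cigar_steps c) l1 (f x) (f u)" "chain (cigar_steps c) l2 (f u) (f v)"
        using Suc.IH[OF u(1)] u(2) by blast
      from chain_trans[OF this] show ?case by (auto simp: add.commute)
    qed
    from this[OF m(2)] obtain l where l: "chain (m * cigar_steps c) l (f x) (f y)" by blast
    have "chain (\<mu> x + m * cigar_steps c + \<mu> y) ((?k + 1) * (12 * \<delta>) + l + (?k + 1) * (12 * \<delta>)) x y"
      by (intro chain_trans[OF chain_trans[OF fl[OF K(2)] l] chain_sym[OF fl[OF K(3)]]])
    moreover have "real (\<mu> x + m * cigar_steps c + \<mu> y) \<le> ?C * (j_inner D x y + 1)"
    proof -
      have lnj: "ln (1 + \<delta> / bd z) \<le> j_inner D x y" if "z \<in> {x, y}" for z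
      proof -
        have z: "min (bd x) (bd y) \<le> bd z" "0 < bd z" using that bx by auto
        have "\<delta> / bd z \<le> \<delta> / min (bd x) (bd y)"
          using z bx \<delta> by (intro divide_left_mono) auto
        moreover have "0 \<le> \<delta> / bd z" using z \<delta> by simp
        ultimately show ?thesis
          unfolding j_inner_def \<delta>_def[symmetric] by (subst ln_le_cancel_iff) linarith+
      qed
      have mu: "real (\<mu> z) \<le> ?k * (8 + 2 * j_inner D x y) + 1" if "z \<in> {x, y}" for z
      proof -
        have "?k * (8 + 2 * ln (1 + \<delta> / bd z)) \<le> ?k * (8 + 2 * j_inner D x y)"
          using lnj[OF that] k0 by (intro mult_left_mono) auto
        then show ?thesis using f(2)[of z] that K by auto
      qed
      have "m * cigar_steps c \<le> 2 * N (96 * c) * cigar_steps c" using m(1) by (rule mult_right_mono) simp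
      then have "real (m * cigar_steps c) \<le> real (2 * N (96 * c) * cigar_steps c)" by (rule of_nat_mono)
      then have "real (\<mu> x + m * cigar_steps c + \<mu> y)
          \<le> 2 * (?k * (8 + 2 * j_inner D x y) + 1) + real (2 * N (96 * c) * cigar_steps c)"
        using mu[of x] mu[of y] by simp
      also have "\<dots> \<le> ?C * (j_inner D x y + 1)"
      proof -
        have "0 \<le> real (2 * N (96 * c) * cigar_steps c) * j_inner D x y" "0 \<le> ?k * j_inner D x y"
          using k0 j0 by auto
        then show ?thesis using k0 j0 by (simp add: algebra_simps)
      qed
      finally show ?thesis .
    qed
    ultimately show ?thesis by blast
  qed
qed

end

section \<open>The quasihyperbolic metric\<close>

lemma dist_le_dlength_sub:
  assumes "s \<in> {a..b}" "t \<in> {a..b}"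
  shows "edist (g s) (g t) \<le> elen g a b"
proof -
  have "edist (g (min s t)) (g (max s t)) \<le> elen g (min s t) (max s t)"
    by (rule dist_le_dlength) auto
  also have "\<dots> \<le> elen g a b" using assms by (intro dlength_edist_mono) auto
  finally show ?thesis by (auto simp: min_def max_def dist_commute split: if_splits)
qed

context subdomain
begin

lemma chain_arc:
  assumes "chain m l u v"
  shows "\<exists>g. joining_arc D u v g \<and> elen g 0 1 \<le> ereal l"
proof (cases "u = v")
  case True
  have "0 \<le> l" using rho_le_chain[OF assms] rho_nonneg chain_mem[OF assms] by (meson order_trans)
  then have "elen (linepath u u) 0 1 \<le> ereal l"
    using dlength_linepath[of 0 1 u u] by (auto intro: order_trans)
  then show ?thesis using True joining_arc_const chain_mem[OF assms] by blast
next
  case False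
  obtain p where p: "p 0 = u" "p m = v" "\<And>i. i < m \<Longrightarrow> step (p i) (p (Suc i))"
    "plen p {..<m} \<le> l" using chain_fun[OF assms] by metis
  have "p 0 \<noteq> p m" using p(1,2) False by simp
  then obtain g where g: "joining_arc D (p 0) (p m) g"
    and gt: "\<forall>t\<in>{0..1}. \<exists>i<m. g t \<in> closed_segment (p i) (p (Suc i)) \<and>
       elen g 0 t \<le> ereal (plen p {..i}) \<and> elen g t 1 \<le> ereal (plen p {i..<m})"
    using step_polygon_arc[of m p, OF p(3)] by blast
  have "joining_arc D u v g" using g p(1,2) by simp
  moreover obtain i where i: "elen g 0 1 \<le> ereal (plen p {i..<m})"
    using bspec[OF gt, of 0] by auto
  have "plen p {i..<m} \<le> plen p {..<m}"
    by (rule sum_mono2) auto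
  then have "ereal (plen p {i..<m}) \<le> ereal l" using p(4) by simp
  ultimately show ?thesis using i order_trans by blast
qed

lemma inner_length_le_chain: "chain m l u v \<Longrightarrow> inner_length_metric D u v \<le> ereal l"
  unfolding inner_length_metric_def inner_metric_def
  by (drule chain_arc) (auto intro: INF_lower2 simp: joining_arc_def)

lemma inner_uniform_imp_weakly_uniform:
  assumes "1 \<le> c" "inner_uniform c D"
  shows "weakly_uniform c"
  unfolding weakly_uniform_def
proof (intro ballI)
  fix x y assume "x \<in> D" "y \<in> D"
  then obtain g where g: "joining_arc D x y g"
    "\<And>t. t \<in> {0..1} \<Longrightarrow> min (elen g 0 t) (elen g t 1) \<le> ereal (c * bd (g t))"
    "elen g 0 1 \<le> ereal c * inner_length_metric D x y"
    using assms(2) unfolding inner_uniform_def by blast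
  have "cigar_path c g"
    unfolding cigar_path_def
  proof
    fix t :: real assume "t \<in> {0..1}"
    then consider "elen g 0 t \<le> ereal (c * bd (g t))" | "elen g t 1 \<le> ereal (c * bd (g t))"
      using g(2)[of t] by (auto simp: min_le_iff_disj)
    then show "(\<forall>t1\<in>{0..t}. \<forall>t2\<in>{0..t}. dist (g t1) (g t2) \<le> c * bd (g t)) \<or>
     (\<forall>t1\<in>{t..1}. \<forall>t2\<in>{t..1}. dist (g t1) (g t2) \<le> c * bd (g t))"
    proof cases
      case 1
      then show ?thesis using dist_le_dlength_sub[of _ 0 t _ g] by (meson ereal_less_eq(3) order_trans)
    next
      case 2
      then show ?thesis using dist_le_dlength_sub[of _ t 1 _ g] by (meson ereal_less_eq(3) order_trans)
    qed
  qed
  moreover have "dist (g t1) (g t2) \<le> c * l" if ch: "chain m l x y" and t: "t1 \<in> {0..1}" "t2 \<in> {0..1}" for m l t1 t2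
  proof -
    have "edist (g t1) (g t2) \<le> elen g 0 1" by (rule dist_le_dlength_sub) (use t in auto)
    also have "\<dots> \<le> ereal c * inner_length_metric D x y" by (rule g(3))
    also have "\<dots> \<le> ereal c * ereal l"
      by (rule ereal_mult_left_mono) (use assms inner_length_le_chain[OF ch] in auto)
    finally show ?thesis by simp
  qed
  ultimately show "\<exists>g. path g \<and> path_image g \<subseteq> D \<and> pathstart g = x \<and> pathfinish g = y \<and>
     cigar_path c g \<and> (\<forall>m l. chain m l x y \<longrightarrow> (\<forall>t1\<in>{0..1}. \<forall>t2\<in>{0..1}. dist (g t1) (g t2) \<le> c * l))"
    using g(1) by (intro exI[of _ g]) (auto simp: joining_arc_def joining_path_def rectifiable_def)
qed

lemma diameter_inner_uniform_imp_weakly_uniform: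
  assumes "1 \<le> c" "diameter_inner_uniform c D"
  shows "weakly_uniform c"
  unfolding weakly_uniform_def
proof (intro ballI)
  fix x y assume xy: "x \<in> D" "y \<in> D"
  then obtain g where g: "joining_arc D x y g"
    "\<And>t. t \<in> {0..1} \<Longrightarrow> min (diameter (g ` {0..t})) (diameter (g ` {t..1})) \<le> c * bd (g t)"
    "diameter (path_image g) \<le> c * \<rho> x y"
    using assms(2) unfolding diameter_inner_uniform_def by blast
  have bd: "bounded (g ` I)" if "I \<subseteq> {0..1}" for I
    using joining_arc_bounded[OF g(1)] that unfolding path_image_def by (meson bounded_subset image_mono)
  have "cigar_path c g"
    unfolding cigar_path_def
  proof
    fix t :: real assume t: "t \<in> {0..1}"
    have "dist (g t1) (g t2) \<le> diameter (g ` {0..t})" if "t1 \<in> {0..t}" "t2 \<in> {0..t}" for t1 t2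
      using t that by (intro diameter_bounded_bound bd) auto
    moreover have "dist (g t1) (g t2) \<le> diameter (g ` {t..1})" if "t1 \<in> {t..1}" "t2 \<in> {t..1}" for t1 t2
      using t that by (intro diameter_bounded_bound bd) auto
    moreover have "diameter (g ` {0..t}) \<le> c * bd (g t) \<or> diameter (g ` {t..1}) \<le> c * bd (g t)"
      using g(2)[OF t] by (auto simp: min_le_iff_disj)
    ultimately show "(\<forall>t1\<in>{0..t}. \<forall>t2\<in>{0..t}. dist (g t1) (g t2) \<le> c * bd (g t)) \<or>
     (\<forall>t1\<in>{t..1}. \<forall>t2\<in>{t..1}. dist (g t1) (g t2) \<le> c * bd (g t))" by (meson order_trans)
  qed
  moreover have "dist (g t1) (g t2) \<le> c * l" if ch: "chain m l x y" and t: "t1 \<in> {0..1}" "t2 \<in> {0..1}" for m l t1 t2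
  proof -
    have "dist (g t1) (g t2) \<le> diameter (path_image g)"
      using t joining_arc_bounded[OF g(1)] by (intro diameter_bounded_bound) (auto simp: path_image_def)
    also have "\<dots> \<le> c * \<rho> x y" by (rule g(3))
    also have "\<dots> \<le> c * l" using assms(1) rho_le_chain[OF ch] by (intro mult_left_mono) auto
    finally show ?thesis .
  qed
  ultimately show "\<exists>g. path g \<and> path_image g \<subseteq> D \<and> pathstart g = x \<and> pathfinish g = y \<and>
     cigar_path c g \<and> (\<forall>m l. chain m l x y \<longrightarrow> (\<forall>t1\<in>{0..1}. \<forall>t2\<in>{0..1}. dist (g t1) (g t2) \<le> c * l))"
    using g(1) by (intro exI[of _ g]) (auto simp: joining_arc_def joining_path_def rectifiable_def)
qed

lemma j_inner_nonneg:
  assumes "x \<in> D" "y \<in> D"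
  shows "0 \<le> j_inner D x y"
proof -
  have "0 \<le> \<rho> x y / min (bd x) (bd y)"
    using rho_nonneg[OF assms] bdist_pos[OF assms(1)] bdist_pos[OF assms(2)]
    by (intro divide_nonneg_nonneg) auto
  then show ?thesis unfolding j_inner_def by (intro ln_ge_zero) simp
qed

text \<open>For small \<open>j_inner\<close> the two points form a single step, and the additive constant in
  \<^const>\<open>chain_le_j\<close> can be dropped.\<close>

lemma chain_le_j_bound:
  assumes B: "0 \<le> B" and c: "0 \<le> c" "chain_le_j c" and xy: "x \<in> D" "y \<in> D"
    and chain: "\<And>m l. chain m l x y \<Longrightarrow> K \<le> B * real m"
    and step: "step x y \<Longrightarrow> K \<le> B * (dist x y / bd x)"
  shows "K \<le> B * (11 * c + 2) * j_inner D x y"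
proof -
  define t where "t = \<rho> x y / min (bd x) (bd y)"
  have j: "j_inner D x y = ln (1 + t)" by (simp add: j_inner_def t_def)
  have b: "0 < bd x" "0 < bd y" using bdist_pos xy by auto
  have t0: "0 \<le> t" unfolding t_def using rho_nonneg[OF xy] b by simp
  have j0: "0 \<le> j_inner D x y" by (rule j_inner_nonneg[OF xy])
  \<comment> \<open>Below the threshold 1/8 the points form a step and
    \<open>t \<le> 2 * ln (1 + t)\<close>. Above it \<open>1 \<le> 10 * j_inner D x y\<close>, so
    \<open>j_inner D x y + 1\<close> is at most 11 times \<open>j_inner D x y\<close>. This explains
    \<open>11 * c + 2\<close>.\<close>
  show ?thesis
  proof (cases "t \<le> 1 / 8")
    case True
    have tx: "dist x y / bd x \<le> t"
      unfolding t_def using dist_le_rho[OF xy] rho_nonneg[OF xy] b by (intro frac_le) auto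
    then have "dist x y \<le> t * bd x" using b by (simp add: pos_divide_le_eq)
    also have "\<dots> \<le> 1 / 8 * bd x" using True b by (intro mult_right_mono) auto
    finally have "8 * dist x y \<le> bd x" by simp
    then have "K \<le> B * (dist x y / bd x)" using xy by (intro step stepI)
    also have "\<dots> \<le> B * t" using tx B by (rule mult_left_mono)
    also have "\<dots> \<le> B * (2 * j_inner D x y)"
    proof (rule mult_left_mono[OF _ B])
      have "t - t\<^sup>2 \<le> ln (1 + t)" using t0 True by (intro ln_one_plus_pos_lower_bound) auto
      moreover have "t * t \<le> t * (1 / 8)" using True t0 by (intro mult_left_mono) auto
      ultimately show "t \<le> 2 * j_inner D x y" using t0 unfolding j by (simp add: power2_eq_square)
    qed
    also have "\<dots> = B * 2 * j_inner D x y" by simp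
    also have "\<dots> \<le> B * (11 * c + 2) * j_inner D x y"
      using B c j0 by (intro mult_right_mono mult_left_mono) auto
    finally show ?thesis .
  next
    case False
    have "1 / 10 \<le> ln (1 + 1 / 8 :: real)"
      using ln_one_plus_pos_lower_bound[of "1/8"] by (simp add: power2_eq_square)
    also have "\<dots> \<le> ln (1 + t)" using False by (subst ln_le_cancel_iff) auto
    finally have j1: "1 \<le> 10 * j_inner D x y" unfolding j by simp
    obtain m l where m: "chain m l x y" "real m \<le> c * (j_inner D x y + 1)"
      using c(2) xy unfolding chain_le_j_def by blast
    have "K \<le> B * real m" by (rule chain[OF m(1)])
    also have "\<dots> \<le> B * (c * (j_inner D x y + 1))" using m(2) B by (rule mult_left_mono)
    also have "\<dots> \<le> B * (c * (11 * j_inner D x y))"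
      using B c j1 by (intro mult_left_mono) auto
    also have "\<dots> = B * (11 * c) * j_inner D x y" by simp
    also have "\<dots> \<le> B * (11 * c + 2) * j_inner D x y"
      using B c j0 by (intro mult_right_mono mult_left_mono) auto
    finally show ?thesis .
  qed
qed

abbreviation qh_length :: "(real \<Rightarrow> 'a) \<Rightarrow> real" where
  "qh_length g \<equiv> arclength_integral (\<lambda>z. 1 / bd z) g"

lemma continuous_on_inverse_bdist: "S \<subseteq> D \<Longrightarrow> continuous_on S (\<lambda>z. 1 / bd z)"
proof (intro continuous_on_divide continuous_on_const ballI)
  show "continuous_on S (bd)" unfolding bdist_def by (intro continuous_intros)
  show "bd z \<noteq> 0" if "S \<subseteq> D" "z \<in> S" for z using bdist_pos that by fastforce
qed

lemma qh_length_integrable: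
  assumes "joining_path D u v g"
  shows "(\<lambda>s. 1 / bd (arclength_param g s)) integrable_on {0..len g 1}"
    and "continuous_on {0..len g 1} (\<lambda>s. 1 / bd (arclength_param g s))"
  using arclength_param_integrable[of g "\<lambda>z. 1 / bd z"] continuous_on_inverse_bdist[of "path_image g"] assms
  by (auto simp: joining_path_def)

lemma arclength_param_in_D:
  assumes "joining_path D u v g" "s \<in> {0..len g 1}"
  shows "arclength_param g s \<in> D"
  using arclength_param_mem[of g s] assms by (auto simp: joining_path_def)

lemma qh_length_nonneg:
  assumes "joining_path D u v g"
  shows "0 \<le> qh_length g"
  unfolding arclength_integral_def
  by (rule integral_nonneg[OF qh_length_integrable(1)[OF assms]])
    (use arclength_param_in_D[OF assms] bdist_pos in \<open>auto intro: less_imp_le\<close>)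

lemma quasihyperbolic_le: "joining_path D u v g \<Longrightarrow> quasihyperbolic D u v \<le> qh_length g"
  unfolding quasihyperbolic_def
  by (rule cINF_lower) (auto intro!: bdd_belowI2[of _ 0] qh_length_nonneg)

lemma step_joining_path: "step u v \<Longrightarrow> joining_path D u v (linepath u v)"
  using step_segment[of u v] by (auto simp: joining_path_def rectifiable_linepath)

lemma bdist_step_segment:
  assumes "step u v" "z \<in> closed_segment u v"
  shows "bd u \<le> 2 * bd z"
  using assms(1) dist_in_closed_segment(1)[OF assms(2)] bdist_triangle[of u z] bdist_pos[of u]
  by (auto simp: step_def dist_commute)

lemma qh_length_step:
  assumes st: "step u v"
  shows "qh_length (linepath u v) \<le> 2 * (dist u v / bd u)"
proof -
  let ?g = "linepath u v"
  note jp = step_joining_path[OF st]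
  have u: "0 < bd u" using st bdist_pos by (auto simp: step_def)
  have L: "0 \<le> len ?g 1" "len ?g 1 \<le> dist u v"
  proof -
    show "0 \<le> len ?g 1" using len_mono[OF rectifiable_linepath, of 0 1 u v] by simp
    have "ereal (len ?g 1) \<le> ereal (dist u v * (1 - 0))"
      unfolding dlength_len[OF rectifiable_linepath, of 1 u v, symmetric, simplified] by (rule dlength_linepath) auto
    then show "len ?g 1 \<le> dist u v" by simp
  qed
  have "qh_length ?g \<le> integral {0..len ?g 1} (\<lambda>_. 2 / bd u)"
    unfolding arclength_integral_def
  proof (rule integral_le[OF qh_length_integrable(1)[OF jp]])
    fix s assume s: "s \<in> {0..len ?g 1}"
    then have "arclength_param ?g s \<in> closed_segment u v"
      using arclength_param_mem[OF rectifiable_linepath] by fastforce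
    then have "bd u \<le> 2 * bd (arclength_param ?g s)" by (rule bdist_step_segment[OF st])
    then show "1 / bd (arclength_param ?g s) \<le> 2 / bd u" using u by (simp add: field_simps)
  qed auto
  also have "\<dots> = len ?g 1 * (2 / bd u)" using L by simp
  also have "\<dots> \<le> dist u v * (2 / bd u)" using L u by (intro mult_right_mono) auto
  finally show ?thesis by (simp add: mult.commute)
qed

text \<open>The quasihyperbolic and inner Apollonian metrics are infima over paths, so segments can
  be concatenated without erasing loops. \<open>P\<close> relates the path to its number of
  steps.\<close>

lemma chain_path_induct [consumes 1, case_names const step]:
  assumes "chain m l u v"
    and "\<And>u. u \<in> D \<Longrightarrow> \<exists>g. joining_path D u u g \<and> P g 0"
    and "\<And>u v w g m. step u v \<Longrightarrow> joining_path D v w g \<Longrightarrow> joining_path D u w (linepath u v +++ g) \<Longrightarrow> P g m \<Longrightarrow>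
      P (linepath u v +++ g) (Suc m)"
  shows "\<exists>g. joining_path D u v g \<and> P g m"
  using assms(1)
proof (induction rule: chain.induct)
  case (chain_refl u l)
  then show ?case using assms(2) by blast
next
  case (chain_step u v m l w l')
  then obtain g where g: "joining_path D v w g" "P g m" by blast
  have "joining_path D u w (linepath u v +++ g)"
    using g(1) step_joining_path[OF chain_step(1)] rectifiable_join(1)[OF rectifiable_linepath, of g u v]
    by (auto simp: joining_path_def path_image_join)
  then show ?case using assms(3)[OF chain_step(1) g(1) _ g(2)] by blast
qed

lemma quasihyperbolic_le_chain:
  assumes "chain m l u v"
  shows "quasihyperbolic D u v \<le> 2 * real m"
proof -
  have "\<exists>g. joining_path D u v g \<and> qh_length g \<le> 2 * real m"
    using assms
  proof (induction rule: chain_path_induct)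
    case (const u)
    then show ?case
      using step_joining_path[OF step_refl] qh_length_step[OF step_refl] by force
  next
    case (step u v w g m)
    have "qh_length (linepath u v +++ g) = qh_length (linepath u v) + qh_length g"
    proof (rule arclength_integral_join)
      show "continuous_on (path_image (linepath u v) \<union> path_image g) (\<lambda>z. 1 / bd z)"
        by (rule continuous_on_inverse_bdist)
          (use step_joining_path[OF step(1)] step(2) in \<open>auto simp: joining_path_def\<close>)
    qed (use step(2) in \<open>auto simp: joining_path_def rectifiable_linepath\<close>)
    moreover have "qh_length (linepath u v) \<le> 2 * 1"
    proof -
      have "dist u v / bd u \<le> 1"
        using step(1) bdist_pos[of u] zero_le_dist[of u v] by (auto simp: step_def pos_divide_le_eq simp del: zero_le_dist)
      then show ?thesis using qh_length_step[OF step(1)] by linarith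
    qed
    ultimately show ?case using step(4) by simp
  qed
  then show ?thesis using quasihyperbolic_le by force
qed

lemma quasihyperbolic_le_step: "step u v \<Longrightarrow> quasihyperbolic D u v \<le> 2 * (dist u v / bd u)"
  using quasihyperbolic_le[OF step_joining_path] qh_length_step by force

lemma chain_le_j_imp_quasihyperbolic:
  assumes "0 \<le> c" "chain_le_j c"
  shows "quasihyperbolic_le_j (2 * (11 * c + 2)) D"
  unfolding quasihyperbolic_le_j_def
proof (intro ballI)
  fix x y assume xy: "x \<in> D" "y \<in> D"
  show "quasihyperbolic D x y \<le> 2 * (11 * c + 2) * j_inner D x y"
    using chain_le_j_bound[OF _ assms xy, of 2 "quasihyperbolic D x y"] quasihyperbolic_le_chain quasihyperbolic_le_step
    by auto
qed

text \<open>Points splitting a path into pieces of equal quasihyperbolic length at most \<open>1/10\<close> form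
  a chain.\<close>

lemma qh_length_chain:
  assumes g: "joining_path D u v g"
  shows "\<exists>m l. chain m l u v \<and> real m \<le> 10 * qh_length g + 2"
proof -
  let ?\<gamma> = "arclength_param g" and ?L = "len g 1"
  let ?\<phi> = "\<lambda>s. 1 / bd (?\<gamma> s)"
  have rect: "rectifiable g" "g 0 = u" "g 1 = v" using g by (auto simp: joining_path_def pathstart_def pathfinish_def)
  have L: "0 \<le> ?L" using len_mono[OF rect(1), of 0 1] by simp
  define F where "F s = integral {0..s} ?\<phi>" for s
  have int: "?\<phi> integrable_on {a..b}" if "0 \<le> a" "b \<le> ?L" for a b
    by (rule integrable_on_subinterval[OF qh_length_integrable(1)[OF g]]) (use that in auto)
  have Fdiff: "F b = F a + integral {a..b} ?\<phi>" if "0 \<le> a" "a \<le> b" "b \<le> ?L" for a b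
    unfolding F_def using that int[of 0 b]
    by (intro Henstock_Kurzweil_Integration.integral_combine[symmetric]) auto
  have pos: "0 \<le> ?\<phi> s" if "s \<in> {0..?L}" for s
    using bdist_pos[OF arclength_param_in_D[OF g that]] by simp
  have Fmono: "F a \<le> F b" if "0 \<le> a" "a \<le> b" "b \<le> ?L" for a b
    using Fdiff[OF that] integral_nonneg[OF int[of a b]] pos that by auto
  have st: "step (?\<gamma> a) (?\<gamma> b)" if ab: "0 \<le> a" "a \<le> b" "b \<le> ?L" "F b - F a \<le> 1 / 10" for a b
  proof (rule stepI)
    show aD: "?\<gamma> a \<in> D" "?\<gamma> b \<in> D" using arclength_param_in_D[OF g] ab by auto
    let ?d = "bd (?\<gamma> a)"
    have d: "0 < ?d" by (rule bdist_pos[OF aD(1)])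
    have "8 * (b - a) \<le> ?d"
    proof (rule ccontr)
      \<comment> \<open>Within length d/8 of \<open>?\<gamma> a\<close>, where d is
        \<open>?d\<close>, the boundary distance is at most 9 d/8. The integral over this stretch is
        thus at least 1/9, above the allowed 1/10.\<close>
      assume "\<not> ?thesis"
      then have c: "a + ?d / 8 < b" by simp
      have "1 / 9 = integral {a..a + ?d / 8} (\<lambda>_. 8 / (9 * ?d))" using d by simp
      also have "\<dots> \<le> integral {a..a + ?d / 8} ?\<phi>"
      proof (rule integral_le)
        show "?\<phi> integrable_on {a..a + ?d / 8}" by (rule int) (use ab c in auto)
        fix s assume s: "s \<in> {a..a + ?d / 8}"
        then have sL: "s \<in> {0..?L}" using ab c by auto
        have "dist (?\<gamma> s) (?\<gamma> a) \<le> ?d / 8"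
          using dist_arclength_param[OF rect(1) sL, of a] ab s by auto
        then have "8 * bd (?\<gamma> s) \<le> 9 * ?d" using bdist_triangle[of "?\<gamma> s" "?\<gamma> a"] by simp
        then show "8 / (9 * ?d) \<le> ?\<phi> s"
          using d bdist_pos[OF arclength_param_in_D[OF g sL]] by (simp add: field_simps)
      qed auto
      also have "\<dots> = F (a + ?d / 8) - F a" using Fdiff[of a "a + ?d / 8"] ab c d by simp
      also have "\<dots> \<le> F b - F a" using Fmono[of "a + ?d / 8" b] ab c d by simp
      finally show False using ab by simp
    qed
    then show "8 * dist (?\<gamma> a) (?\<gamma> b) \<le> ?d"
      using dist_arclength_param[OF rect(1), of a b] ab by auto
  qed
  define I where "I = qh_length g"
  have I0: "0 \<le> I" unfolding I_def by (rule qh_length_nonneg[OF g])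
  have F0: "F 0 = 0" "F ?L = I" by (auto simp: F_def I_def arclength_integral_def)
  have Fcont: "continuous_on {0..?L} F"
    unfolding F_def by (rule indefinite_integral_continuous_1) (rule int; simp)
  \<comment> \<open>The added 1 keeps \<open>n\<close> positive when the quasihyperbolic length is
    0.\<close>
  define n where "n = nat \<lceil>10 * I\<rceil> + 1"
  have n: "10 * I \<le> real n" "real n \<le> 10 * I + 2" "0 < n" using I0 unfolding n_def by linarith+
  have "\<exists>s. s \<in> {0..?L} \<and> F s = I * real i / real n \<and> (i = 0 \<longrightarrow> s = 0) \<and> (i = n \<longrightarrow> s = ?L)" if "i \<le> n" for i
  proof -
    consider "i = 0" | "i = n" | "i \<noteq> 0" "i \<noteq> n" by blast
    then show ?thesis
    proof cases
      case 3
      have "I * real i \<le> I * real n" using I0 that by (intro mult_left_mono) auto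
      then have "0 \<le> I * real i / real n" "I * real i / real n \<le> I" using I0 n by (auto simp: pos_divide_le_eq)
      then obtain s where "0 \<le> s" "s \<le> ?L" "F s = I * real i / real n"
        using IVT'[of F 0 _ ?L] Fcont F0 L by auto
      then show ?thesis using 3 by auto
    qed (use F0 L n in \<open>auto intro: exI[of _ 0] exI[of _ ?L]\<close>)
  qed
  then obtain s where s: "\<And>i. i \<le> n \<Longrightarrow> s i \<in> {0..?L}" "\<And>i. i \<le> n \<Longrightarrow> F (s i) = I * real i / real n"
    "s 0 = 0" "s n = ?L" by (metis le0 order_refl)
  have "step (?\<gamma> (s i)) (?\<gamma> (s (Suc i)))" if i: "i < n" for i
  proof -
    have "F (s (Suc i)) - F (s i) = I / real n" using s(2)[of i] s(2)[of "Suc i"] i by (simp add: field_simps)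
    also have "\<dots> \<le> 1 / 10" using n by (simp add: pos_divide_le_eq)
    finally have inc: "F (s (Suc i)) - F (s i) \<le> 1 / 10" .
    have mem: "s i \<in> {0..?L}" "s (Suc i) \<in> {0..?L}" using s(1) i by auto
    show ?thesis
    \<comment> \<open>The parameters come from the intermediate value theorem without any order. If
      they are reversed, the increment of \<open>F\<close> in the other direction is not positive,
      and symmetry of steps suffices.\<close>
    proof (cases "s i \<le> s (Suc i)")
      case True
      then show ?thesis using st[of "s i" "s (Suc i)"] mem inc by auto
    next
      case False
      have "F (s i) \<le> F (s (Suc i))"
        using s(2)[of i] s(2)[of "Suc i"] i I0 by (simp add: divide_right_mono mult_left_mono)
      then have "step (?\<gamma> (s (Suc i))) (?\<gamma> (s i))" using st[of "s (Suc i)" "s i"] mem False by auto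
      then show ?thesis by (rule step_sym)
    qed
  qed
  moreover have "?\<gamma> (s 0) = u" "?\<gamma> (s n) = v"
    using arclength_param_len[OF rect(1), of 0] arclength_param_len[OF rect(1), of 1] s rect by auto
  moreover have "u \<in> D" using g by (auto simp: joining_path_def)
  ultimately have "chain n (\<Sum>i<n. dist (?\<gamma> (s i)) (?\<gamma> (s (Suc i)))) u v"
    using fun_chain[of n "\<lambda>i. ?\<gamma> (s i)"] by auto
  then show ?thesis using n(2) unfolding I_def by blast
qed

lemma quasihyperbolic_imp_chain_le_j:
  assumes c: "0 \<le> c" "quasihyperbolic_le_j c D"
  shows "chain_le_j (10 * c + 12)"
  unfolding chain_le_j_def
proof (intro ballI)
  fix x y assume xy: "x \<in> D" "y \<in> D"
  let ?j = "j_inner D x y"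
  have "{g. joining_path D x y g} \<noteq> {}" using joining_arc_exists[OF xy] by (auto simp: joining_arc_def)
  moreover have "quasihyperbolic D x y < c * ?j + 1" using c(2) xy unfolding quasihyperbolic_le_j_def by force
  ultimately obtain g where g: "joining_path D x y g" "qh_length g < c * ?j + 1"
    unfolding quasihyperbolic_def by (subst (asm) cINF_less_iff) (auto intro!: bdd_belowI2[of _ 0] qh_length_nonneg)
  obtain m l where m: "chain m l x y" "real m \<le> 10 * qh_length g + 2" using qh_length_chain[OF g(1)] by blast
  have "real m \<le> 10 * (c * ?j + 1) + 2" using m(2) g(2) by simp
  also have "\<dots> \<le> (10 * c + 12) * (?j + 1)"
    using c j_inner_nonneg[OF xy] by (simp add: algebra_simps)
  finally show "\<exists>m l. chain m l x y \<and> real m \<le> (10 * c + 12) * (?j + 1)" using m(1) by blast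
qed

section \<open>The inner Apollonian metric\<close>

abbreviation \<alpha> where "\<alpha> \<equiv> apollonian_dist D"

lemma ext_frontier_neq:
  assumes "Some p \<in> ext_frontier D" "x \<in> D"
  shows "p \<noteq> x"
  using assms open_D by (auto simp: ext_frontier_def frontier_def interior_open split: if_splits)

lemma ext_frontier_pos:
  assumes "a \<in> ext_frontier D" "x \<in> D" "y \<in> D"
  shows "0 < dist_ratio a x y"
proof (cases a)
  case (Some p)
  then have "p \<noteq> x" "p \<noteq> y" using ext_frontier_neq assms by blast+
  then show ?thesis using Some by simp
qed simp

lemma ext_frontier_ratio_mult:
  assumes "a \<in> ext_frontier D" "x \<in> D" "y \<in> D" "z \<in> D"
  shows "dist_ratio a x z = dist_ratio a x y * dist_ratio a y z"
proof (cases a)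
  case (Some p)
  then have "p \<noteq> y" "p \<noteq> z" using ext_frontier_neq assms by blast+
  then show ?thesis using Some by simp
qed simp

lemma apollonian_ge:
  assumes "a \<in> ext_frontier D" "b \<in> ext_frontier D"
  shows "ereal (ln (dist_ratio a x y * dist_ratio b y x)) \<le> \<alpha> x y"
  unfolding apollonian_dist_def by (rule SUP_upper2[of "(a, b)"]) (use assms in auto)

lemma apollonian_le:
  assumes "\<And>a b. a \<in> ext_frontier D \<Longrightarrow> b \<in> ext_frontier D \<Longrightarrow> ereal (ln (dist_ratio a x y * dist_ratio b y x)) \<le> B"
  shows "\<alpha> x y \<le> B"
  unfolding apollonian_dist_def by (rule SUP_least) (use assms in auto)

lemma frontier_ext: "p \<in> frontier D \<Longrightarrow> Some p \<in> ext_frontier D"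
  by (simp add: ext_frontier_def)

lemma apollonian_nonneg:
  assumes "x \<in> D" "y \<in> D"
  shows "0 \<le> \<alpha> x y"
proof -
  obtain p where p: "Some p \<in> ext_frontier D" using frontier_nonempty frontier_ext by blast
  have "dist_ratio (Some p) x y * dist_ratio (Some p) y x = 1"
    using ext_frontier_neq[OF p assms(1)] ext_frontier_neq[OF p assms(2)] by simp
  then show ?thesis using apollonian_ge[OF p p, of x y] by (simp add: zero_ereal_def)
qed

lemma apollonian_triangle:
  assumes "x \<in> D" "y \<in> D" "z \<in> D"
  shows "\<alpha> x z \<le> \<alpha> x y + \<alpha> y z"
proof (rule apollonian_le)
  fix a b assume ab: "a \<in> ext_frontier D" "b \<in> ext_frontier D"
  note pos = ext_frontier_pos[OF ab(1) assms(1,2)] ext_frontier_pos[OF ab(1) assms(2,3)]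
    ext_frontier_pos[OF ab(2) assms(3,2)] ext_frontier_pos[OF ab(2) assms(2,1)]
  have "dist_ratio a x z * dist_ratio b z x
     = (dist_ratio a x y * dist_ratio b y x) * (dist_ratio a y z * dist_ratio b z y)"
    using ext_frontier_ratio_mult[OF ab(1) assms] ext_frontier_ratio_mult[OF ab(2) assms(3,2,1)] by simp
  then have "ln (dist_ratio a x z * dist_ratio b z x)
     = ln (dist_ratio a x y * dist_ratio b y x) + ln (dist_ratio a y z * dist_ratio b z y)"
    using pos by (simp add: ln_mult_pos)
  then have "ereal (ln (dist_ratio a x z * dist_ratio b z x))
     = ereal (ln (dist_ratio a x y * dist_ratio b y x)) + ereal (ln (dist_ratio a y z * dist_ratio b z y))"
    by simp
  also have "\<dots> \<le> \<alpha> x y + \<alpha> y z" by (intro add_mono apollonian_ge ab)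
  finally show "ereal (ln (dist_ratio a x z * dist_ratio b z x)) \<le> \<alpha> x y + \<alpha> y z" .
qed

lemma ln_dist_ratio_le:
  assumes "a \<in> ext_frontier D" "x \<in> D" "y \<in> D"
  shows "ln (dist_ratio a x y) \<le> dist x y / bd y"
proof (cases a)
  case None
  then show ?thesis using bdist_pos[OF assms(3)] by simp
next
  case (Some p)
  then have p: "p \<in> frontier D" using assms(1) by (auto simp: ext_frontier_def split: if_splits)
  have b: "0 < bd y" "bd y \<le> dist p y"
    using bdist_pos[OF assms(3)] bdist_le[OF p, of y] by (simp_all add: dist_commute)
  have b0: "0 < dist p y" using b by linarith
  have "ln (dist p x / dist p y) \<le> dist p x / dist p y - 1"
    using ext_frontier_pos[OF assms] Some by (intro ln_le_minus_one) simp
  also have "\<dots> = (dist p x - dist p y) / dist p y"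
    using ext_frontier_neq[of p y] assms Some by (simp add: diff_divide_distrib)
  also have "\<dots> \<le> dist x y / dist p y"
    using b dist_triangle[of p x y] by (intro divide_right_mono) (auto simp: dist_commute)
  also have "\<dots> \<le> dist x y / bd y" using b b0 by (intro divide_left_mono mult_pos_pos) auto
  finally show ?thesis using Some by simp
qed

lemma apollonian_upper:
  assumes "x \<in> D" "y \<in> D"
  shows "\<alpha> x y \<le> ereal (dist x y / bd y + dist x y / bd x)"
proof (rule apollonian_le)
  fix a b assume ab: "a \<in> ext_frontier D" "b \<in> ext_frontier D"
  have "ln (dist_ratio a x y * dist_ratio b y x) = ln (dist_ratio a x y) + ln (dist_ratio b y x)"
    using ext_frontier_pos ab assms by (intro ln_mult_pos) auto
  then show "ereal (ln (dist_ratio a x y * dist_ratio b y x)) \<le> ereal (dist x y / bd y + dist x y / bd x)"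
    using ln_dist_ratio_le[OF ab(1) assms] ln_dist_ratio_le[OF ab(2) assms(2,1)] by (simp add: dist_commute)
qed

text \<open>On the segment the boundary distance is at least half of \<open>bd u\<close>, so each of
  the two terms in \<open>apollonian_upper\<close> contributes 2 to the factor 4.\<close>

lemma apollonian_length_step:
  assumes st: "step u v"
  shows "dlength \<alpha> (linepath u v) 0 1 \<le> ereal (4 * (dist u v / bd u))"
proof -
  let ?M = "4 * (dist u v / bd u)"
  have u: "0 < bd u" using st bdist_pos by (auto simp: step_def)
  have "dlength \<alpha> (linepath u v) 0 1 \<le> ereal (?M * (1 - 0))"
  proof (rule dlength_lipschitz)
    fix s t :: real assume s: "0 \<le> s" "s \<le> t" "t \<le> 1"
    let ?p = "linepath u v s" and ?q = "linepath u v t"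
    have mem: "?p \<in> closed_segment u v" "?q \<in> closed_segment u v" using s by (auto intro: linepath_in_path)
    then have D: "?p \<in> D" "?q \<in> D" using step_segment[OF st] by auto
    have b: "bd u \<le> 2 * bd ?p" "bd u \<le> 2 * bd ?q" using bdist_step_segment[OF st] mem by auto
    have "?p - ?q = (t - s) *\<^sub>R (u - v)" by (simp add: linepath_def algebra_simps)
    then have d: "dist ?p ?q = (t - s) * dist u v" using s by (simp add: dist_norm)
    have frac: "dist ?p ?q / bd w \<le> 2 * (dist u v / bd u) * (t - s)" if "bd u \<le> 2 * bd w" for w
    proof -
      have "dist ?p ?q / bd w \<le> dist ?p ?q / (bd u / 2)" using that u by (intro divide_left_mono) auto
      then show ?thesis unfolding d by (simp add: mult_ac)
    qed
    have "dist ?p ?q / bd ?q + dist ?p ?q / bd ?p \<le> ?M * (t - s)"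
      using frac[OF b(1)] frac[OF b(2)] by simp
    then show "\<alpha> ?p ?q \<le> ereal (?M * (t - s))"
      using apollonian_upper[OF D] by (meson ereal_less_eq(3) order_trans)
  qed
  then show ?thesis by simp
qed

lemma apollonian_length_join:
  assumes "path_image g \<subseteq> D" "path_image h \<subseteq> D" "pathfinish g = pathstart h"
  shows "dlength \<alpha> (g +++ h) 0 1 \<le> dlength \<alpha> g 0 1 + dlength \<alpha> h 0 1"
proof -
  have im: "(g +++ h) ` {0..1} \<subseteq> D"
    using assms path_image_join_subset[of g h] unfolding path_image_def by blast
  have "dlength \<alpha> (g +++ h) 0 1 \<le> dlength \<alpha> (g +++ h) 0 (1/2) + dlength \<alpha> (g +++ h) (1/2) 1"
    by (rule dlength_subadd) (use im apollonian_triangle apollonian_nonneg in \<open>auto simp: image_subset_iff\<close>)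
  then show ?thesis
    using dlength_join_left[of 0 "1/2" \<alpha> g h] dlength_join_right[of "1/2" 1 g h \<alpha>] assms(3) by simp
qed

lemma inner_apollonian_le: "joining_path D u v g \<Longrightarrow> inner_apollonian D u v \<le> dlength \<alpha> g 0 1"
  unfolding inner_apollonian_def inner_metric_def by (rule INF_lower) simp

lemma inner_apollonian_le_chain:
  assumes "chain m l u v"
  shows "inner_apollonian D u v \<le> ereal (4 * real m)"
proof -
  have "\<exists>g. joining_path D u v g \<and> dlength \<alpha> g 0 1 \<le> ereal (4 * real m)"
    using assms
  proof (induction rule: chain_path_induct)
    case (const u)
    then show ?case
      using step_joining_path[OF step_refl] apollonian_length_step[OF step_refl] by force
  next
    case (step u v w g m)
    have "dlength \<alpha> (linepath u v +++ g) 0 1 \<le> dlength \<alpha> (linepath u v) 0 1 + dlength \<alpha> g 0 1"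
      by (rule apollonian_length_join)
        (use step(2) step_joining_path[OF step(1)] in \<open>auto simp: joining_path_def\<close>)
    also have "\<dots> \<le> ereal 4 + ereal (4 * real m)"
    proof (rule add_mono[OF _ step(4)])
      have "dist u v / bd u \<le> 1"
        using step(1) bdist_pos[of u] zero_le_dist[of u v] by (auto simp: step_def pos_divide_le_eq simp del: zero_le_dist)
      then have "ereal (4 * (dist u v / bd u)) \<le> ereal 4" by simp
      then show "dlength \<alpha> (linepath u v) 0 1 \<le> ereal 4" using apollonian_length_step[OF step(1)] by order
    qed
    finally show ?case by (simp add: algebra_simps)
  qed
  then show ?thesis using inner_apollonian_le order_trans by blast
qed

lemma inner_apollonian_le_step:
  "step u v \<Longrightarrow> inner_apollonian D u v \<le> ereal (4 * (dist u v / bd u))"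
  using inner_apollonian_le[OF step_joining_path] apollonian_length_step order_trans by blast

lemma inner_apollonian_nonneg: "0 \<le> inner_apollonian D u v"
  unfolding inner_apollonian_def inner_metric_def
proof (rule INF_greatest)
  fix g assume "g \<in> {g. joining_path D u v g}"
  then have "g ` {0..1} \<subseteq> D" by (auto simp: joining_path_def path_image_def)
  then show "0 \<le> dlength \<alpha> g 0 1" by (intro dlength_nonneg apollonian_nonneg) auto
qed

lemma chain_le_j_imp_inner_apollonian:
  assumes c: "0 \<le> c" "chain_le_j c"
  shows "inner_apollonian_le_j (4 * (11 * c + 2)) D"
  unfolding inner_apollonian_le_j_def
proof (intro ballI)
  fix x y assume xy: "x \<in> D" "y \<in> D"
  obtain m0 l0 where m0: "chain m0 l0 x y" using chain_exists[OF xy] by blast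
  define K where "K = real_of_ereal (inner_apollonian D x y)"
  \<comment> \<open>A chain makes the value finite, so the real-valued
    \<open>chain_le_j_bound\<close> applies.\<close>
  have K: "inner_apollonian D x y = ereal K"
    using inner_apollonian_le_chain[OF m0] inner_apollonian_nonneg[of x y]
    by (cases "inner_apollonian D x y") (auto simp: K_def)
  have "K \<le> 4 * (11 * c + 2) * j_inner D x y"
  proof (rule chain_le_j_bound[OF _ c xy])
    show "K \<le> 4 * real m" if "chain m l x y" for m l
      using inner_apollonian_le_chain[OF that] unfolding K by simp
    show "K \<le> 4 * (dist x y / bd x)" if "step x y"
      using inner_apollonian_le_step[OF that] unfolding K by simp
  qed simp
  then show "inner_apollonian D x y \<le> ereal (4 * (11 * c + 2) * j_inner D x y)" unfolding K by simp
qed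

text \<open>The point is infinity or lies on the ray from \<open>z\<close> through \<open>x\<close>, beyond \<open>x\<close>.\<close>

lemma ext_frontier_behind:
  assumes "x \<in> D"
  obtains a where "a \<in> ext_frontier D" "1 \<le> dist_ratio a z x"
proof (cases "bounded D")
  case False
  then show thesis using that[of None] by (simp add: ext_frontier_def)
next
  case True
  obtain p0 where p0: "p0 \<in> frontier D" using frontier_nonempty by blast
  have out: "x \<notin> frontier D" using assms open_D by (auto simp: frontier_def interior_open)
  show thesis
  proof (cases "x = z")
    case True
    have "p0 \<noteq> x" using p0 out by auto
    then show thesis using that[of "Some p0"] frontier_ext[OF p0] True by simp
  next
    case False
    obtain R where R: "\<And>w. w \<in> D \<Longrightarrow> dist x w \<le> R" using True by (metis bounded_any_center)
    define r where "r = (\<bar>R\<bar> + 1) / dist x z"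
    define w where "w = x + r *\<^sub>R (x - z)"
    have r: "0 < r" using False by (simp add: r_def)
    have "dist x w = \<bar>R\<bar> + 1" using False r by (simp add: w_def dist_norm r_def)
    then have "w \<notin> D" using R[of w] by auto
    then obtain p where p: "p \<in> frontier D" "p \<in> closed_segment x w"
      using connected_Int_frontier[of "closed_segment x w" D] assms by auto
    then obtain s where s: "0 \<le> s" "p = x + (s * r) *\<^sub>R (x - z)"
      by (auto simp: in_segment w_def algebra_simps)
    have "p - z = (1 + s * r) *\<^sub>R (x - z)" "p - x = (s * r) *\<^sub>R (x - z)" using s by (auto simp: algebra_simps)
    then have "dist p z = (1 + s * r) * dist x z" "dist p x = (s * r) * dist x z"
      using s r by (auto simp: dist_norm abs_mult add_nonneg_nonneg)
    then have "dist p x \<le> dist p z" by (simp add: mult_right_mono)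
    moreover have "0 < dist p x" using p(1) out by auto
    ultimately show thesis using that[of "Some p"] frontier_ext[OF p(1)] by (simp add: pos_le_divide_eq)
  qed
qed

text \<open>The finite boundary point \<open>p\<close> supplies the factor 2, and the other boundary
  point is chosen by \<open>ext_frontier_behind\<close> so that its factor is at least 1.\<close>

lemma apollonian_ge_ratio:
  assumes xz: "x \<in> D" "z \<in> D" and p: "p \<in> frontier D"
  shows "2 * dist p z \<le> dist p x \<Longrightarrow> ereal (ln 2) \<le> \<alpha> x z"
    and "2 * dist p x \<le> dist p z \<Longrightarrow> ereal (ln 2) \<le> \<alpha> x z"
proof -
  have pos: "0 < dist p x" "0 < dist p z" using xz p open_D by (auto simp: frontier_def interior_open)
  show "ereal (ln 2) \<le> \<alpha> x z" if "2 * dist p z \<le> dist p x"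
  proof -
    obtain b where b: "b \<in> ext_frontier D" "1 \<le> dist_ratio b z x" using ext_frontier_behind[OF xz(1)] .
    have "2 * 1 \<le> dist_ratio (Some p) x z * dist_ratio b z x"
      using that pos b(2) by (intro mult_mono) (auto simp: pos_le_divide_eq)
    then have "ereal (ln 2) \<le> ereal (ln (dist_ratio (Some p) x z * dist_ratio b z x))" by simp
    also have "\<dots> \<le> \<alpha> x z" by (rule apollonian_ge[OF frontier_ext[OF p] b(1)])
    finally show ?thesis .
  qed
  show "ereal (ln 2) \<le> \<alpha> x z" if "2 * dist p x \<le> dist p z"
  proof -
    obtain b where b: "b \<in> ext_frontier D" "1 \<le> dist_ratio b x z" using ext_frontier_behind[OF xz(2)] .
    have "1 * 2 \<le> dist_ratio b x z * dist_ratio (Some p) z x"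
      using that pos b(2) by (intro mult_mono) (auto simp: pos_le_divide_eq)
    then have "ereal (ln 2) \<le> ereal (ln (dist_ratio b x z * dist_ratio (Some p) z x))" by simp
    also have "\<dots> \<le> \<alpha> x z" by (rule apollonian_ge[OF b(1) frontier_ext[OF p]])
    finally show ?thesis .
  qed
qed

text \<open>The witness is the boundary point nearest to \<open>x\<close> in the first case and
  nearest to \<open>z\<close> in the second; its distances to \<open>x\<close> and \<open>z\<close>
  differ by a factor of at least 2.\<close>

lemma apollonian_lower:
  assumes xz: "x \<in> D" "z \<in> D" and far: "3 * bd x \<le> dist x z \<or> 2 * bd z \<le> bd x"
  shows "ereal (ln 2) \<le> \<alpha> x z"
  using far
proof
  assume f: "3 * bd x \<le> dist x z"
  obtain p where p: "p \<in> frontier D" "bd x = dist x p" by (rule bdist_attained)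
  then have "2 * dist p x \<le> dist p z" using f dist_triangle[of x z p] by (simp add: dist_commute)
  then show ?thesis by (rule apollonian_ge_ratio(2)[OF xz p(1)])
next
  assume f: "2 * bd z \<le> bd x"
  obtain p where p: "p \<in> frontier D" "bd z = dist z p" by (rule bdist_attained)
  then have "2 * dist p z \<le> dist p x" using f bdist_le[OF p(1), of x] by (simp add: dist_commute)
  then show ?thesis by (rule apollonian_ge_ratio(1)[OF xz p(1)])
qed

text \<open>With \<open>s = bd (g a) / 2\<close> the piece stays at distance \<open>s\<close> from
  the boundary and within \<open>6 * s\<close> of \<open>g a\<close>, which gives
  \<open>N 24\<close>.\<close>

lemma apollonian_piece:
  fixes a b :: real
  assumes g: "continuous_on {a..b} g" "g ` {a..b} \<subseteq> D" "a \<le> b"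
  and near: "\<And>t. t \<in> {a..b} \<Longrightarrow> dist (g a) (g t) \<le> 3 * bd (g a)"
      "\<And>t. t \<in> {a..b} \<Longrightarrow> bd (g a) \<le> 2 * bd (g t)"
  shows "\<exists>l. chain (2 * N 24) l (g a) (g b)"
proof -
  have "g a \<in> D" using g by auto
  then have d: "0 < bd (g a)" by (rule bdist_pos)
  have "chain (2 * N (4 * 6)) (real (2 * N (4 * 6)) * (bd (g a) / 2)) (g a) (g b)"
  proof (rule cover_chain[of "g ` {a..b}" _ _ "g a"])
    show "connected (g ` {a..b})" by (intro connected_continuous_image g) simp
    show "g ` {a..b} \<subseteq> cball (g a) (6 * (bd (g a) / 2))" using near(1) by auto
    fix z assume "z \<in> g ` {a..b}"
    then show "bd (g a) / 2 \<le> bd z" using near(2) by fastforce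
  qed (use g d in auto)
  then show ?thesis by auto
qed

lemma apollonian_split:
  assumes g: "continuous_on {a..1} g" "g ` {a..1} \<subseteq> D" "a \<le> (1::real)"
  shows "(\<exists>l. chain (2 * N 24) l (g a) (g 1)) \<or>
    (\<exists>b\<in>{a..1}. (\<exists>l. chain (2 * N 24) l (g a) (g b)) \<and> ereal (ln 2) + dlength \<alpha> g b 1 \<le> dlength \<alpha> g a 1)"
proof -
  have gD: "g t \<in> D" if "t \<in> {a..1}" for t using g(2) that by auto
  have d: "0 < bd (g a)" using bdist_pos gD g(3) by auto
  \<comment> \<open>Both conditions of \<open>apollonian_piece\<close> hold where
    \<open>h \<le> 1\<close>, and \<open>h = 1\<close> gives one of the two alternatives of
    \<open>apollonian_lower\<close>. Cutting at the first time with \<open>h = 1\<close> thus serves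
    both lemmas.\<close>
  define h where "h t = max (dist (g a) (g t) / (3 * bd (g a))) (bd (g a) / (2 * bd (g t)))" for t
  have nz: "\<forall>t\<in>{a..1}. 2 * bd (g t) \<noteq> 0"
  proof
    fix t assume "t \<in> {a..1}"
    then have "0 < bd (g t)" by (intro bdist_pos gD)
    then show "2 * bd (g t) \<noteq> 0" by simp
  qed
  have cb: "continuous_on {a..1} (\<lambda>t. bd (g t))"
    unfolding bdist_def by (intro continuous_intros g(1))
  have h: "continuous_on {a..1} h"
    unfolding h_def
    by (intro continuous_on_max continuous_on_divide[OF _ _ nz] continuous_on_divide continuous_intros cb g(1))
      (use d in auto)
  have near: "dist (g a) (g t) \<le> 3 * bd (g a)" "bd (g a) \<le> 2 * bd (g t)"
    if "t \<in> {a..1}" "h t \<le> 1" for t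
    using that(2) d bdist_pos[OF gD[OF that(1)]] by (auto simp: h_def pos_divide_le_eq)
  have ha: "h a \<le> 1" using d by (simp add: h_def)
  show ?thesis
  proof (cases "\<exists>t\<in>{a..1}. 1 \<le> h t")
    case False
    then have "\<And>t. t \<in> {a..1} \<Longrightarrow> h t \<le> 1" by (meson le_cases)
    then show ?thesis using apollonian_piece[OF g] near by blast
  next
    case True
    then obtain t0 where t0: "t0 \<in> {a..1}" "1 \<le> h t0" by blast
    have "continuous_on {a..t0} h" by (rule continuous_on_subset[OF h]) (use t0 in auto)
    then obtain b where b: "b \<in> {a..t0}" "h b = 1" "\<And>t. t \<in> {a..b} \<Longrightarrow> h t \<le> 1"
      by (rule first_hit[of a t0 h 1]) (use t0 ha in auto)
    have b1: "a \<le> b" "b \<le> 1" "b \<in> {a..1}" using b(1) t0 by auto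
    have "\<exists>l. chain (2 * N 24) l (g a) (g b)"
      by (rule apollonian_piece[OF continuous_on_subset[OF g(1)]]) (use b1 b(3) near g(2) in \<open>auto simp: image_subset_iff\<close>)
    moreover have "ereal (ln 2) \<le> \<alpha> (g a) (g b)"
    proof (rule apollonian_lower)
      have bb: "0 < bd (g b)" by (intro bdist_pos gD b1)
      have "dist (g a) (g b) / (3 * bd (g a)) = 1 \<or> bd (g a) / (2 * bd (g b)) = 1"
        using b(2) unfolding h_def by (auto simp: max_def split: if_splits)
      then show "3 * bd (g a) \<le> dist (g a) (g b) \<or> 2 * bd (g b) \<le> bd (g a)"
        using d bb by (auto simp: divide_eq_1_iff)
    qed (use gD g(3) b1 in auto)
    moreover have "\<alpha> (g a) (g b) \<le> dlength \<alpha> g a b"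
    proof (rule dlength_ge)
      \<comment> \<open>The value at the start is 1/2, so the piece is not degenerate.\<close>
      have "h a \<noteq> 1" using d by (simp add: h_def)
      then have "a \<noteq> b" using b(2) by auto
      then show "a < b" using b1 by simp
    qed
    moreover have "dlength \<alpha> g a b + dlength \<alpha> g b 1 \<le> dlength \<alpha> g a 1"
      by (rule dlength_superadd) (use b1 gD apollonian_nonneg in auto)
    ultimately show ?thesis using b1 by (meson add_right_mono order_trans)
  qed
qed

text \<open>Every cut consumes ln 2 of the Apollonian length, so \<open>n\<close> cuts leave at most
  one further piece; for \<open>n = 0\<close> no cut can occur.\<close>

lemma apollonian_length_chain:
  assumes g: "continuous_on {a..1} g" "g ` {a..1} \<subseteq> D" "a \<le> 1"
    and len: "dlength \<alpha> g a 1 \<le> ereal (real n * ln 2)"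
  shows "\<exists>l. chain ((n + 1) * (2 * N 24)) l (g a) (g 1)"
  using g len
proof (induction n arbitrary: a)
  case 0
  from apollonian_split[OF 0(1-3)] show ?case
  proof
    assume "\<exists>b\<in>{a..1}. (\<exists>l. chain (2 * N 24) l (g a) (g b)) \<and> ereal (ln 2) + dlength \<alpha> g b 1 \<le> dlength \<alpha> g a 1"
    then obtain b where b: "b \<in> {a..1}" "ereal (ln 2) + dlength \<alpha> g b 1 \<le> dlength \<alpha> g a 1" by blast
    have "0 \<le> dlength \<alpha> g b 1"
      by (rule dlength_nonneg) (use b 0(2) apollonian_nonneg in \<open>auto simp: image_subset_iff\<close>)
    then have "ereal (ln 2) + 0 \<le> ereal (ln 2) + dlength \<alpha> g b 1" by (rule add_left_mono)
    with b(2) 0(4) have "ereal (ln 2) + 0 \<le> ereal (real 0 * ln 2)" by order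
    then show ?thesis by simp
  qed auto
next
  case (Suc n)
  from apollonian_split[OF Suc.prems(1-3)] show ?case
  proof
    assume "\<exists>l. chain (2 * N 24) l (g a) (g 1)"
    then obtain l where "chain (2 * N 24) l (g a) (g 1)" by blast
    from chain_pad[OF this, of "(Suc n + 1) * (2 * N 24)"] show ?thesis by auto
  next
    assume "\<exists>b\<in>{a..1}. (\<exists>l. chain (2 * N 24) l (g a) (g b)) \<and> ereal (ln 2) + dlength \<alpha> g b 1 \<le> dlength \<alpha> g a 1"
    then obtain b l where b: "b \<in> {a..1}" "chain (2 * N 24) l (g a) (g b)"
      "ereal (ln 2) + dlength \<alpha> g b 1 \<le> dlength \<alpha> g a 1" by blast
    have "ereal (ln 2) + dlength \<alpha> g b 1 \<le> ereal (real (Suc n) * ln 2)" using b(3) Suc.prems(4) by order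
    then have "dlength \<alpha> g b 1 \<le> ereal (real n * ln 2)"
      by (cases "dlength \<alpha> g b 1") (auto simp: algebra_simps)
    moreover have "continuous_on {b..1} g" by (rule continuous_on_subset[OF Suc.prems(1)]) (use b in auto)
    moreover have "g ` {b..1} \<subseteq> D" using Suc.prems(2) b(1) by (auto simp: image_subset_iff)
    ultimately obtain l' where "chain ((n + 1) * (2 * N 24)) l' (g b) (g 1)" using Suc.IH[of b] b(1) by auto
    from chain_trans[OF b(2) this] show ?thesis by auto
  qed
qed

lemma inner_apollonian_imp_chain_le_j:
  assumes c: "0 \<le> c" "inner_apollonian_le_j c D"
  shows "chain_le_j (real (2 * N 24) * (2 * c + 4))"
  unfolding chain_le_j_def
proof (intro ballI)
  fix x y assume xy: "x \<in> D" "y \<in> D"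
  let ?j = "j_inner D x y"
  have j0: "0 \<le> ?j" by (rule j_inner_nonneg[OF xy])
  have "inner_apollonian D x y \<le> ereal (c * ?j)" using c(2) xy unfolding inner_apollonian_le_j_def by blast
  also have "\<dots> < ereal (c * ?j + 1)" by simp
  finally obtain g where g: "joining_path D x y g" "dlength \<alpha> g 0 1 < ereal (c * ?j + 1)"
    unfolding inner_apollonian_def inner_metric_def by (auto simp: INF_less_iff)
  \<comment> \<open>The factor 2 compensates for ln 2, of which only ln 2 \<ge> 1/2 is used.\<close>
  define n where "n = nat \<lceil>2 * (c * ?j + 1)\<rceil>"
  have n: "2 * (c * ?j + 1) \<le> real n" "real n \<le> 2 * (c * ?j + 1) + 1"
  proof -
    have "0 \<le> c * ?j" using c(1) j0 by simp
    then have "0 \<le> \<lceil>2 * (c * ?j + 1)\<rceil>" by (simp add: zero_le_ceiling)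
    then have "real n = real_of_int \<lceil>2 * (c * ?j + 1)\<rceil>" unfolding n_def by simp
    then show "2 * (c * ?j + 1) \<le> real n" "real n \<le> 2 * (c * ?j + 1) + 1" by linarith+
  qed
  have "(c * ?j + 1) \<le> real n * (1 / 2)" using n(1) by simp
  also have "\<dots> \<le> real n * ln 2" using ln2_ge_two_thirds by (intro mult_left_mono) auto
  finally have "dlength \<alpha> g 0 1 \<le> ereal (real n * ln 2)"
    using g(2) by (meson ereal_less_eq(3) less_imp_le order_trans)
  then obtain l where l: "chain ((n + 1) * (2 * N 24)) l (g 0) (g 1)"
    using apollonian_length_chain[of 0 g n] g(1)
    by (auto simp: joining_path_def rectifiable_def path_def path_image_def)
  moreover have "g 0 = x" "g 1 = y" using g(1) by (auto simp: joining_path_def pathstart_def pathfinish_def)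
  moreover have "real ((n + 1) * (2 * N 24)) \<le> real (2 * N 24) * (2 * c + 4) * (?j + 1)"
  proof -
    have "real n + 1 \<le> (2 * c + 4) * (?j + 1)" using n(2) c(1) j0 by (simp add: algebra_simps)
    then have "real (2 * N 24) * (real n + 1) \<le> real (2 * N 24) * ((2 * c + 4) * (?j + 1))" by (rule mult_left_mono) simp
    then show ?thesis by (simp add: algebra_simps)
  qed
  ultimately show "\<exists>m l. chain m l x y \<and> real m \<le> real (2 * N 24) * (2 * c + 4) * (?j + 1)" by auto
qed

end

section \<open>Quantitative equivalence of the four conditions\<close>

lemma (in subdomain) chain_le_j_mono:
  assumes "chain_le_j c" "c \<le> c'"
  shows "chain_le_j c'"
  unfolding chain_le_j_def
proof (intro ballI)
  fix x y assume xy: "x \<in> D" "y \<in> D"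
  then obtain m l where m: "chain m l x y" "real m \<le> c * (j_inner D x y + 1)"
    using assms(1) unfolding chain_le_j_def by blast
  note m(2)
  also have "c * (j_inner D x y + 1) \<le> c' * (j_inner D x y + 1)"
    using assms(2) j_inner_nonneg[OF xy] by (intro mult_right_mono) auto
  finally show "\<exists>m l. chain m l x y \<and> real m \<le> c' * (j_inner D x y + 1)" using m(1) by blast
qed

abbreviation uniformity_conditions :: "(real \<Rightarrow> 'a::euclidean_space set \<Rightarrow> bool) set" where
  "uniformity_conditions \<equiv> {inner_uniform, quasihyperbolic_le_j, inner_apollonian_le_j, diameter_inner_uniform}"

text \<open>The constant is fixed before the domain. The maximum of the constants of three
  reductions works for every \<open>P\<close>, since the two uniformity conditions share the
  reduction through \<open>weakly_uniform\<close>.\<close>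

lemma chain_le_j_of_condition:
  assumes P: "P \<in> uniformity_conditions"
    and c: "1 < c" and N: "separation_bound N TYPE('a::euclidean_space)"
  shows "\<exists>c'>1. \<forall>D::'a set. proper_subdomain D \<and> P c D \<longrightarrow> subdomain.chain_le_j D c'"
proof -
  have sub: "subdomain D N" if "proper_subdomain D" for D :: "'a set"
    using that N by unfold_locales
  let ?w = "20 * subdomain.carrot_steps N c + 3 + real (2 * N (96 * c) * subdomain.cigar_steps N c)"
  let ?c' = "max ?w (max (10 * c + 12) (real (2 * N 24) * (2 * c + 4)))"
  have "subdomain.chain_le_j D ?c'" if D: "proper_subdomain D" "P c D" for D
  proof -
    interpret subdomain D N by (rule sub[OF D(1)])
    consider "P = inner_uniform" | "P = quasihyperbolic_le_j" | "P = inner_apollonian_le_j" | "P = diameter_inner_uniform"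
      using P by blast
    then show ?thesis
    proof cases
      case 1
      then show ?thesis
        using weakly_uniform_imp_chain_le_j inner_uniform_imp_weakly_uniform chain_le_j_mono c D(2)
        by (meson less_imp_le max.cobounded1)
    next
      case 2
      have "chain_le_j (10 * c + 12)" using quasihyperbolic_imp_chain_le_j[of c] 2 c D(2) by simp
      then show ?thesis by (rule chain_le_j_mono) auto
    next
      case 3
      have "chain_le_j (real (2 * N 24) * (2 * c + 4))" using inner_apollonian_imp_chain_le_j[of c] 3 c D(2) by simp
      then show ?thesis by (rule chain_le_j_mono) auto
    next
      case 4
      then show ?thesis
        using weakly_uniform_imp_chain_le_j diameter_inner_uniform_imp_weakly_uniform chain_le_j_mono c D(2)
        by (meson less_imp_le max.cobounded1)
    qed
  qed
  moreover have "1 < ?c'" using c by (simp add: less_max_iff_disj)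
  ultimately show ?thesis by blast
qed

lemma condition_of_chain_le_j:
  assumes Q: "Q \<in> uniformity_conditions"
    and c: "1 < c" and N: "separation_bound N TYPE('a::euclidean_space)"
  shows "\<exists>c'>1. \<forall>D::'a set. proper_subdomain D \<and> subdomain.chain_le_j D c \<longrightarrow> Q c' D"
proof -
  have sub: "subdomain D N" if "proper_subdomain D" for D :: "'a set"
    using that N by unfold_locales
  have "seq_B c > 0" "seq_C c 5 \<ge> 0"
    by (auto simp: seq_B_def seq_C_def seq_G_def intro!: mult_pos_pos add_nonneg_pos)
  then have u: "1 < 2 * seq_B c + seq_C c 5 + 1" by simp
  consider "Q = inner_uniform" | "Q = quasihyperbolic_le_j" | "Q = inner_apollonian_le_j" | "Q = diameter_inner_uniform"
    using Q by blast
  then show ?thesis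
  proof cases
    case 1
    then show ?thesis using u subdomain.chain_le_j_imp_inner_uniform(1)[OF sub, of _ c] c
      by (intro exI[of _ "2 * seq_B c + seq_C c 5 + 1"]) auto
  next
    case 2
    then show ?thesis using subdomain.chain_le_j_imp_quasihyperbolic[OF sub, of _ c] c
      by (intro exI[of _ "2 * (11 * c + 2)"]) auto
  next
    case 3
    then show ?thesis using subdomain.chain_le_j_imp_inner_apollonian[OF sub, of _ c] c
      by (intro exI[of _ "4 * (11 * c + 2)"]) auto
  next
    case 4
    then show ?thesis using u subdomain.chain_le_j_imp_inner_uniform(2)[OF sub, of _ c] c
      by (intro exI[of _ "2 * seq_B c + seq_C c 5 + 1"]) auto
  qed
qed

theorem theorem1:
  assumes "CARD('n::finite) \<ge> 2"
  shows "\<forall>P \<in> {inner_uniform, quasihyperbolic_le_j, inner_apollonian_le_j, diameter_inner_uniform}.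
         \<forall>Q \<in> {inner_uniform, quasihyperbolic_le_j, inner_apollonian_le_j, diameter_inner_uniform}.
         \<forall>c>1. \<exists>c'>1. \<forall>D :: (real ^ 'n) set.
           proper_subdomain D \<and> apollonian_domain D \<and> P c D \<longrightarrow> Q c' D"
proof (intro ballI allI impI)
  fix P Q :: "real \<Rightarrow> (real ^ 'n) set \<Rightarrow> bool" and c :: real
  assume P: "P \<in> uniformity_conditions"
    and Q: "Q \<in> uniformity_conditions"
    and c: "1 < c"
  obtain N where N: "separation_bound N TYPE(real ^ 'n)" using separation_bound_exists by blast
  obtain c1 where c1: "1 < c1" "\<And>D. proper_subdomain D \<Longrightarrow> P c D \<Longrightarrow> subdomain.chain_le_j D c1"
    using chain_le_j_of_condition[OF P c N] by blast
  obtain c2 where c2: "1 < c2" "\<And>D. proper_subdomain D \<Longrightarrow> subdomain.chain_le_j D c1 \<Longrightarrow> Q c2 D"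
    using condition_of_chain_le_j[OF Q c1(1) N] by blast
  show "\<exists>c'>1. \<forall>D. proper_subdomain D \<and> apollonian_domain D \<and> P c D \<longrightarrow> Q c' D"
    using c1 c2 by blast
qed

end
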